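(* Let $0<s<1$, $a=1-2s$ and $u\in\mathscr S(\mathbb R^n)$. The function $$U(x,z)=\int_{\mathbb R^n}K^{(a)}_z(x,y)\,u(y)\,dy,\qquad x\in\mathbb R^n,\ z>0,$$ solves the extension problem $\mathscr L_aU=0$, $U(x,0)=u(x)$, in the sense that $\mathscr L_aU=0$ in $\mathbb R^{n+1}_+$, and in $L^2(\mathbb R^n)$ $$\lim_{z\to0^+}U(\cdot,z)=u.$$
   Context: Let $n\ge3$ and let $\mathscr X=\{X_1,\dots,X_m\}$ be $C^\infty$ vector fields on $\mathbb R^n$ satisfying Hörmander's finite rank condition $\operatorname{rank}\operatorname{Lie}[X_1,\dots,X_m](x)=n$ at every $x\in\mathbb R^n$, with sub-Laplacean $\mathscr L=-\sum_{i=1}^mX_i^\star X_i$ ($X_i^\star$ the formal adjoint). It is assumed that outside a large compact set $\mathscr L$ coincides with the standard Laplacian. Let $d$ be the Carnot-Carathéodory distance of $\mathscr X$: $d(x,y)=\inf T$ over piecewise $C^1$ curves $\gamma:[0,T]\to\mathbb R^n$ with $\gamma(0)=x,\gamma(T)=y$ and $\gamma'=\sum_ia_i(t)X_i(\gamma)$ with $a_i$ piecewise continuous, $\sum_i|a_i|\le1$; $B(x,r)$ are its balls and $|B(x,r)|$ their Lebesgue measure. The heat operator $\mathscr H=\partial_t-\mathscr L$ admits a positive fundamental solution $p(x,t;\xi,\tau)=p(x,\xi;t-\tau)$, smooth in $\mathbb R^{n+1}\setminus\{(\xi,\tau)\}$; $p(x,y,t)$ denotes it with $\tau=0$. Recalled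 facts: there is $M>0$ such that for all $k,j\ge 0$ one has $|\partial_t^kX_{j_1}\cdots X_{j_j}p(x,y,t)|\le\frac{C}{t^{k+j/2}|B(x,\sqrt t)|}e^{-Md(x,y)^2/t}$ with $C=C(\mathscr X,k,j)$, and $p(x,y,t)\ge\frac{C^{-1}}{|B(x,\sqrt t)|}e^{-M^{-1}d(x,y)^2/t}$; moreover $\int_{\mathbb R^n}p(x,y,t)\,dy=1$. $\mathbb R^{n+1}_+=\{(x,z):x\in\mathbb R^n,z>0\}$; $\mathscr S(\mathbb R^n)$ is the Schwartz class; $\mathscr B_a=\frac{\partial^2}{\partial z^2}+\frac az\frac{\partial}{\partial z}$; the extension operator is $\mathscr L_a=z^a(\mathscr L+\mathscr B_a)$, with $\mathscr L$ acting in $x$. Its Poisson kernel is $$K^{(a)}_z(x,y)=\frac{1}{2^{1-a}\Gamma(\frac{1-a}2)}\,z^{1-a}\int_0^\infty\frac{e^{-\frac{z^2}{4t}}}{t^{\frac{3-a}2}}\,p(x,y,t)\,dt,$$ where $\Gamma(\cdot)$ is Euler's gamma function. *)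

theory Defs
  imports "HOL-Analysis.Analysis"
begin

section \<open>Smooth functions\<close>

text \<open>Intended for open sets, where within-set and full derivatives agree.\<close>

fun C_k_on :: "nat \<Rightarrow> ('a::euclidean_space \<Rightarrow> 'b::real_normed_vector) \<Rightarrow> 'a set \<Rightarrow> bool" where
  "C_k_on 0 f S \<longleftrightarrow> continuous_on S f"
| "C_k_on (Suc k) f S \<longleftrightarrow>
     f differentiable_on S \<and> (\<forall>b\<in>Basis. C_k_on k (\<lambda>x. frechet_derivative f (at x) b) S)"

definition smooth_on :: "('a::euclidean_space \<Rightarrow> 'b::real_normed_vector) \<Rightarrow> 'a set \<Rightarrow> bool" where
  "smooth_on f S \<longleftrightarrow> (\<forall>k. C_k_on k f S)"

definition pderivs :: "'a list \<Rightarrow> ('a::euclidean_space \<Rightarrow> real) \<Rightarrow> 'a \<Rightarrow> real" where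
  "pderivs bs f = foldr (\<lambda>b g x. frechet_derivative g (at x) b) bs f"

definition schwartz :: "('a::euclidean_space \<Rightarrow> real) \<Rightarrow> bool" where
  "schwartz u \<longleftrightarrow> smooth_on u UNIV \<and>
     (\<forall>k::nat. \<forall>bs\<in>lists Basis. bounded (range (\<lambda>x. norm x ^ k * pderivs bs u x)))"

definition test_function :: "('a::euclidean_space \<Rightarrow> real) \<Rightarrow> bool" where
  "test_function \<phi> \<longleftrightarrow> smooth_on \<phi> UNIV \<and> (\<exists>K. compact K \<and> (\<forall>x. x \<notin> K \<longrightarrow> \<phi> x = 0))"

section \<open>Vector fields and the sub-Laplacian\<close>

definition vf_deriv :: "('a::euclidean_space \<Rightarrow> 'a) \<Rightarrow> ('a \<Rightarrow> real) \<Rightarrow> 'a \<Rightarrow> real" where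
  "vf_deriv X f x = frechet_derivative f (at x) (X x)"

text \<open>Integration by parts against test functions gives \<open>X\<^sup>\<star> g = - div (g X)\<close>.\<close>

definition vf_adjoint :: "('a::euclidean_space \<Rightarrow> 'a) \<Rightarrow> ('a \<Rightarrow> real) \<Rightarrow> 'a \<Rightarrow> real" where
  "vf_adjoint X g x = - (\<Sum>b\<in>Basis. frechet_derivative (\<lambda>y. g y * (X y \<bullet> b)) (at x) b)"

definition vf_word :: "('m \<Rightarrow> 'a::euclidean_space \<Rightarrow> 'a) \<Rightarrow> 'm list \<Rightarrow> ('a \<Rightarrow> real) \<Rightarrow> 'a \<Rightarrow> real" where
  "vf_word X js f = foldr (\<lambda>j. vf_deriv (X j)) js f"

definition lie_bracket :: "('a::euclidean_space \<Rightarrow> 'a) \<Rightarrow> ('a \<Rightarrow> 'a) \<Rightarrow> 'a \<Rightarrow> 'a" where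
  "lie_bracket V W x = frechet_derivative W (at x) (V x) - frechet_derivative V (at x) (W x)"

inductive_set lie_algebra :: "('m \<Rightarrow> 'a::euclidean_space \<Rightarrow> 'a) \<Rightarrow> ('a \<Rightarrow> 'a) set"
  for X :: "'m \<Rightarrow> 'a \<Rightarrow> 'a" where
  gen: "X i \<in> lie_algebra X"
| add: "V \<in> lie_algebra X \<Longrightarrow> W \<in> lie_algebra X \<Longrightarrow> (\<lambda>x. V x + W x) \<in> lie_algebra X"
| scale: "V \<in> lie_algebra X \<Longrightarrow> (\<lambda>x. c *\<^sub>R V x) \<in> lie_algebra X"
| bracket: "V \<in> lie_algebra X \<Longrightarrow> W \<in> lie_algebra X \<Longrightarrow> lie_bracket V W \<in> lie_algebra X"

definition hormander :: "('m \<Rightarrow> 'a::euclidean_space \<Rightarrow> 'a) \<Rightarrow> bool" where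
  "hormander X \<longleftrightarrow> (\<forall>x. dim ((\<lambda>V. V x) ` lie_algebra X) = DIM('a))"

definition sub_laplacian :: "('m::finite \<Rightarrow> 'a::euclidean_space \<Rightarrow> 'a) \<Rightarrow> ('a \<Rightarrow> real) \<Rightarrow> 'a \<Rightarrow> real" where
  "sub_laplacian X f x = - (\<Sum>i\<in>UNIV. vf_adjoint (X i) (vf_deriv (X i) f) x)"

definition laplacian :: "('a::euclidean_space \<Rightarrow> real) \<Rightarrow> 'a \<Rightarrow> real" where
  "laplacian f x = (\<Sum>b\<in>Basis. pderivs [b, b] f x)"

definition laplacian_off_compact :: "('m::finite \<Rightarrow> 'a::euclidean_space \<Rightarrow> 'a) \<Rightarrow> bool" where
  "laplacian_off_compact X \<longleftrightarrow>
     (\<exists>K. compact K \<and> (\<forall>f. smooth_on f UNIV \<longrightarrow> (\<forall>x. x \<notin> K \<longrightarrow> sub_laplacian X f x = laplacian f x)))"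

section \<open>Carnot-Caratheodory distance\<close>

definition piecewise_continuous_on :: "real \<Rightarrow> real \<Rightarrow> (real \<Rightarrow> real) \<Rightarrow> bool" where
  "piecewise_continuous_on c d f \<longleftrightarrow>
     (\<exists>S. finite S \<and> continuous_on ({c..d} - S) f) \<and>
     (\<forall>t\<in>{c<..d}. \<exists>l. (f \<longlongrightarrow> l) (at_left t)) \<and>
     (\<forall>t\<in>{c..<d}. \<exists>l. (f \<longlongrightarrow> l) (at_right t))"

text \<open>The derivative condition is imposed off a finite set. The one-sided limits of the coefficients
  then give one-sided limits of \<open>\<gamma>'\<close>, which the library's piecewise \<open>C\<^sup>1\<close> does not ask for.\<close>

definition subunit_curve ::
    "('m::finite \<Rightarrow> 'a::euclidean_space \<Rightarrow> 'a) \<Rightarrow> 'a \<Rightarrow> 'a \<Rightarrow> real \<Rightarrow> (real \<Rightarrow> 'a) \<Rightarrow> bool" where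
  "subunit_curve X x y T \<gamma> \<longleftrightarrow>
     0 \<le> T \<and> \<gamma> piecewise_C1_differentiable_on {0..T} \<and> \<gamma> 0 = x \<and> \<gamma> T = y \<and>
     (\<exists>a :: 'm \<Rightarrow> real \<Rightarrow> real.
        (\<forall>i. piecewise_continuous_on 0 T (a i)) \<and>
        (\<forall>t\<in>{0..T}. (\<Sum>i\<in>UNIV. \<bar>a i t\<bar>) \<le> 1) \<and>
        (\<exists>S. finite S \<and> (\<forall>t\<in>{0..T} - S.
           (\<gamma> has_vector_derivative (\<Sum>i\<in>UNIV. a i t *\<^sub>R X i (\<gamma> t))) (at t within {0..T}))))"

text \<open>Extended-real valued, so that the infimum over an empty set of curves is \<open>\<infinity>\<close>; under
  Hoermander's condition it is finite (Chow's theorem).\<close>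

definition cc_dist :: "('m::finite \<Rightarrow> 'a::euclidean_space \<Rightarrow> 'a) \<Rightarrow> 'a \<Rightarrow> 'a \<Rightarrow> ereal" where
  "cc_dist X x y = (INF T\<in>{T. \<exists>\<gamma>. subunit_curve X x y T \<gamma>}. ereal T)"

definition cc_ball :: "('m::finite \<Rightarrow> 'a::euclidean_space \<Rightarrow> 'a) \<Rightarrow> 'a \<Rightarrow> real \<Rightarrow> 'a set" where
  "cc_ball X x r = {y. cc_dist X x y < ereal r}"

definition cc_volume :: "('m::finite \<Rightarrow> 'a::euclidean_space \<Rightarrow> 'a) \<Rightarrow> 'a \<Rightarrow> real \<Rightarrow> real" where
  "cc_volume X x r = measure lborel (cc_ball X x r)"

text \<open>\<open>exp (- c * d\<^sup>2 / t)\<close>, with the convention \<open>exp (- \<infinity>) = 0\<close>.\<close>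

definition gaussian :: "real \<Rightarrow> ereal \<Rightarrow> real \<Rightarrow> real" where
  "gaussian c d t = (if d = \<infinity> then 0 else exp (- c * (real_of_ereal d)\<^sup>2 / t))"

section \<open>Heat kernel\<close>

text \<open>The formal adjoint of \<open>\<partial>\<^sub>t - \<L>\<close>, as \<open>\<L> = - \<Sum>\<^sub>i X\<^sub>i\<^sup>\<star> X\<^sub>i\<close> is formally self-adjoint.\<close>

definition heat_adjoint ::
    "('m::finite \<Rightarrow> 'a::euclidean_space \<Rightarrow> 'a) \<Rightarrow> ('a \<times> real \<Rightarrow> real) \<Rightarrow> 'a \<times> real \<Rightarrow> real" where
  "heat_adjoint X \<phi> = (\<lambda>(x, t). - deriv (\<lambda>\<tau>. \<phi> (x, \<tau>)) t - sub_laplacian X (\<lambda>\<xi>. \<phi> (\<xi>, t)) x)"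

text \<open>\<open>\<Gamma> \<zeta>\<close> is locally integrable and \<open>(\<partial>\<^sub>t - \<L>) (\<Gamma> \<zeta>) = \<delta>\<^sub>\<zeta>\<close> in the sense of distributions.\<close>

definition fundamental_solution ::
    "('m::finite \<Rightarrow> 'a::euclidean_space \<Rightarrow> 'a) \<Rightarrow> ('a \<times> real \<Rightarrow> 'a \<times> real \<Rightarrow> real) \<Rightarrow> bool" where
  "fundamental_solution X \<Gamma> \<longleftrightarrow>
     (\<forall>\<zeta>. (\<forall>K. compact K \<longrightarrow> set_integrable lborel K (\<Gamma> \<zeta>)) \<and>
          (\<forall>\<phi>. test_function \<phi> \<longrightarrow> (LINT w|lborel. \<Gamma> \<zeta> w * heat_adjoint X \<phi> w) = \<phi> \<zeta>))"

text \<open>\<open>p x \<xi> (t - \<tau>)\<close> is the value at \<open>(x, t)\<close> of the fundamental solution with pole \<open>(\<xi>, \<tau>)\<close>.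
  It is positive after the pole's time and vanishes up to that time.\<close>

definition heat_kernel ::
    "('m::finite \<Rightarrow> 'a::euclidean_space \<Rightarrow> 'a) \<Rightarrow> ('a \<Rightarrow> 'a \<Rightarrow> real \<Rightarrow> real) \<Rightarrow> bool" where
  "heat_kernel X p \<longleftrightarrow>
     fundamental_solution X (\<lambda>(\<xi>, \<tau>) (x, t). p x \<xi> (t - \<tau>)) \<and>
     (\<forall>x \<xi> t. t > 0 \<longrightarrow> p x \<xi> t > 0) \<and>
     (\<forall>x \<xi> t. t \<le> 0 \<longrightarrow> p x \<xi> t = 0) \<and>
     (\<forall>\<xi> \<tau>. smooth_on (\<lambda>(x, t). p x \<xi> (t - \<tau>)) (UNIV - {(\<xi>, \<tau>)}))"

definition gaussian_upper ::
    "('m::finite \<Rightarrow> 'a::euclidean_space \<Rightarrow> 'a) \<Rightarrow> real \<Rightarrow> ('a \<Rightarrow> 'a \<Rightarrow> real \<Rightarrow> real) \<Rightarrow> bool" where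
  "gaussian_upper X M p \<longleftrightarrow>
     (\<forall>k j. \<exists>C>0. \<forall>js. length js = j \<longrightarrow> (\<forall>x y t. t > 0 \<longrightarrow>
        \<bar>(deriv ^^ k) (\<lambda>\<tau>. vf_word X js (\<lambda>\<xi>. p \<xi> y \<tau>) x) t\<bar>
          \<le> C / (t powr (real k + real j / 2) * cc_volume X x (sqrt t)) * gaussian M (cc_dist X x y) t))"

definition gaussian_lower ::
    "('m::finite \<Rightarrow> 'a::euclidean_space \<Rightarrow> 'a) \<Rightarrow> real \<Rightarrow> ('a \<Rightarrow> 'a \<Rightarrow> real \<Rightarrow> real) \<Rightarrow> bool" where
  "gaussian_lower X M p \<longleftrightarrow>
     (\<exists>C>0. \<forall>x y t. t > 0 \<longrightarrow>
        p x y t \<ge> inverse C / cc_volume X x (sqrt t) * gaussian (inverse M) (cc_dist X x y) t)"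

section \<open>The extension problem\<close>

definition bessel_op :: "real \<Rightarrow> (real \<Rightarrow> real) \<Rightarrow> real \<Rightarrow> real" where
  "bessel_op a g z = deriv (deriv g) z + a / z * deriv g z"

definition extension_op ::
    "('m::finite \<Rightarrow> 'a::euclidean_space \<Rightarrow> 'a) \<Rightarrow> real \<Rightarrow> ('a \<Rightarrow> real \<Rightarrow> real) \<Rightarrow> 'a \<Rightarrow> real \<Rightarrow> real" where
  "extension_op X a U x z =
     z powr a * (sub_laplacian X (\<lambda>\<xi>. U \<xi> z) x + bessel_op a (U x) z)"

definition poisson_integrand :: "('a \<Rightarrow> 'a \<Rightarrow> real \<Rightarrow> real) \<Rightarrow> real \<Rightarrow> real \<Rightarrow> 'a \<Rightarrow> 'a \<Rightarrow> real \<Rightarrow> real" where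
  "poisson_integrand p a z x y t = exp (- z\<^sup>2 / (4 * t)) / t powr ((3 - a) / 2) * p x y t"

definition poisson_kernel :: "('a \<Rightarrow> 'a \<Rightarrow> real \<Rightarrow> real) \<Rightarrow> real \<Rightarrow> real \<Rightarrow> 'a \<Rightarrow> 'a \<Rightarrow> real" where
  "poisson_kernel p a z x y =
     1 / (2 powr (1 - a) * Gamma ((1 - a) / 2)) * z powr (1 - a) *
     (LINT t:{0<..}|lborel. poisson_integrand p a z x y t)"

definition square_integrable :: "('a::euclidean_space \<Rightarrow> real) \<Rightarrow> bool" where
  "square_integrable f \<longleftrightarrow> f \<in> borel_measurable lborel \<and> integrable lborel (\<lambda>x. (f x)\<^sup>2)"

definition tendsto_L2 ::
    "('i \<Rightarrow> 'a::euclidean_space \<Rightarrow> real) \<Rightarrow> ('a \<Rightarrow> real) \<Rightarrow> 'i filter \<Rightarrow> bool" where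
  "tendsto_L2 f g F \<longleftrightarrow>
     square_integrable g \<and> (\<forall>\<^sub>F i in F. square_integrable (f i)) \<and>
     ((\<lambda>i. sqrt (LINT x|lborel. (f i x - g x)\<^sup>2)) \<longlongrightarrow> 0) F"

end

theory Submission
  imports Defs
begin

text \<open>
  Write \<open>U(x,z) = \<integral>\<integral> w\<^sub>z(t) p(x,y,t) u(y) dy dt\<close>, where the weight \<open>w\<^sub>z\<close> is a probability density on
  \<open>(0,\<infinity>)\<close> with \<open>\<partial>\<^sub>t w = \<B>\<^sub>a w\<close>. Since \<open>\<partial>\<^sub>t p = \<L> p\<close>, the integrand of \<open>(\<L> + \<B>\<^sub>a) U\<close> is \<open>\<partial>\<^sub>t (w p) u\<close>,
  which integrates to zero.

  Local regularity needs no information on the Carnot-Caratheodory balls beyond the Gaussian bounds.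
  Comparing the lower bound with \<open>\<integral> p dy = 1\<close> gives volume doubling, hence the upper bounds become
  \<open>|X\<^sub>J p(x,y,t)| \<le> C t\<^bsup>-|J|/2\<^esup> p(x,y,\<kappa>t)\<close>; by Hoermander's condition finitely many words \<open>X\<^sub>J\<close> control
  the Euclidean derivatives near a point. The dominating functions vary with \<open>x\<close>, but they are continuous
  in \<open>x\<close> and their integral is constant, so Pratt's form of dominated convergence applies.

  For the boundary values, Jensen's inequality bounds \<open>\<parallel>U(\<cdot>,z) - u\<parallel>\<^sup>2\<close> by the average over \<open>w\<^sub>z\<close> of
  \<open>\<Phi>(t) = \<integral>\<integral> p(x,y,t) (u(y) - u(x))\<^sup>2 dy dx\<close>. The fields are bounded, so \<open>|x - y| \<le> \<Lambda> d(x,y)\<close>, and the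
  Gaussian factor together with the decay of \<open>u\<close> yields \<open>\<Phi>(t) \<le> C min(1,t)\<close>.
\<close>

section \<open>Smooth functions\<close>

text \<open>The obstacle to differentiating under the integral is that nothing is known about how
  the Gaussians over \<open>cc_volume\<close> depend on x. A dominating function that is again a
  kernel avoids this: \<open>p x y (\<kappa> * t)\<close> has mass exactly one in y for every x. The
  exponent is M in the upper bound and 1/M in the lower one, so time must be rescaled by \<kappa> =
  1/M^2. The powers of 1/t that appear are paid for by half of the exponent in exp(-z^2/(4t)).

  The pointwise equation for p is not a hypothesis: \<open>heat_kernel\<close> provides it as a
  distribution, together with smoothness off the pole, and Green's identity recovers it.

  The mass is prescribed in y only and symmetry of p is not assumed, so integrals over x go through
  \<open>p_swap\<close>.

  The bound by min(1,t) enters in the weaker form t^(s/2). The weight decays like t^(-1-s), so for s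
  < 1 its first moment diverges, whereas the moment of order s/2 is a constant times z^s; the rate
  in L2 is therefore z^(s/2).\<close>

lemma C_k_on_cong_imp:
  assumes "open S" "\<And>x. x \<in> S \<Longrightarrow> f x = g x" "C_k_on k f S"
  shows "C_k_on k g S"
  using assms
proof (induction k arbitrary: f g)
  case 0
  then show ?case by (simp cong: continuous_on_cong)
next
  case (Suc k)
  have d: "f differentiable at x" if "x \<in> S" for x
    using Suc.prems that by (auto simp: differentiable_on_eq_differentiable_at)
  have fd: "frechet_derivative f (at x) = frechet_derivative g (at x)" if "x \<in> S" for x
    using frechet_derivative_transform_within_open[OF d[OF that] \<open>open S\<close> that] Suc.prems(2) by blast
  have "g differentiable at x" if "x \<in> S" for x
    using d[OF that] has_derivative_transform_within_open[of f _ x UNIV S g, OF _ Suc.prems(1) that]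
      Suc.prems(2) unfolding differentiable_def by blast
  moreover have "C_k_on k (\<lambda>x. frechet_derivative g (at x) b) S" if "b \<in> Basis" for b
  proof (rule Suc.IH[OF Suc.prems(1)])
    show "C_k_on k (\<lambda>x. frechet_derivative f (at x) b) S" using Suc.prems(3) that by simp
  qed (simp add: fd)
  ultimately show ?case
    using Suc.prems(1) by (auto simp: differentiable_on_eq_differentiable_at)
qed

lemma C_k_on_Suc_imp: "C_k_on (Suc k) f S \<Longrightarrow> C_k_on k f S"
proof (induction k arbitrary: f)
  case 0
  then show ?case by (simp add: differentiable_imp_continuous_on)
next
  case (Suc k)
  then show ?case by (simp only: C_k_on.simps(2)) blast
qed

lemma C_k_on_le: "C_k_on k f S \<Longrightarrow> j \<le> k \<Longrightarrow> C_k_on j f S"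
proof (induction k)
  case (Suc k)
  then show ?case using C_k_on_Suc_imp[OF Suc.prems(1)] by (cases "j = Suc k") auto
qed simp

lemma C_k_on_continuous: "C_k_on k f S \<Longrightarrow> continuous_on S f"
  using C_k_on_le[of k f S 0] by simp

lemma C_k_on_subset: "C_k_on k f S \<Longrightarrow> T \<subseteq> S \<Longrightarrow> C_k_on k f T"
  by (induction k arbitrary: f) (auto intro: continuous_on_subset differentiable_on_subset)

text \<open>\<open>frechet_derivative f (at x)\<close> does not mention the set, so derivatives
  taken on different neighbourhoods agree automatically. Used to glue functions extended by zero,
  and for the extension, whose regularity is proved near each point separately.\<close>

lemma C_k_on_local:
  assumes "open S" "\<And>x. x \<in> S \<Longrightarrow> \<exists>T. open T \<and> x \<in> T \<and> C_k_on k f T"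
  shows "C_k_on k f S"
  using assms
proof (induction k arbitrary: f)
  case 0
  have "isCont f x" if "x \<in> S" for x
    using 0(2)[OF that] by (auto simp: continuous_on_eq_continuous_at)
  then show ?case by (simp add: continuous_at_imp_continuous_on)
next
  case (Suc k)
  have "f differentiable at x" if "x \<in> S" for x
    using Suc.prems(2)[OF that] by (auto simp: differentiable_on_eq_differentiable_at)
  moreover have "C_k_on k (\<lambda>x. frechet_derivative f (at x) b) S" if "b \<in> Basis" for b
  proof (rule Suc.IH[OF Suc.prems(1)])
    fix x assume "x \<in> S"
    then obtain T where "open T" "x \<in> T" "C_k_on (Suc k) f T" using Suc.prems(2) by blast
    then show "\<exists>T. open T \<and> x \<in> T \<and> C_k_on k (\<lambda>x. frechet_derivative f (at x) b) T"
      using that by auto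
  qed
  ultimately show ?case
    using Suc.prems(1) by (auto simp: differentiable_on_eq_differentiable_at)
qed

text \<open>\<open>C_k_on\<close> is phrased with \<open>frechet_derivative\<close>, a choice
  operator. On an open set the derivative is unique, so any derivative that can be written down may
  replace it; most closure rules below go through this form.\<close>

lemma C_k_on_SucI:
  assumes "open S" "\<And>x. x \<in> S \<Longrightarrow> (f has_derivative f' x) (at x)"
    "\<And>b. b \<in> Basis \<Longrightarrow> C_k_on k (\<lambda>x. f' x b) S"
  shows "C_k_on (Suc k) f S"
proof -
  have "frechet_derivative f (at x) = f' x" if "x \<in> S" for x
    using frechet_derivative_at[OF assms(2)[OF that]] by simp
  then have "C_k_on k (\<lambda>x. frechet_derivative f (at x) b) S" if "b \<in> Basis" for b
    using C_k_on_cong_imp[OF assms(1) _ assms(3)[OF that]] by auto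
  then show ?thesis
    using assms(1,2) by (auto simp: differentiable_on_eq_differentiable_at differentiable_def)
qed

lemma C_k_on_Suc_derivative:
  assumes "open S" "C_k_on (Suc k) f S" "x \<in> S"
  shows "(f has_derivative frechet_derivative f (at x)) (at x)"
  using assms by (auto simp: differentiable_on_eq_differentiable_at frechet_derivative_works)

lemma C_k_on_const: "C_k_on k (\<lambda>x. c) S"
  by (induction k arbitrary: c) auto

lemma C_k_on_add:
  assumes "open S" "C_k_on k f S" "C_k_on k g S"
  shows "C_k_on k (\<lambda>x. f x + g x) S"
  using assms
proof (induction k arbitrary: f g)
  case 0 then show ?case by (auto intro: continuous_intros)
next
  case (Suc k)
  show ?case
    by (rule C_k_on_SucI[OF Suc.prems(1) has_derivative_add[OF
          C_k_on_Suc_derivative[OF Suc.prems(1,2)] C_k_on_Suc_derivative[OF Suc.prems(1,3)]]])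
       (use Suc in auto)
qed

lemma C_k_on_bounded_linear:
  assumes "open S" "bounded_linear h" "C_k_on k f S"
  shows "C_k_on k (\<lambda>x. h (f x)) S"
  using assms
proof (induction k arbitrary: f)
  case 0 then show ?case by (auto intro: bounded_linear.continuous_on)
next
  case (Suc k)
  show ?case
    by (rule C_k_on_SucI[OF Suc.prems(1) bounded_linear.has_derivative[OF Suc.prems(2)
          C_k_on_Suc_derivative[OF Suc.prems(1,3)]]]) (use Suc in auto)
qed

lemma C_k_on_sum:
  assumes "open S" "finite A" "\<And>i. i \<in> A \<Longrightarrow> C_k_on k (f i) S"
  shows "C_k_on k (\<lambda>x. \<Sum>i\<in>A. f i x) S"
  using assms(2,3) by (induction A) (auto intro: C_k_on_const C_k_on_add[OF assms(1)])

lemma C_k_on_scaleR: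
  assumes "open S" "C_k_on k f S" "C_k_on k g S"
  shows "C_k_on k (\<lambda>x. f x *\<^sub>R g x) S"
  using assms
proof (induction k arbitrary: f g)
  case 0 then show ?case by (auto intro: continuous_intros)
next
  case (Suc k)
  note C_k_on_Suc_imp[OF Suc.prems(2)] C_k_on_Suc_imp[OF Suc.prems(3)]
  then show ?case
    using Suc
    by (intro C_k_on_SucI[OF Suc.prems(1) has_derivative_scaleR[OF
          C_k_on_Suc_derivative[OF Suc.prems(1,2)] C_k_on_Suc_derivative[OF Suc.prems(1,3)]]]
          C_k_on_add) auto
qed

lemma C_k_on_mult:
  fixes f g :: "'a::euclidean_space \<Rightarrow> real"
  assumes "open S" "C_k_on k f S" "C_k_on k g S"
  shows "C_k_on k (\<lambda>x. f x * g x) S"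
  using C_k_on_scaleR[OF assms] by simp

lemma C_k_on_cmult:
  fixes f :: "'a::euclidean_space \<Rightarrow> real"
  assumes "open S" "C_k_on k f S"
  shows "C_k_on k (\<lambda>x. c * f x) S"
  using C_k_on_mult[OF assms(1) C_k_on_const assms(2)] .

lemma C_k_on_diff:
  fixes f g :: "'a::euclidean_space \<Rightarrow> real"
  assumes "open S" "C_k_on k f S" "C_k_on k g S"
  shows "C_k_on k (\<lambda>x. f x - g x) S"
  using C_k_on_add[OF assms(1,2) C_k_on_cmult[OF assms(1,3), of "-1"]] by simp

lemma C_k_on_linear: "bounded_linear f \<Longrightarrow> C_k_on k f S"
proof (cases k)
  case (Suc j)
  assume f: "bounded_linear f"
  then have "frechet_derivative f (at x) = f" for x
    using frechet_derivative_at[OF bounded_linear_imp_has_derivative[OF f]] by simp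
  with f Suc show ?thesis
    by (auto simp: C_k_on_const bounded_linear_imp_differentiable_on)
qed (auto intro: linear_continuous_on)

lemma linear_sum_Basis:
  fixes f :: "'a::euclidean_space \<Rightarrow> 'b::real_vector"
  assumes "linear f"
  shows "f v = (\<Sum>b\<in>Basis. (v \<bullet> b) *\<^sub>R f b)"
proof -
  have "f v = f (\<Sum>b\<in>Basis. (v \<bullet> b) *\<^sub>R b)" by (simp add: euclidean_representation)
  then show ?thesis by (simp add: linear_sum[OF assms] linear_cmul[OF assms])
qed

text \<open>The inner map has the constant derivative L, so a derivative of the composite is a fixed
  linear combination of functions composed with the same map, and the induction closes without
  products. Needed for slices and for functions of one factor of a product.\<close>

lemma C_k_on_affine_compose:
  fixes f :: "'a::euclidean_space \<Rightarrow> 'c::real_normed_vector" and L :: "'b::euclidean_space \<Rightarrow> 'a"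
  assumes S: "open S" and L: "bounded_linear L" and f: "C_k_on k f S"
  shows "C_k_on k (\<lambda>x. f (c + L x)) ((\<lambda>x. c + L x) -` S)"
  using f
proof (induction k arbitrary: f)
  case 0
  have "continuous_on UNIV (\<lambda>x. c + L x)"
    by (intro continuous_intros linear_continuous_on L)
  then show ?case using 0
    by (auto intro!: continuous_on_compose2[of S f] intro: continuous_on_subset)
next
  case (Suc k)
  let ?A = "\<lambda>x. c + L x"
  have cont: "continuous_on UNIV ?A"
    by (intro continuous_intros linear_continuous_on L)
  have op: "open (?A -` S)" using S cont by (metis open_vimage)
  have der: "((\<lambda>x. f (?A x)) has_derivative (\<lambda>v. frechet_derivative f (at (?A x)) (L v))) (at x)"
    if "x \<in> ?A -` S" for x
  proof -
    have 1: "(f has_derivative frechet_derivative f (at (?A x))) (at (?A x))"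
      using C_k_on_Suc_derivative[OF S Suc.prems] that by auto
    have 2: "(?A has_derivative L) (at x)"
      using has_derivative_add[OF has_derivative_const[of c] bounded_linear_imp_has_derivative[OF L]] by simp
    show ?thesis using has_derivative_compose[OF 2 1] .
  qed
  show ?case
  proof (rule C_k_on_SucI[OF op der])
    fix b :: 'b assume b: "b \<in> Basis"
    have eq: "frechet_derivative f (at (?A x)) (L b) =
       (\<Sum>i\<in>Basis. (L b \<bullet> i) *\<^sub>R frechet_derivative f (at (?A x)) i)" if "x \<in> ?A -` S" for x
      using linear_sum_Basis[OF has_derivative_linear[OF C_k_on_Suc_derivative[OF S Suc.prems]]] that by auto
    have C: "C_k_on k (\<lambda>x. \<Sum>i\<in>Basis. (L b \<bullet> i) *\<^sub>R frechet_derivative f (at (?A x)) i) (?A -` S)"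
      using Suc by (intro C_k_on_sum op C_k_on_bounded_linear[OF op bounded_linear_scaleR_right] Suc.IH) auto
    show "C_k_on k (\<lambda>x. frechet_derivative f (at (?A x)) (L b)) (?A -` S)"
      by (rule C_k_on_cong_imp[OF op _ C]) (simp add: eq)
  qed auto
qed

text \<open>\<open>C_k_on\<close> records derivatives in basis directions only; a varying direction
  is reached by expanding V in coordinates, at the price of one order.\<close>

lemma C_k_on_directional:
  assumes S: "open S" and f: "C_k_on (Suc k) f S" and V: "C_k_on k V S"
  shows "C_k_on k (\<lambda>x. frechet_derivative f (at x) (V x)) S"
proof -
  have eq: "frechet_derivative f (at x) (V x) =
       (\<Sum>i\<in>Basis. (V x \<bullet> i) *\<^sub>R frechet_derivative f (at x) i)" if "x \<in> S" for x
    using linear_sum_Basis[OF has_derivative_linear[OF C_k_on_Suc_derivative[OF S f that]]] .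
  have C: "C_k_on k (\<lambda>x. \<Sum>i\<in>Basis. (V x \<bullet> i) *\<^sub>R frechet_derivative f (at x) i) S"
    using f by (intro C_k_on_sum S C_k_on_scaleR C_k_on_bounded_linear[OF S bounded_linear_inner_left V]) simp_all
  show ?thesis by (rule C_k_on_cong_imp[OF S _ C]) (simp add: eq)
qed

lemma smooth_on_C_k: "smooth_on f S \<Longrightarrow> C_k_on k f S"
  by (simp add: smooth_on_def)

lemma smooth_on_directional:
  assumes S: "open S" and f: "smooth_on f S" and V: "smooth_on V S"
  shows "smooth_on (\<lambda>x. frechet_derivative f (at x) (V x)) S"
  unfolding smooth_on_def
  using C_k_on_directional[OF S smooth_on_C_k[OF f] smooth_on_C_k[OF V]] by blast

lemma smooth_on_has_derivative:
  assumes "open S" "smooth_on f S" "x \<in> S"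
  shows "(f has_derivative frechet_derivative f (at x)) (at x)"
  using C_k_on_Suc_derivative[OF assms(1) smooth_on_C_k[OF assms(2)] assms(3)] .

section \<open>Second derivatives and their symmetry\<close>

abbreviation pd :: "('a::euclidean_space \<Rightarrow> real) \<Rightarrow> 'a \<Rightarrow> 'a \<Rightarrow> real" where
  "pd f x b \<equiv> frechet_derivative f (at x) b"

abbreviation pd2 :: "('a::euclidean_space \<Rightarrow> real) \<Rightarrow> 'a \<Rightarrow> 'a \<Rightarrow> 'a \<Rightarrow> real" where
  "pd2 f x c b \<equiv> frechet_derivative (\<lambda>y. frechet_derivative f (at y) b) (at x) c"

lemma has_derivative_along_line:
  fixes f :: "'a::euclidean_space \<Rightarrow> real"
  assumes "(f has_derivative f') (at (x + s *\<^sub>R v))"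
  shows "((\<lambda>s. f (x + s *\<^sub>R v)) has_real_derivative f' v) (at s)"
proof -
  have 1: "((\<lambda>s. x + s *\<^sub>R v) has_derivative (\<lambda>h. h *\<^sub>R v)) (at s)"
    by (auto intro!: derivative_eq_intros)
  have "((\<lambda>s. f (x + s *\<^sub>R v)) has_derivative (\<lambda>h. f' (h *\<^sub>R v))) (at s)"
    by (rule has_derivative_compose[OF 1 assms])
  moreover have "f' (h *\<^sub>R v) = f' v * h" for h
    using linear_cmul[OF has_derivative_linear[OF assms]] by simp
  ultimately show ?thesis by (simp add: has_field_derivative_def)
qed

lemma C_k_on_2D:
  assumes "open S" "C_k_on 2 f S" "x \<in> S"
  shows "(f has_derivative frechet_derivative f (at x)) (at x)"
    and "((\<lambda>y. frechet_derivative f (at y) v) has_derivative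
           frechet_derivative (\<lambda>y. frechet_derivative f (at y) v) (at x)) (at x)"
    and "continuous_on S (\<lambda>x. frechet_derivative f (at x) v)"
    and "continuous_on S (\<lambda>x. frechet_derivative (\<lambda>y. frechet_derivative f (at y) v) (at x) w)"
proof -
  have 2: "C_k_on (Suc (Suc 0)) f S" using assms(2) by (simp add: numeral_2_eq_2)
  show "(f has_derivative frechet_derivative f (at x)) (at x)"
    by (rule C_k_on_Suc_derivative[OF assms(1) 2 assms(3)])
  have 1: "C_k_on (Suc 0) (\<lambda>x. frechet_derivative f (at x) v) S"
    by (rule C_k_on_directional[OF assms(1) 2 C_k_on_const])
  show "((\<lambda>y. frechet_derivative f (at y) v) has_derivative
           frechet_derivative (\<lambda>y. frechet_derivative f (at y) v) (at x)) (at x)"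
    by (rule C_k_on_Suc_derivative[OF assms(1) 1 assms(3)])
  show "continuous_on S (\<lambda>x. frechet_derivative f (at x) v)"
    by (rule C_k_on_continuous[OF 1])
  show "continuous_on S (\<lambda>x. frechet_derivative (\<lambda>y. frechet_derivative f (at y) v) (at x) w)"
    by (rule C_k_on_continuous[OF C_k_on_directional[OF assms(1) 1 C_k_on_const]])
qed

text \<open>The mean value theorem is applied twice: in direction u to the difference of f over the
  step \<open>h *\<^sub>R v\<close>, then in direction v to the resulting difference of first
  derivatives.\<close>

lemma second_difference_mvt:
  fixes f :: "'a::euclidean_space \<Rightarrow> real"
  assumes S: "open S" and f: "C_k_on 2 f S" and h: "h > 0"
    and sub: "\<And>s t. 0 \<le> s \<Longrightarrow> s \<le> h \<Longrightarrow> 0 \<le> t \<Longrightarrow> t \<le> h \<Longrightarrow> x + s *\<^sub>R u + t *\<^sub>R v \<in> S"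
  shows "\<exists>s t. 0 < s \<and> s < h \<and> 0 < t \<and> t < h \<and>
    f (x + h *\<^sub>R u + h *\<^sub>R v) - f (x + h *\<^sub>R u) - f (x + h *\<^sub>R v) + f x
      = h\<^sup>2 * pd2 f (x + s *\<^sub>R u + t *\<^sub>R v) v u"
proof -
  define \<phi> where "\<phi> s = f ((x + h *\<^sub>R v) + s *\<^sub>R u) - f (x + s *\<^sub>R u)" for s
  have "DERIV \<phi> s :> pd f ((x + h *\<^sub>R v) + s *\<^sub>R u) u - pd f (x + s *\<^sub>R u) u" if "0 \<le> s" "s \<le> h" for s
  proof -
    have "x + s *\<^sub>R u \<in> S" "(x + h *\<^sub>R v) + s *\<^sub>R u \<in> S"
      using sub[of s 0] sub[of s h] that h by (auto simp: algebra_simps)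
    then show ?thesis unfolding \<phi>_def
      by (intro DERIV_diff has_derivative_along_line C_k_on_2D(1)[OF S f])
  qed
  from MVT2[OF h this] obtain s where s: "0 < s" "s < h"
    and e1: "\<phi> h - \<phi> 0 = h * (pd f ((x + h *\<^sub>R v) + s *\<^sub>R u) u - pd f (x + s *\<^sub>R u) u)"
    by auto
  have "DERIV (\<lambda>t. pd f ((x + s *\<^sub>R u) + t *\<^sub>R v) u) t :> pd2 f ((x + s *\<^sub>R u) + t *\<^sub>R v) v u"
    if "0 \<le> t" "t \<le> h" for t
    using sub[of s t] that s
    by (intro has_derivative_along_line[where f = "\<lambda>y. pd f y u"] C_k_on_2D(2)[OF S f]) auto
  from MVT2[OF h this] obtain t where t: "0 < t" "t < h"
    and e2: "pd f ((x + s *\<^sub>R u) + h *\<^sub>R v) u - pd f ((x + s *\<^sub>R u) + 0 *\<^sub>R v) u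
       = h * pd2 f ((x + s *\<^sub>R u) + t *\<^sub>R v) v u" by auto
  have "x + s *\<^sub>R u + h *\<^sub>R v = x + h *\<^sub>R v + s *\<^sub>R u" by (simp add: algebra_simps)
  with e1 e2 have "\<phi> h - \<phi> 0 = h * (h * pd2 f ((x + s *\<^sub>R u) + t *\<^sub>R v) v u)" by simp
  moreover have "\<phi> h - \<phi> 0 = f (x + h *\<^sub>R u + h *\<^sub>R v) - f (x + h *\<^sub>R u) - f (x + h *\<^sub>R v) + f x"
    by (simp add: \<phi>_def algebra_simps)
  ultimately show ?thesis using s t by (auto simp: power2_eq_square)
qed

text \<open>The second difference is symmetric in u and v, so it equals h^2 times either mixed
  derivative, each at some point close to x. Continuity then excludes a gap of 2e between the two
  values at x.\<close>

lemma pd2_commute: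
  fixes f :: "'a::euclidean_space \<Rightarrow> real"
  assumes S: "open S" and f: "C_k_on 2 f S" and x: "x \<in> S"
  shows "pd2 f x u v = pd2 f x v u"
proof (rule ccontr)
  assume ne: "\<not> ?thesis"
  define e where "e = \<bar>pd2 f x u v - pd2 f x v u\<bar> / 2"
  have e: "e > 0" using ne by (simp add: e_def)
  have cont: "isCont (\<lambda>y. pd2 f y v u) x" "isCont (\<lambda>y. pd2 f y u v) x"
    using C_k_on_2D(4)[OF S f x] S x by (auto simp: continuous_on_eq_continuous_at)
  obtain d1 where d1: "d1 > 0" "\<And>y. dist y x < d1 \<Longrightarrow> \<bar>pd2 f y v u - pd2 f x v u\<bar> < e"
    using cont(1) e unfolding continuous_at_eps_delta dist_real_def by blast
  obtain d2 where d2: "d2 > 0" "\<And>y. dist y x < d2 \<Longrightarrow> \<bar>pd2 f y u v - pd2 f x u v\<bar> < e"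
    using cont(2) e unfolding continuous_at_eps_delta dist_real_def by blast
  obtain d3 where d3: "d3 > 0" "ball x d3 \<subseteq> S" using S x by (auto simp: open_contains_ball)
  define d where "d = min d1 (min d2 d3)"
  \<comment> \<open>With this step the whole parallelogram stays within d / 2 of x.\<close>
  define h where "h = d / (2 * (norm u + norm v + 1))"
  have dpos: "d > 0" using d1 d2 d3 by (simp add: d_def)
  have npos: "norm u + norm v + 1 > 0" by (smt (verit) norm_ge_zero)
  then have h: "h > 0" using dpos by (simp add: h_def)
  have near: "dist (x + s *\<^sub>R u + t *\<^sub>R v) x < d" if "0 \<le> s" "s \<le> h" "0 \<le> t" "t \<le> h" for s t
  proof -
    have "norm (s *\<^sub>R u + t *\<^sub>R v) \<le> s * norm u + t * norm v"
      using that by (metis abs_of_nonneg norm_scaleR norm_triangle_ineq)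
    also have "\<dots> \<le> h * (norm u + norm v + 1)"
      using that h by (smt (verit) distrib_left mult_right_mono norm_ge_zero mult_cancel_left2)
    also have "\<dots> = d / 2" using npos unfolding h_def by (metis mult.commute nonzero_mult_divide_mult_cancel_left order_less_irrefl times_divide_eq_left)
    finally show ?thesis using dpos by (simp add: dist_norm add.assoc)
  qed
  obtain s t where st: "0 < s" "s < h" "0 < t" "t < h"
    "f (x + h *\<^sub>R u + h *\<^sub>R v) - f (x + h *\<^sub>R u) - f (x + h *\<^sub>R v) + f x
      = h\<^sup>2 * pd2 f (x + s *\<^sub>R u + t *\<^sub>R v) v u"
    using second_difference_mvt[OF S f h, of x u v] near d3 by (auto simp: d_def dist_commute subset_iff)
  obtain s' t' where st': "0 < s'" "s' < h" "0 < t'" "t' < h"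
    "f (x + h *\<^sub>R v + h *\<^sub>R u) - f (x + h *\<^sub>R v) - f (x + h *\<^sub>R u) + f x
      = h\<^sup>2 * pd2 f (x + s' *\<^sub>R v + t' *\<^sub>R u) u v"
  proof -
    have "x + s *\<^sub>R v + t *\<^sub>R u \<in> S" if "0 \<le> s" "s \<le> h" "0 \<le> t" "t \<le> h" for s t
    proof -
      have "x + s *\<^sub>R v + t *\<^sub>R u = x + t *\<^sub>R u + s *\<^sub>R v" by (simp add: algebra_simps)
      moreover have "x + t *\<^sub>R u + s *\<^sub>R v \<in> S"
        using near[of t s] that d3 by (auto simp: d_def dist_commute subset_iff)
      ultimately show ?thesis by (simp only:)
    qed
    from second_difference_mvt[OF S f h this] that show thesis by blast
  qed
  have "x + h *\<^sub>R v + h *\<^sub>R u = x + h *\<^sub>R u + h *\<^sub>R v" by simp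
  then have "f (x + h *\<^sub>R v + h *\<^sub>R u) = f (x + h *\<^sub>R u + h *\<^sub>R v)" by (rule arg_cong)
  with st(5) st'(5) have "h\<^sup>2 * pd2 f (x + s *\<^sub>R u + t *\<^sub>R v) v u
      = h\<^sup>2 * pd2 f (x + s' *\<^sub>R v + t' *\<^sub>R u) u v" by linarith
  then have eq: "pd2 f (x + s *\<^sub>R u + t *\<^sub>R v) v u = pd2 f (x + s' *\<^sub>R v + t' *\<^sub>R u) u v"
    using h by simp
  have "\<bar>pd2 f (x + s *\<^sub>R u + t *\<^sub>R v) v u - pd2 f x v u\<bar> < e"
    using d1(2) near[of s t] st by (auto simp: d_def)
  moreover have "\<bar>pd2 f (x + s' *\<^sub>R v + t' *\<^sub>R u) u v - pd2 f x u v\<bar> < e"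
    using d2(2) near[of t' s'] st' by (auto simp: d_def algebra_simps)
  ultimately have "\<bar>pd2 f x u v - pd2 f x v u\<bar> < 2 * e" using eq unfolding abs_less_iff by linarith
  then show False by (simp add: e_def)
qed

text \<open>For v = V x this is a second-order word. The Hessian sum is symmetric in the two fields;
  the term with W' is what survives in a commutator.\<close>

lemma has_derivative_directional:
  fixes f :: "'a::euclidean_space \<Rightarrow> real"
  assumes S: "open S" and f: "C_k_on 2 f S" and x: "x \<in> S" and W: "(W has_derivative W') (at x)"
  shows "((\<lambda>y. pd f y (W y)) has_derivative
     (\<lambda>v. pd f x (W' v) + (\<Sum>b\<in>Basis. (W x \<bullet> b) * pd2 f x v b))) (at x)"
proof -
  note lin = has_derivative_linear[OF C_k_on_2D(1)[OF S f]]
  have eq: "(\<Sum>b\<in>Basis. (W y \<bullet> b) * pd f y b) = pd f y (W y)" if "y \<in> S" for y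
    using linear_sum_Basis[OF lin[OF that], of "W y"] by (simp only: real_scaleR_def)
  have "((\<lambda>y. \<Sum>b\<in>Basis. (W y \<bullet> b) * pd f y b) has_derivative
     (\<lambda>v. \<Sum>b\<in>Basis. (W x \<bullet> b) * pd2 f x v b + (W' v \<bullet> b) * pd f x b)) (at x)"
    by (intro has_derivative_sum has_derivative_mult has_derivative_inner_left W C_k_on_2D(2)[OF S f x])
  moreover have "(\<Sum>b\<in>Basis. (W x \<bullet> b) * pd2 f x v b + (W' v \<bullet> b) * pd f x b) =
      pd f x (W' v) + (\<Sum>b\<in>Basis. (W x \<bullet> b) * pd2 f x v b)" for v
    using linear_sum_Basis[OF lin[OF x], of "W' v"]
    by (simp only: sum.distrib real_scaleR_def add.commute)
  ultimately show ?thesis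
    using has_derivative_transform_within_open[OF _ S x eq] by simp
qed

section \<open>Derivatives along words in the fields\<close>

text \<open>Finite linear combinations of words with constant coefficients, the empty word included.
  Constants suffice because \<open>lie_algebra\<close> is closed under real multiples only.
  Agreement is asked for smooth functions alone, as \<open>frechet_derivative\<close> carries no
  information elsewhere.\<close>

definition word_operator ::
    "('m \<Rightarrow> 'a::euclidean_space \<Rightarrow> 'a) \<Rightarrow> (('a \<Rightarrow> real) \<Rightarrow> 'a \<Rightarrow> real) \<Rightarrow> bool" where
  "word_operator X \<Phi> \<longleftrightarrow> (\<exists>cs :: (real \<times> 'm list) list. \<forall>f. smooth_on f UNIV \<longrightarrow>
     \<Phi> f = (\<lambda>x. \<Sum>(c, js)\<leftarrow>cs. c * vf_word X js f x))"

lemma smooth_on_vf_deriv: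
  assumes "smooth_on V UNIV" "smooth_on f UNIV"
  shows "smooth_on (vf_deriv V f) UNIV"
  using smooth_on_directional[OF open_UNIV assms(2,1)] unfolding vf_deriv_def .

lemma smooth_on_add: "open S \<Longrightarrow> smooth_on f S \<Longrightarrow> smooth_on g S \<Longrightarrow> smooth_on (\<lambda>x. f x + g x) S"
  by (simp add: smooth_on_def C_k_on_add)

lemma smooth_on_bounded_linear:
  "open S \<Longrightarrow> bounded_linear h \<Longrightarrow> smooth_on f S \<Longrightarrow> smooth_on (\<lambda>x. h (f x)) S"
  by (simp add: smooth_on_def C_k_on_bounded_linear)

lemma smooth_on_const: "smooth_on (\<lambda>x. c) S"
  by (simp add: smooth_on_def C_k_on_const)

lemma smooth_on_cmult:
  fixes f :: "'a::euclidean_space \<Rightarrow> real"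
  shows "open S \<Longrightarrow> smooth_on f S \<Longrightarrow> smooth_on (\<lambda>x. c * f x) S"
  by (simp add: smooth_on_def C_k_on_cmult)

lemma vf_word_Nil [simp]: "vf_word X [] f = f"
  and vf_word_Cons [simp]: "vf_word X (j # js) f = vf_deriv (X j) (vf_word X js f)"
  and vf_word_append: "vf_word X (js @ ks) f = vf_word X js (vf_word X ks f)"
  by (simp_all add: vf_word_def)

lemma smooth_on_vf_word:
  assumes "\<And>i. smooth_on (X i) UNIV" "smooth_on f UNIV"
  shows "smooth_on (vf_word X js f) UNIV"
  by (induction js) (auto intro: smooth_on_vf_deriv assms)

lemma vf_deriv_sum_list:
  fixes fs :: "(real \<times> ('a::euclidean_space \<Rightarrow> real)) list"
  assumes "\<And>c f. (c, f) \<in> set fs \<Longrightarrow> smooth_on f UNIV"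
  shows "vf_deriv V (\<lambda>x. \<Sum>(c, f)\<leftarrow>fs. c * f x) = (\<lambda>x. \<Sum>(c, f)\<leftarrow>fs. c * vf_deriv V f x)
    \<and> smooth_on (\<lambda>x. \<Sum>(c, f)\<leftarrow>fs. c * f x) UNIV"
  using assms
proof (induction fs)
  case Nil
  then show ?case by (simp add: vf_deriv_def smooth_on_const)
next
  case (Cons a fs)
  obtain c f where a: "a = (c, f)" by fastforce
  have f: "smooth_on f UNIV" using Cons.prems[of c f] a by simp
  define g where "g = (\<lambda>x. \<Sum>(c, f)\<leftarrow>fs. c * f x)"
  have IH: "vf_deriv V g = (\<lambda>x. \<Sum>(c, f)\<leftarrow>fs. c * vf_deriv V f x)" "smooth_on g UNIV"
    unfolding g_def using Cons.IH Cons.prems by (meson list.set_intros(2))+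
  have "((\<lambda>x. c * f x + g x) has_derivative
      (\<lambda>v. c * frechet_derivative f (at x) v + frechet_derivative g (at x) v)) (at x)" for x
    by (intro has_derivative_add has_derivative_mult_right smooth_on_has_derivative[of UNIV] f IH) auto
  then have "frechet_derivative (\<lambda>x. c * f x + g x) (at x) =
      (\<lambda>v. c * frechet_derivative f (at x) v + frechet_derivative g (at x) v)" for x
    using frechet_derivative_at by metis
  then have "vf_deriv V (\<lambda>x. c * f x + g x) = (\<lambda>x. c * vf_deriv V f x + vf_deriv V g x)"
    by (simp add: vf_deriv_def fun_eq_iff)
  moreover have "smooth_on (\<lambda>x. c * f x + g x) UNIV"
    by (intro smooth_on_add smooth_on_cmult f IH(2)) auto
  ultimately show ?case by (simp add: a IH(1)[unfolded g_def] g_def)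
qed

lemma vf_word_sum_list:
  fixes fs :: "(real \<times> ('a::euclidean_space \<Rightarrow> real)) list"
  assumes X: "\<And>i. smooth_on (X i) UNIV" and fs: "\<And>c f. (c, f) \<in> set fs \<Longrightarrow> smooth_on f UNIV"
  shows "vf_word X js (\<lambda>x. \<Sum>(c, f)\<leftarrow>fs. c * f x) = (\<lambda>x. \<Sum>(c, f)\<leftarrow>fs. c * vf_word X js f x)"
proof (induction js)
  case (Cons j js)
  let ?gs = "map (\<lambda>(c, f). (c, vf_word X js f)) fs"
  have "vf_word X (j # js) (\<lambda>x. \<Sum>(c, f)\<leftarrow>fs. c * f x) = vf_deriv (X j) (\<lambda>x. \<Sum>(c, g)\<leftarrow>?gs. c * g x)"
    using Cons by (simp add: case_prod_unfold comp_def)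
  also have "\<dots> = (\<lambda>x. \<Sum>(c, g)\<leftarrow>?gs. c * vf_deriv (X j) g x)"
    by (intro conjunct1[OF vf_deriv_sum_list]) (auto intro: smooth_on_vf_word X fs)
  also have "\<dots> = (\<lambda>x. \<Sum>(c, f)\<leftarrow>fs. c * vf_word X (j # js) f x)"
    by (simp add: case_prod_unfold comp_def)
  finally show ?case .
qed simp

lemma smooth_on_word_operator:
  assumes X: "\<And>i. smooth_on (X i) UNIV" and "word_operator X \<Phi>" and f: "smooth_on f UNIV"
  shows "smooth_on (\<Phi> f) UNIV"
proof -
  obtain cs where "\<Phi> f = (\<lambda>x. \<Sum>(c, js)\<leftarrow>cs. c * vf_word X js f x)"
    using assms unfolding word_operator_def by blast
  also have "\<dots> = (\<lambda>x. \<Sum>(c, g)\<leftarrow>map (\<lambda>(c, js). (c, vf_word X js f)) cs. c * g x)"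
    by (simp add: case_prod_unfold comp_def)
  finally show ?thesis
    using conjunct2[OF vf_deriv_sum_list[of "map (\<lambda>(c, js). (c, vf_word X js f)) cs"]]
      smooth_on_vf_word[OF X f] by fastforce
qed

text \<open>Constants pass through derivations, so composition concatenates words. Smoothness of
  \<open>\<Psi> f\<close> is needed before the representation of \<Phi> may be applied to
  it.\<close>

lemma word_operator_compose:
  assumes X: "\<And>i. smooth_on (X i) UNIV" and "word_operator X \<Phi>" "word_operator X \<Psi>"
  shows "word_operator X (\<lambda>f. \<Phi> (\<Psi> f))"
proof -
  obtain cs where cs: "\<And>f. smooth_on f UNIV \<Longrightarrow> \<Phi> f = (\<lambda>x. \<Sum>(c, js)\<leftarrow>cs. c * vf_word X js f x)"
    using assms(2) unfolding word_operator_def by blast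
  obtain ds where ds: "\<And>f. smooth_on f UNIV \<Longrightarrow> \<Psi> f = (\<lambda>x. \<Sum>(d, ks)\<leftarrow>ds. d * vf_word X ks f x)"
    using assms(3) unfolding word_operator_def by blast
  define es where "es = concat (map (\<lambda>(c, js). map (\<lambda>(d, ks). (c * d, js @ ks)) ds) cs)"
  have "\<Phi> (\<Psi> f) = (\<lambda>x. \<Sum>(c, js)\<leftarrow>es. c * vf_word X js f x)" if f: "smooth_on f UNIV" for f
  proof
    fix x
    have w: "vf_word X js (\<Psi> f) x = (\<Sum>(d, ks)\<leftarrow>ds. d * vf_word X (js @ ks) f x)" for js
    proof -
      let ?fs = "map (\<lambda>(d, ks). (d, vf_word X ks f)) ds"
      have "smooth_on g UNIV" if "(c, g) \<in> set ?fs" for c g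
        using that smooth_on_vf_word[where X = X, OF X f] by auto
      from vf_word_sum_list[where X = X and fs = ?fs and js = js, OF X this] show ?thesis
        by (simp add: ds[OF f] case_prod_unfold comp_def vf_word_append)
    qed
    have "\<Phi> (\<Psi> f) x = (\<Sum>(c, js)\<leftarrow>cs. c * (\<Sum>(d, ks)\<leftarrow>ds. d * vf_word X (js @ ks) f x))"
      by (simp add: cs[OF smooth_on_word_operator[OF X assms(3) f]] w)
    also have "\<dots> = (\<Sum>(c, js)\<leftarrow>es. c * vf_word X js f x)"
      unfolding es_def
      by (induction cs) (auto simp: case_prod_unfold comp_def sum_list_const_mult mult.assoc)
    finally show "\<Phi> (\<Psi> f) x = (\<Sum>(c, js)\<leftarrow>es. c * vf_word X js f x)" .
  qed
  then show ?thesis unfolding word_operator_def by blast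
qed

lemma word_operator_lincomb:
  assumes "word_operator X \<Phi>" "word_operator X \<Psi>"
  shows "word_operator X (\<lambda>f x. a * \<Phi> f x + b * \<Psi> f x)"
proof -
  obtain cs where cs: "\<And>f. smooth_on f UNIV \<Longrightarrow> \<Phi> f = (\<lambda>x. \<Sum>(c, js)\<leftarrow>cs. c * vf_word X js f x)"
    using assms(1) unfolding word_operator_def by blast
  obtain ds where ds: "\<And>f. smooth_on f UNIV \<Longrightarrow> \<Psi> f = (\<lambda>x. \<Sum>(d, ks)\<leftarrow>ds. d * vf_word X ks f x)"
    using assms(2) unfolding word_operator_def by blast
  define es where "es = map (\<lambda>(c, js). (a * c, js)) cs @ map (\<lambda>(d, ks). (b * d, ks)) ds"
  have "(\<lambda>x. a * \<Phi> f x + b * \<Psi> f x) = (\<lambda>x. \<Sum>(c, js)\<leftarrow>es. c * vf_word X js f x)"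
    if f: "smooth_on f UNIV" for f
    by (simp add: es_def cs[OF f] ds[OF f] case_prod_unfold comp_def mult.assoc
        sum_list_const_mult[symmetric])
  then show ?thesis unfolding word_operator_def by blast
qed

lemma word_operator_cong:
  "(\<And>f. smooth_on f UNIV \<Longrightarrow> \<Phi> f = \<Psi> f) \<Longrightarrow> word_operator X \<Psi> \<Longrightarrow> word_operator X \<Phi>"
  unfolding word_operator_def by simp

text \<open>Expanding both second-order words by \<open>has_derivative_directional\<close>, the
  Hessian parts cancel by \<open>pd2_commute\<close>; what remains is the derivative of f along
  DW(V) - DV(W), which is the sign convention of \<open>lie_bracket\<close>.\<close>

lemma vf_deriv_lie_bracket:
  assumes V: "smooth_on V UNIV" and W: "smooth_on W UNIV" and f: "smooth_on f UNIV"
  shows "vf_deriv (lie_bracket V W) f = (\<lambda>x. 1 * vf_deriv V (vf_deriv W f) x + -1 * vf_deriv W (vf_deriv V f) x)"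
proof
  fix x
  note f2 = smooth_on_C_k[OF f, of 2]
  note d = has_derivative_directional[OF open_UNIV f2 UNIV_I smooth_on_has_derivative[OF open_UNIV _ UNIV_I]]
  note lin = has_derivative_linear[OF C_k_on_2D(1)[OF open_UNIV f2 UNIV_I, of x]]
  have eq: "vf_deriv A (vf_deriv B f) x = pd f x (frechet_derivative B (at x) (A x)) +
     (\<Sum>b\<in>Basis. (B x \<bullet> b) * pd2 f x (A x) b)" if "smooth_on B UNIV" for A B
    unfolding vf_deriv_def 
    by (simp add: frechet_derivative_at[OF d[OF that, of x], symmetric])
  have l: "pd2 f x v b = (\<Sum>c\<in>Basis. (v \<bullet> c) * pd2 f x c b)" for v b
    using linear_sum_Basis[OF has_derivative_linear[OF C_k_on_2D(2)[OF open_UNIV f2 UNIV_I]], of b x v]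
    by simp
  have "(\<Sum>b\<in>Basis. (W x \<bullet> b) * pd2 f x (V x) b) =
      (\<Sum>b\<in>Basis. \<Sum>c\<in>Basis. (W x \<bullet> b) * ((V x \<bullet> c) * pd2 f x c b))"
    by (subst l) (simp add: sum_distrib_left)
  also have "\<dots> = (\<Sum>c\<in>Basis. \<Sum>b\<in>Basis. (W x \<bullet> b) * ((V x \<bullet> c) * pd2 f x c b))"
    by (rule sum.swap)
  also have "\<dots> = (\<Sum>c\<in>Basis. \<Sum>b\<in>Basis. (V x \<bullet> c) * ((W x \<bullet> b) * pd2 f x b c))"
    by (intro sum.cong refl) (metis mult.left_commute pd2_commute[OF open_UNIV f2 UNIV_I])
  also have "\<dots> = (\<Sum>c\<in>Basis. (V x \<bullet> c) * pd2 f x (W x) c)"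
    by (subst (2) l) (simp add: sum_distrib_left)
  finally have s: "(\<Sum>b\<in>Basis. (W x \<bullet> b) * pd2 f x (V x) b) = (\<Sum>c\<in>Basis. (V x \<bullet> c) * pd2 f x (W x) c)" .
  have "vf_deriv V (vf_deriv W f) x - vf_deriv W (vf_deriv V f) x =
     pd f x (frechet_derivative W (at x) (V x)) - pd f x (frechet_derivative V (at x) (W x))"
    unfolding eq[OF V] eq[OF W] s by simp
  also have "\<dots> = vf_deriv (lie_bracket V W) f x"
    by (simp add: vf_deriv_def lie_bracket_def linear_diff[OF lin])
  finally show "vf_deriv (lie_bracket V W) f x = 1 * vf_deriv V (vf_deriv W f) x + -1 * vf_deriv W (vf_deriv V f) x"
    by simp
qed

text \<open>Smoothness is carried along in the induction because the bracket case differentiates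
  both fields.\<close>

lemma lie_algebra_word_operator:
  assumes X: "\<And>i. smooth_on (X i) UNIV" and "V \<in> lie_algebra X"
  shows "smooth_on V UNIV \<and> word_operator X (vf_deriv V)"
  using assms(2)
proof (induction rule: lie_algebra.induct)
  case (gen i)
  have "word_operator X (vf_deriv (X i))"
    unfolding word_operator_def
    by (intro exI[of _ "[(1, [i])]"]) simp
  then show ?case using X by blast
next
  case (add V W)
  have "vf_deriv (\<lambda>x. V x + W x) f = (\<lambda>x. 1 * vf_deriv V f x + 1 * vf_deriv W f x)"
    if f: "smooth_on f UNIV" for f
    using has_derivative_linear[OF smooth_on_has_derivative[OF open_UNIV f UNIV_I]]
    by (simp add: vf_deriv_def linear_add fun_eq_iff)
  then show ?case
    using add word_operator_cong[OF _ word_operator_lincomb[of X _ _ 1 1]] by (auto intro: smooth_on_add)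
next
  case (scale V c)
  \<comment> \<open>The zero summand puts the multiple into the form of
    \<open>word_operator_lincomb\<close>.\<close>
  have "vf_deriv (\<lambda>x. c *\<^sub>R V x) f = (\<lambda>x. c * vf_deriv V f x + 0 * vf_deriv V f x)"
    if f: "smooth_on f UNIV" for f
    using has_derivative_linear[OF smooth_on_has_derivative[OF open_UNIV f UNIV_I]]
    by (simp add: vf_deriv_def linear_cmul fun_eq_iff)
  then show ?case
    using scale word_operator_cong[OF _ word_operator_lincomb[of X _ _ c 0]]
    by (auto intro: smooth_on_bounded_linear[OF _ bounded_linear_scaleR_right])
next
  case (bracket V W)
  have "smooth_on (lie_bracket V W) UNIV"
  proof -
    have "smooth_on (\<lambda>x. frechet_derivative W (at x) (V x) + - frechet_derivative V (at x) (W x)) UNIV"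
      using bracket
      by (intro smooth_on_add smooth_on_directional smooth_on_bounded_linear[OF _ bounded_linear_minus[OF bounded_linear_ident]]) auto
    moreover have "lie_bracket V W = (\<lambda>x. frechet_derivative W (at x) (V x) + - frechet_derivative V (at x) (W x))"
      by (simp add: lie_bracket_def fun_eq_iff)
    ultimately show ?thesis by simp
  qed
  moreover have "word_operator X (vf_deriv (lie_bracket V W))"
  proof (rule word_operator_cong)
    show "vf_deriv (lie_bracket V W) f =
        (\<lambda>x. 1 * vf_deriv V (vf_deriv W f) x + -1 * vf_deriv W (vf_deriv V f) x)"
      if "smooth_on f UNIV" for f
      using bracket that by (intro vf_deriv_lie_bracket) auto
    show "word_operator X (\<lambda>f x. 1 * vf_deriv V (vf_deriv W f) x + -1 * vf_deriv W (vf_deriv V f) x)"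
      by (rule word_operator_lincomb[OF word_operator_compose word_operator_compose])
         (use X bracket in blast)+
  qed
  ultimately show ?case by blast
qed

text \<open>The values at x already form a subspace, since the algebra is closed under linear
  combinations. Full dimension thus gives each vector as the value of a single field, not merely of
  a combination.\<close>

lemma lie_algebra_span:
  fixes X :: "'m \<Rightarrow> 'a::euclidean_space \<Rightarrow> 'a"
  assumes "hormander X"
  shows "\<exists>V\<in>lie_algebra X. V x = v"
proof -
  let ?A = "(\<lambda>V. V x) ` lie_algebra X"
  have "subspace ?A"
  proof (rule subspaceI)
    have "(\<lambda>x. 0 *\<^sub>R X undefined x) \<in> lie_algebra X" by (intro lie_algebra.intros)
    then show "0 \<in> ?A" by force
  next
    fix u w assume "u \<in> ?A" "w \<in> ?A"
    then obtain V W where "V \<in> lie_algebra X" "W \<in> lie_algebra X" "u = V x" "w = W x" by blast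
    then show "u + w \<in> ?A" using lie_algebra.add[of V X W] by force
  next
    fix c u assume "u \<in> ?A"
    then obtain V where "V \<in> lie_algebra X" "u = V x" by blast
    then show "c *\<^sub>R u \<in> ?A" using lie_algebra.scale[of V X c] by force
  qed
  moreover have "dim ?A = DIM('a)" using assms by (simp add: hormander_def)
  ultimately have "?A = UNIV" using dim_eq_full[of ?A] span_eq_iff[of ?A] by simp
  then show ?thesis by (metis (mono_tags, lifting) UNIV_I imageE)
qed

section \<open>Euclidean derivatives controlled by words\<close>

lemma functional_bound:
  fixes l :: "'a::euclidean_space \<Rightarrow> real"
  assumes "linear l"
  shows "\<bar>l v\<bar> \<le> norm v * (\<Sum>b\<in>Basis. \<bar>l b\<bar>)"
proof -
  have "\<bar>l v\<bar> = \<bar>\<Sum>b\<in>Basis. (v \<bullet> b) * l b\<bar>"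
    using linear_sum_Basis[OF assms, of v] by simp
  also have "\<dots> \<le> (\<Sum>b\<in>Basis. \<bar>v \<bullet> b\<bar> * \<bar>l b\<bar>)"
    using sum_abs[of "\<lambda>b. (v \<bullet> b) * l b"] by (simp add: abs_mult)
  also have "\<dots> \<le> (\<Sum>b\<in>Basis. norm v * \<bar>l b\<bar>)"
    by (intro sum_mono mult_right_mono Basis_le_norm) auto
  finally show ?thesis by (simp add: sum_distrib_left)
qed

text \<open>With m the sum on the left, replacing b by w b costs at most m / (2 DIM) for each basis
  vector, hence m / 2 altogether, which is absorbed on the left.\<close>

lemma frame_bound:
  fixes l :: "'a::euclidean_space \<Rightarrow> real" and w :: "'a \<Rightarrow> 'a"
  assumes l: "linear l" and w: "\<And>b. b \<in> Basis \<Longrightarrow> norm (w b - b) \<le> 1 / (2 * DIM('a))"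
  shows "(\<Sum>b\<in>Basis. \<bar>l b\<bar>) \<le> 2 * (\<Sum>b\<in>Basis. \<bar>l (w b)\<bar>)"
proof -
  define m where "m = (\<Sum>b\<in>Basis. \<bar>l b\<bar>)"
  have m0: "m \<ge> 0" by (simp add: m_def sum_nonneg)
  have "\<bar>l b\<bar> \<le> \<bar>l (w b)\<bar> + m / (2 * DIM('a))" if b: "b \<in> Basis" for b
  proof -
    have "\<bar>l (w b - b)\<bar> \<le> norm (w b - b) * m"
      unfolding m_def by (rule functional_bound[OF l])
    also have "\<dots> \<le> 1 / (2 * DIM('a)) * m" by (rule mult_right_mono[OF w[OF b] m0])
    finally show ?thesis by (simp add: linear_diff[OF l])
  qed
  then have "m \<le> (\<Sum>b\<in>(Basis::'a set). \<bar>l (w b)\<bar> + m / (2 * DIM('a)))"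
    unfolding m_def by (intro sum_mono)
  also have "\<dots> = (\<Sum>b\<in>Basis. \<bar>l (w b)\<bar>) + m / 2"
    by (simp add: sum.distrib)
  finally show ?thesis by (simp add: m_def)
qed

text \<open>C and J depend on the operator alone. The bound A may therefore vary with the function
  and the point, as it does for the functions \<open>\<lambda>\<xi>. p \<xi> y t\<close>.\<close>

lemma word_operator_bound:
  assumes "word_operator X \<Phi>"
  shows "\<exists>C\<ge>0. \<exists>J. \<forall>f x A. smooth_on f UNIV \<longrightarrow>
    (\<forall>js. length js \<le> J \<longrightarrow> \<bar>vf_word X js f x\<bar> \<le> A) \<longrightarrow> \<bar>\<Phi> f x\<bar> \<le> C * A"
proof -
  obtain cs where cs: "\<And>f. smooth_on f UNIV \<Longrightarrow> \<Phi> f = (\<lambda>x. \<Sum>(c, js)\<leftarrow>cs. c * vf_word X js f x)"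
    using assms(1) unfolding word_operator_def by blast
  define J where "J = Max (insert 0 ((length \<circ> snd) ` set cs))"
  have J: "length js \<le> J" if "(c, js) \<in> set cs" for c js
    unfolding J_def using that by (intro Max_ge) force+
  have "\<bar>\<Sum>(c, js)\<leftarrow>ds. c * vf_word X js f x\<bar> \<le> (\<Sum>(c, js)\<leftarrow>ds. \<bar>c\<bar>) * A"
    if "\<And>js. length js \<le> J \<Longrightarrow> \<bar>vf_word X js f x\<bar> \<le> A" "set ds \<subseteq> set cs" for f x A ds
    using that(2)
  proof (induction ds)
    case (Cons d ds)
    obtain c js where d: "d = (c, js)" by fastforce
    have "\<bar>c * vf_word X js f x\<bar> \<le> \<bar>c\<bar> * A"
      unfolding abs_mult using that(1)[OF J[of c js]] Cons.prems d by (intro mult_left_mono) auto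
    then show ?case using Cons d by (auto simp: distrib_right intro: abs_triangle_ineq[THEN order_trans])
  qed simp
  then have "\<forall>f x A. smooth_on f UNIV \<longrightarrow>
    (\<forall>js. length js \<le> J \<longrightarrow> \<bar>vf_word X js f x\<bar> \<le> A) \<longrightarrow> \<bar>\<Phi> f x\<bar> \<le> (\<Sum>(c, js)\<leftarrow>cs. \<bar>c\<bar>) * A"
    by (auto simp: cs)
  moreover have "0 \<le> (\<Sum>(c, js)\<leftarrow>cs. \<bar>c\<bar>)" by (induction cs) auto
  ultimately show ?thesis by blast
qed

lemma word_operators_bound:
  fixes \<Phi> :: "'i \<Rightarrow> ('a::euclidean_space \<Rightarrow> real) \<Rightarrow> 'a \<Rightarrow> real"
  assumes "finite I" "\<And>i. i \<in> I \<Longrightarrow> word_operator X (\<Phi> i)"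
  shows "\<exists>C\<ge>0. \<exists>J. \<forall>f x A. smooth_on f UNIV \<longrightarrow>
    (\<forall>js. length js \<le> J \<longrightarrow> \<bar>vf_word X js f x\<bar> \<le> A) \<longrightarrow> (\<Sum>i\<in>I. \<bar>\<Phi> i f x\<bar>) \<le> C * A"
proof -
  have "\<forall>i\<in>I. \<exists>C J. C \<ge> 0 \<and> (\<forall>f x A. smooth_on f UNIV \<longrightarrow>
    (\<forall>js. length js \<le> J \<longrightarrow> \<bar>vf_word X js f x\<bar> \<le> A) \<longrightarrow> \<bar>\<Phi> i f x\<bar> \<le> C * A)"
    using word_operator_bound[OF assms(2)] by blast
  then obtain C J where CJ: "\<And>i. i \<in> I \<Longrightarrow> C i \<ge> 0" "\<And>i f x A. i \<in> I \<Longrightarrow> smooth_on f UNIV \<Longrightarrow>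
    (\<forall>js. length js \<le> J i \<longrightarrow> \<bar>vf_word X js f x\<bar> \<le> A) \<Longrightarrow> \<bar>\<Phi> i f x\<bar> \<le> C i * A"
    by metis
  define K where "K = Max (insert 0 (J ` I))"
  have K: "J i \<le> K" if "i \<in> I" for i
    unfolding K_def using that assms(1) by (intro Max_ge) auto
  have "(\<Sum>i\<in>I. \<bar>\<Phi> i f x\<bar>) \<le> (\<Sum>i\<in>I. C i) * A"
    if "smooth_on f UNIV" "\<forall>js. length js \<le> K \<longrightarrow> \<bar>vf_word X js f x\<bar> \<le> A" for f x A
    unfolding sum_distrib_right
    using that K by (intro sum_mono CJ(2)) (auto intro: order_trans)
  then show ?thesis using sum_nonneg[of I C] CJ(1) by blast
qed

text \<open>Choose fields of the Lie algebra that equal the basis vectors at x0. By continuity they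
  stay an almost standard frame on a small ball, and \<open>frame_bound\<close> inverts it. For
  second derivatives, V_c V_b f is the Hessian on (V_c, V_b) plus a first-order term with bounded
  coefficients, which the first-order estimate handles.\<close>

lemma hormander_derivative_bounds:
  fixes X :: "'m \<Rightarrow> 'a::euclidean_space \<Rightarrow> 'a"
  assumes X: "\<And>i. smooth_on (X i) UNIV" and H: "hormander X"
  shows "\<exists>\<delta>>0. \<exists>C\<ge>0. \<exists>J. \<forall>x\<in>ball x0 \<delta>. \<forall>f A. smooth_on f UNIV \<longrightarrow>
    (\<forall>js. length js \<le> J \<longrightarrow> \<bar>vf_word X js f x\<bar> \<le> A) \<longrightarrow>
    (\<forall>b\<in>Basis. \<bar>pd f x b\<bar> \<le> C * A) \<and> (\<forall>b\<in>Basis. \<forall>c\<in>Basis. \<bar>pd2 f x c b\<bar> \<le> C * A)"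
proof -
  obtain V where V: "\<And>b. V b \<in> lie_algebra X" "\<And>b. V b x0 = b"
    using lie_algebra_span[OF H] by metis
  have sm: "smooth_on (V b) UNIV" and wo: "word_operator X (vf_deriv (V b))" for b
    using lie_algebra_word_operator[OF X V(1)] by auto
  have near: "\<exists>d>0. \<forall>x\<in>ball x0 d. norm (V b x - b) \<le> 1 / (2 * DIM('a))" if "b \<in> Basis" for b
  proof -
    have "isCont (V b) x0"
      using C_k_on_continuous[OF smooth_on_C_k[OF sm, of 0]] by (auto simp: continuous_on_eq_continuous_at)
    moreover have "0 < 1 / (2 * real DIM('a))" by simp
    ultimately obtain d where "d > 0" "\<And>y. dist y x0 < d \<Longrightarrow> dist (V b y) (V b x0) < 1 / (2 * real DIM('a))"
      unfolding continuous_at_eps_delta by blast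
    then show ?thesis
      by (intro exI[of _ d]) (auto simp: dist_norm V(2) norm_minus_commute intro: less_imp_le)
  qed
  then obtain d where d: "\<And>b. b \<in> Basis \<Longrightarrow> d b > 0"
    "\<And>b x. b \<in> Basis \<Longrightarrow> x \<in> ball x0 (d b) \<Longrightarrow> norm (V b x - b) \<le> 1 / (2 * DIM('a))"
    by metis
  define \<delta> where "\<delta> = Min (d ` Basis)"
  have \<delta>: "\<delta> > 0" "\<And>b. b \<in> Basis \<Longrightarrow> \<delta> \<le> d b"
    unfolding \<delta>_def using d(1) by auto
  have frame: "norm (V b x - b) \<le> 1 / (2 * DIM('a))" if "x \<in> ball x0 \<delta>" "b \<in> Basis" for x b
    using d(2)[of b x] \<delta>(2)[of b] that by auto
  \<comment> \<open>Direction of the first-order remainder in V_c V_b f, bounded on the closed ball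
    by compactness.\<close>
  define W where "W b c x = frechet_derivative (V b) (at x) (V c x)" for b c x
  have "\<exists>K\<ge>0. \<forall>x\<in>cball x0 \<delta>. norm (W b c x) \<le> K" for b c
  proof -
    have "smooth_on (W b c) UNIV" unfolding W_def
      by (intro smooth_on_directional sm) auto
    then have "continuous_on UNIV (W b c)"
      using C_k_on_continuous[OF smooth_on_C_k[of _ _ 0]] by blast
    then have "bounded (W b c ` cball x0 \<delta>)"
      by (intro compact_imp_bounded compact_continuous_image) (auto intro: continuous_on_subset)
    then obtain K where "\<forall>x\<in>cball x0 \<delta>. norm (W b c x) \<le> K"
      by (auto simp: bounded_iff)
    then show ?thesis by (intro exI[of _ "max K 0"]) auto
  qed
  then obtain K where K: "\<And>b c. K b c \<ge> 0" "\<And>b c x. x \<in> cball x0 \<delta> \<Longrightarrow> norm (W b c x) \<le> K b c"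
    by metis
  define KK where "KK = (\<Sum>b\<in>Basis. \<Sum>c\<in>Basis. K b c)"
  have KK: "KK \<ge> 0" unfolding KK_def by (intro sum_nonneg K)
  obtain C1 J1 where 1: "C1 \<ge> 0" "\<And>f x A. smooth_on f UNIV \<Longrightarrow>
    (\<forall>js. length js \<le> J1 \<longrightarrow> \<bar>vf_word X js f x\<bar> \<le> A) \<Longrightarrow> (\<Sum>b\<in>Basis. \<bar>vf_deriv (V b) f x\<bar>) \<le> C1 * A"
    using word_operators_bound[where I = "Basis :: 'a set" and \<Phi> = "\<lambda>b. vf_deriv (V b)", OF finite_Basis wo]
    by meson
  have wo2: "word_operator X ((\<lambda>(b, c) f. vf_deriv (V c) (vf_deriv (V b) f)) i)" for i
    by (cases i) (auto intro: word_operator_compose[OF X wo wo])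
  obtain C2 J2 where 2: "C2 \<ge> 0" "\<And>f x A. smooth_on f UNIV \<Longrightarrow>
    (\<forall>js. length js \<le> J2 \<longrightarrow> \<bar>vf_word X js f x\<bar> \<le> A) \<Longrightarrow>
    (\<Sum>(b, c)\<in>Basis \<times> Basis. \<bar>vf_deriv (V c) (vf_deriv (V b) f) x\<bar>) \<le> C2 * A"
    using word_operators_bound[where I = "(Basis :: 'a set) \<times> Basis" and X = X and
        \<Phi> = "\<lambda>(b, c) f. vf_deriv (V c) (vf_deriv (V b) f)", OF finite_cartesian_product[OF finite_Basis finite_Basis] wo2]
    unfolding case_prod_unfold by meson
  define C where "C = 2 * C1 + 4 * (C2 + KK * (2 * C1))"
  have bounds: "(\<Sum>b\<in>Basis. \<bar>pd f x b\<bar>) \<le> 2 * C1 * A"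
    "(\<Sum>b\<in>Basis. \<Sum>c\<in>Basis. \<bar>pd2 f x c b\<bar>) \<le> 4 * (C2 + KK * (2 * C1)) * A" "A \<ge> 0"
    if x: "x \<in> ball x0 \<delta>" and f: "smooth_on f UNIV"
      and A: "\<And>js. length js \<le> max J1 J2 \<Longrightarrow> \<bar>vf_word X js f x\<bar> \<le> A" for x f A
  proof -
    note f2 = smooth_on_C_k[OF f, of 2]
    note lin1 = has_derivative_linear[OF C_k_on_2D(1)[OF open_UNIV f2 UNIV_I, of x]]
    note lin2 = has_derivative_linear[OF C_k_on_2D(2)[OF open_UNIV f2 UNIV_I]]
    \<comment> \<open>The empty word is among those bounded by A.\<close>
    show "A \<ge> 0" using A[of "[]"] by simp
    have "(\<Sum>b\<in>Basis. \<bar>pd f x b\<bar>) \<le> 2 * (\<Sum>b\<in>Basis. \<bar>pd f x (V b x)\<bar>)"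
      by (rule frame_bound[OF lin1 frame[OF x]])
    also have "\<dots> \<le> 2 * (C1 * A)"
      using 1(2)[OF f, of x A] A by (simp add: vf_deriv_def)
    finally show m1: "(\<Sum>b\<in>Basis. \<bar>pd f x b\<bar>) \<le> 2 * C1 * A" by simp
    \<comment> \<open>The Hessian as a form that is linear in each slot, so that
      \<open>frame_bound\<close> can replace the basis by the frame one slot at a time; two
      replacements give the factor 4.\<close>
    define Q where "Q v w = (\<Sum>b\<in>Basis. (w \<bullet> b) * pd2 f x v b)" for v w
    have linQ2: "linear (Q v)" for v
      unfolding Q_def by (intro linear_compose_sum ballI linearI) (auto simp: algebra_simps)
    have linQ1: "linear (\<lambda>v. Q v w)" for w
      unfolding Q_def using lin2
      by (intro linear_compose_sum ballI linearI) (auto simp: linear_add linear_cmul algebra_simps)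
    have Qb: "Q v b = pd2 f x v b" if "b \<in> Basis" for v b
    proof -
      have "Q v b = (\<Sum>c\<in>Basis. (if c = b then pd2 f x v c else 0))"
        unfolding Q_def using that by (intro sum.cong) (auto simp: inner_Basis)
      then show ?thesis using that by simp
    qed
    have Q2: "\<bar>Q (V c x) (V b x)\<bar> \<le> \<bar>vf_deriv (V c) (vf_deriv (V b) f) x\<bar> + K b c * (2 * C1 * A)"
      if "b \<in> Basis" "c \<in> Basis" for b c
    proof -
      have "vf_deriv (V c) (vf_deriv (V b) f) x = pd f x (W b c x) + Q (V c x) (V b x)"
        unfolding vf_deriv_def Q_def W_def
        using frechet_derivative_at[OF has_derivative_directional[OF open_UNIV f2 UNIV_I
            smooth_on_has_derivative[OF open_UNIV sm UNIV_I], of b x], symmetric]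
        by simp
      moreover have "\<bar>pd f x (W b c x)\<bar> \<le> norm (W b c x) * (\<Sum>b\<in>Basis. \<bar>pd f x b\<bar>)"
        by (rule functional_bound[OF lin1])
      moreover have "\<dots> \<le> K b c * (2 * C1 * A)"
        using K(2)[of x b c] K(1)[of b c] x m1 by (intro mult_mono) (auto intro: sum_nonneg)
      ultimately show ?thesis by linarith
    qed
    have "(\<Sum>b\<in>Basis. \<Sum>c\<in>Basis. \<bar>pd2 f x c b\<bar>) = (\<Sum>c\<in>Basis. \<Sum>b\<in>Basis. \<bar>Q c b\<bar>)"
      by (subst sum.swap) (simp add: Qb)
    also have "\<dots> \<le> (\<Sum>c\<in>Basis. 2 * (\<Sum>b\<in>Basis. \<bar>Q c (V b x)\<bar>))"
      by (intro sum_mono frame_bound[OF linQ2 frame[OF x]])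
    also have "\<dots> = 2 * (\<Sum>b\<in>Basis. \<Sum>c\<in>Basis. \<bar>Q c (V b x)\<bar>)"
      by (subst sum.swap) (simp add: sum_distrib_left)
    also have "\<dots> \<le> 2 * (\<Sum>b\<in>Basis. 2 * (\<Sum>c\<in>Basis. \<bar>Q (V c x) (V b x)\<bar>))"
      by (intro mult_left_mono sum_mono frame_bound[OF linQ1 frame[OF x]]) auto
    also have "\<dots> = 4 * (\<Sum>b\<in>Basis. \<Sum>c\<in>Basis. \<bar>Q (V c x) (V b x)\<bar>)"
      by (simp add: sum_distrib_left)
    also have "\<dots> \<le> 4 * (\<Sum>b\<in>Basis. \<Sum>c\<in>Basis. \<bar>vf_deriv (V c) (vf_deriv (V b) f) x\<bar> + K b c * (2 * C1 * A))"
      by (intro mult_left_mono sum_mono Q2) auto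
    also have "\<dots> = 4 * ((\<Sum>(b, c)\<in>Basis \<times> Basis. \<bar>vf_deriv (V c) (vf_deriv (V b) f) x\<bar>) + KK * (2 * C1 * A))"
      by (simp add: KK_def sum.distrib sum.cartesian_product[symmetric] sum_distrib_right)
    also have "\<dots> \<le> 4 * (C2 * A + KK * (2 * C1 * A))"
      using 2(2)[OF f, of x A] A by simp
    finally show "(\<Sum>b\<in>Basis. \<Sum>c\<in>Basis. \<bar>pd2 f x c b\<bar>) \<le> 4 * (C2 + KK * (2 * C1)) * A"
      by (simp add: algebra_simps)
  qed
  have C: "C \<ge> 0" "2 * C1 \<le> C" "4 * (C2 + KK * (2 * C1)) \<le> C"
    using 1(1) 2(1) KK by (auto simp: C_def)
  have "\<bar>pd f x b\<bar> \<le> C * A \<and> (\<forall>c\<in>Basis. \<bar>pd2 f x c b\<bar> \<le> C * A)"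
    if x: "x \<in> ball x0 \<delta>" and f: "smooth_on f UNIV"
      and A: "\<And>js. length js \<le> max J1 J2 \<Longrightarrow> \<bar>vf_word X js f x\<bar> \<le> A" and b: "b \<in> Basis" for x f A b
  proof (intro conjI ballI)
    note B = bounds[OF x f A]
    have "\<bar>pd f x b\<bar> \<le> (\<Sum>b\<in>Basis. \<bar>pd f x b\<bar>)" using b by (intro member_le_sum) auto
    also note B(1)
    also have "2 * C1 * A \<le> C * A" using C B(3) by (intro mult_right_mono) auto
    finally show "\<bar>pd f x b\<bar> \<le> C * A" by simp
    fix c :: 'a assume c: "c \<in> Basis"
    have "\<bar>pd2 f x c b\<bar> \<le> (\<Sum>c\<in>Basis. \<bar>pd2 f x c b\<bar>)" using c by (intro member_le_sum) auto
    also have "\<dots> \<le> (\<Sum>b\<in>Basis. \<Sum>c\<in>Basis. \<bar>pd2 f x c b\<bar>)"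
      using b by (intro member_le_sum[of b Basis "\<lambda>b. \<Sum>c\<in>Basis. \<bar>pd2 f x c b\<bar>"] sum_nonneg) auto
    also note B(2)
    also have "4 * (C2 + KK * (2 * C1)) * A \<le> C * A" using C B(3) by (intro mult_right_mono) auto
    finally show "\<bar>pd2 f x c b\<bar> \<le> C * A" by simp
  qed
  then show ?thesis using \<delta>(1) C(1) by (intro exI[of _ \<delta>] exI[of _ C] exI[of _ "max J1 J2"] conjI) blast+
qed

section \<open>The sub-Laplacian as a second-order operator\<close>

text \<open>Entries of the matrix A = \<Sum> X_i X_i^T; the sub-Laplacian is the divergence-form
  operator div (A grad f).\<close>

definition diffusion :: "('m::finite \<Rightarrow> 'a::euclidean_space \<Rightarrow> 'a) \<Rightarrow> 'a \<Rightarrow> 'a \<Rightarrow> 'a \<Rightarrow> real" where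
  "diffusion X b c x = (\<Sum>i\<in>UNIV. (X i x \<bullet> b) * (X i x \<bullet> c))"

lemma diffusion_commute: "diffusion X b c x = diffusion X c b x"
  by (simp add: diffusion_def mult.commute)

lemma pd_eqI: "(f has_derivative f') (at x) \<Longrightarrow> pd f x v = f' v"
  using frechet_derivative_at[of f f' x] by simp

lemma C_k_on_inner:
  assumes "open S" "C_k_on k f S"
  shows "C_k_on k (\<lambda>x. f x \<bullet> b) S"
  using C_k_on_bounded_linear[OF assms(1) bounded_linear_inner_left assms(2)] .

lemma C_k_on_diffusion:
  assumes "\<And>i. smooth_on (X i) UNIV"
  shows "C_k_on k (diffusion X b c) UNIV"
  unfolding diffusion_def[abs_def]
  by (intro C_k_on_sum C_k_on_mult C_k_on_inner smooth_on_C_k assms) auto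

text \<open>Each X_i^* X_i f is minus the divergence of (X_i f) X_i; summing over i turns these
  vectors into A grad f, and the product rule separates the two orders. Only C^2 regularity near the
  point is used, so the formula also serves the extension.\<close>

lemma sub_laplacian_eq:
  fixes X :: "'m::finite \<Rightarrow> 'a::euclidean_space \<Rightarrow> 'a"
  assumes X: "\<And>i. smooth_on (X i) UNIV" and S: "open S" and f: "C_k_on 2 f S" and x: "x \<in> S"
  shows "sub_laplacian X f x = (\<Sum>b\<in>Basis. \<Sum>c\<in>Basis.
      diffusion X b c x * pd2 f x b c + pd (diffusion X b c) x b * pd f x c)"
proof -
  define q where "q i b c y = (X i y \<bullet> b) * (X i y \<bullet> c)" for i b c y
  have qC: "C_k_on 1 (q i b c) UNIV" for i b c
    unfolding q_def[abs_def] by (intro C_k_on_mult C_k_on_inner smooth_on_C_k X) auto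
  have qd: "(q i b c has_derivative frechet_derivative (q i b c) (at y)) (at y)" for i b c y
    by (rule C_k_on_Suc_derivative[OF open_UNIV, of 0]) (use qC in auto)
  have "((\<lambda>y. vf_deriv (X i) f y * (X i y \<bullet> b)) has_derivative
       (\<lambda>v. \<Sum>c\<in>Basis. q i b c x * pd2 f x v c + pd (q i b c) x v * pd f x c)) (at x)" for i b
  proof -
    have "((\<lambda>y. \<Sum>c\<in>Basis. q i b c y * pd f y c) has_derivative
       (\<lambda>v. \<Sum>c\<in>Basis. q i b c x * pd2 f x v c + pd (q i b c) x v * pd f x c)) (at x)"
      by (intro has_derivative_sum has_derivative_mult qd C_k_on_2D(2)[OF S f x])
    moreover have "(\<Sum>c\<in>Basis. q i b c y * pd f y c) = vf_deriv (X i) f y * (X i y \<bullet> b)" if "y \<in> S" for y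
      using linear_sum_Basis[OF has_derivative_linear[OF C_k_on_2D(1)[OF S f that]], of "X i y"]
      by (simp add: vf_deriv_def q_def sum_distrib_left sum_distrib_right mult_ac)
    ultimately show ?thesis
      by (rule has_derivative_transform_within_open[OF _ S x])
  qed
  from pd_eqI[OF this] have "sub_laplacian X f x = (\<Sum>i\<in>UNIV. \<Sum>b\<in>Basis. \<Sum>c\<in>Basis.
      q i b c x * pd2 f x b c + pd (q i b c) x b * pd f x c)"
    by (simp add: sub_laplacian_def vf_adjoint_def sum_negf)
  also have "\<dots> = (\<Sum>b\<in>Basis. \<Sum>c\<in>Basis. \<Sum>i\<in>UNIV.
      q i b c x * pd2 f x b c + pd (q i b c) x b * pd f x c)"
    by (subst sum.swap, subst (2) sum.swap) (rule refl)
  also have "\<dots> = (\<Sum>b\<in>Basis. \<Sum>c\<in>Basis.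
      diffusion X b c x * pd2 f x b c + pd (diffusion X b c) x b * pd f x c)"
  proof (intro sum.cong refl)
    fix b c :: 'a
    have "(diffusion X b c has_derivative (\<lambda>v. \<Sum>i\<in>UNIV. pd (q i b c) x v)) (at x)"
      unfolding diffusion_def[abs_def] q_def[symmetric] by (intro has_derivative_sum qd)
    from pd_eqI[OF this]
    show "(\<Sum>i\<in>UNIV. q i b c x * pd2 f x b c + pd (q i b c) x b * pd f x c) =
        diffusion X b c x * pd2 f x b c + pd (diffusion X b c) x b * pd f x c"
      by (simp add: sum.distrib sum_distrib_right diffusion_def q_def)
  qed
  finally show ?thesis .
qed

text \<open>Off the compact set, testing the two operators on \<open>((y - x) \<bullet> b)\<^sup>2\<close> identifies the diffusion
  matrix with the identity.\<close>

lemma fields_bounded: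
  fixes X :: "'m::finite \<Rightarrow> 'a::euclidean_space \<Rightarrow> 'a"
  assumes X: "\<And>i. smooth_on (X i) UNIV" and "laplacian_off_compact X"
  shows "\<exists>\<Lambda>. \<forall>i x. norm (X i x) \<le> \<Lambda>"
proof -
  obtain K where K: "compact K"
    "\<And>f x. smooth_on f UNIV \<Longrightarrow> x \<notin> K \<Longrightarrow> sub_laplacian X f x = laplacian f x"
    using assms(2) unfolding laplacian_off_compact_def by blast
  have off: "norm (X i x) \<le> DIM('a)" if x: "x \<notin> K" for i x
  proof -
    have "\<bar>X i x \<bullet> e\<bar> \<le> 1" if e: "e \<in> Basis" for e
    proof -
      \<comment> \<open>The gradient vanishes at x and the Hessian is 2 e e^T, so both operators
        reduce there to one diagonal entry.\<close>
      define f where "f y = ((y - x) \<bullet> e) * ((y - x) \<bullet> e)" for y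
      have lin: "C_k_on k (\<lambda>y. (y - x) \<bullet> e) UNIV" for k
      proof -
        have "C_k_on k (\<lambda>y. y \<bullet> e + - (x \<bullet> e)) UNIV"
          by (intro C_k_on_add C_k_on_linear bounded_linear_inner_left C_k_on_const) auto
        then show ?thesis by (simp add: inner_diff_left)
      qed
      have sm: "smooth_on f UNIV" unfolding smooth_on_def f_def[abs_def]
        by (intro allI C_k_on_mult lin) auto
      have f1: "pd f y v = 2 * ((y - x) \<bullet> e) * (v \<bullet> e)" for y v
        unfolding f_def[abs_def] by (rule pd_eqI) (auto intro!: derivative_eq_intros)
      have f2: "pd2 f y w v = 2 * (w \<bullet> e) * (v \<bullet> e)" for y w v
        unfolding f1 by (rule pd_eqI) (auto intro!: derivative_eq_intros)
      have del: "(\<Sum>b\<in>Basis. g b * (b \<bullet> e)) = g e" for g :: "'a \<Rightarrow> real"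
      proof -
        have "(\<Sum>b\<in>Basis. g b * (b \<bullet> e)) = (\<Sum>b\<in>Basis. if b = e then g b else 0)"
          using e by (intro sum.cong) (auto simp: inner_Basis)
        then show ?thesis using e by simp
      qed
      have "sub_laplacian X f x = (\<Sum>b\<in>Basis. \<Sum>c\<in>Basis. diffusion X b c x * (2 * (b \<bullet> e) * (c \<bullet> e)))"
        unfolding sub_laplacian_eq[OF X open_UNIV smooth_on_C_k[OF sm] UNIV_I] f2 by (simp add: f1)
      also have "\<dots> = (\<Sum>b\<in>Basis. (2 * (\<Sum>c\<in>Basis. diffusion X b c x * (c \<bullet> e))) * (b \<bullet> e))"
        by (simp add: sum_distrib_left sum_distrib_right mult_ac)
      also have "\<dots> = 2 * diffusion X e e x"
        unfolding del ..
      finally have 1: "sub_laplacian X f x = 2 * diffusion X e e x" .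
      have "laplacian f x = (\<Sum>b\<in>Basis. (2 * (b \<bullet> e)) * (b \<bullet> e))"
        by (simp add: laplacian_def pderivs_def f2)
      also have "\<dots> = 2" unfolding del using e by simp
      finally have "diffusion X e e x = 1" using 1 K(2)[OF sm x] by simp
      \<comment> \<open>The diagonal entry is the sum of the squared e-components of all fields, so
        each of them is at most 1.\<close>
      moreover have "(X i x \<bullet> e) * (X i x \<bullet> e) \<le> diffusion X e e x"
        unfolding diffusion_def by (intro member_le_sum[of i UNIV "\<lambda>i. (X i x \<bullet> e) * (X i x \<bullet> e)"]) auto
      ultimately have "(X i x \<bullet> e)\<^sup>2 \<le> 1" by (simp add: power2_eq_square)
      then show ?thesis by (simp add: abs_square_le_1)
    qed
    then have "(\<Sum>e\<in>(Basis::'a set). \<bar>X i x \<bullet> e\<bar>) \<le> (\<Sum>e\<in>(Basis::'a set). 1)" by (intro sum_mono) auto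
    then show ?thesis using norm_le_l1[of "X i x"] by simp
  qed
  have "\<exists>B. \<forall>x\<in>K. norm (X i x) \<le> B" for i
  proof -
    have "continuous_on K (X i)"
      using C_k_on_continuous[OF smooth_on_C_k[OF X, where k = 0]] by (rule continuous_on_subset) auto
    then have "bounded (X i ` K)" using K(1) compact_continuous_image compact_imp_bounded by blast
    then show ?thesis by (auto simp: bounded_iff)
  qed
  then obtain B where B: "\<And>i x. x \<in> K \<Longrightarrow> norm (X i x) \<le> B i" by metis
  have "norm (X i x) \<le> DIM('a) + (\<Sum>i\<in>UNIV. \<bar>B i\<bar>)" for i x
  proof (cases "x \<in> K")
    case True
    have "\<bar>B i\<bar> \<le> (\<Sum>i\<in>UNIV. \<bar>B i\<bar>)" by (intro member_le_sum) auto
    then show ?thesis using B[OF True, of i] by simp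
  next
    case False
    have "0 \<le> (\<Sum>i\<in>UNIV. \<bar>B i\<bar>)" by (intro sum_nonneg) auto
    then show ?thesis using off[OF False, of i] by linarith
  qed
  then show ?thesis by blast
qed

section \<open>Parametric integrals\<close>

lemma integrable_dominated:
  fixes f g :: "'w \<Rightarrow> real"
  assumes "integrable M g" "f \<in> borel_measurable M" "\<And>\<omega>. \<omega> \<in> space M \<Longrightarrow> \<bar>f \<omega>\<bar> \<le> g \<omega>"
  shows "integrable M f"
  by (rule Bochner_Integration.integrable_bound[OF assms(1,2)])
     (auto intro!: AE_I2 order_trans[OF assms(3)])

text \<open>Approximate the identity by simple functions in the first argument.\<close>

lemma caratheodory_measurable:
  fixes f :: "'a::euclidean_space \<Rightarrow> 'b \<Rightarrow> real"
  assumes S: "open S" and cont: "\<And>\<omega>. \<omega> \<in> space M \<Longrightarrow> continuous_on S (\<lambda>a. f a \<omega>)"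
    and meas: "\<And>a. a \<in> S \<Longrightarrow> f a \<in> borel_measurable M"
  shows "(\<lambda>(a, \<omega>). indicator S a * f a \<omega>) \<in> borel_measurable (borel \<Otimes>\<^sub>M M)"
proof -
  have "(\<lambda>x::'a. x) \<in> borel_measurable borel" by simp
  from borel_measurable_implies_sequence_metric[OF this, of 0] obtain s :: "nat \<Rightarrow> 'a \<Rightarrow> 'a"
    where s: "\<And>i. simple_function borel (s i)" "\<And>x. (\<lambda>i. s i x) \<longlonglongrightarrow> x"
    by auto
  \<comment> \<open>Approximating points may fall outside S, where nothing is known about f; the
    indicator sets those values to 0.\<close>
  define g where "g i w = indicator S (s i (fst w)) * f (s i (fst w)) (snd w)" for i w
  have gm: "g i \<in> borel_measurable (borel \<Otimes>\<^sub>M M)" for i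
  proof -
    have fin: "finite (range (s i))" using s(1)[of i] by (simp add: simple_function_def)
    have "s i \<in> borel \<rightarrow>\<^sub>M count_space UNIV"
      using measurable_simple_function[OF s(1)] .
    then have m0: "(\<lambda>w. s i (fst w)) \<in> borel \<Otimes>\<^sub>M M \<rightarrow>\<^sub>M count_space UNIV"
      by (rule measurable_compose[OF measurable_fst])
    then have m: "(\<lambda>w. s i (fst w)) \<in> borel \<Otimes>\<^sub>M M \<rightarrow>\<^sub>M count_space (range (s i))"
      unfolding measurable_def using measurable_sets[OF m0] by auto
    have "(\<lambda>w. indicator S a * f a (snd w)) \<in> borel_measurable (borel \<Otimes>\<^sub>M M)" for a
      using measurable_compose[OF measurable_snd meas[of a], of borel]
      by (cases "a \<in> S") auto
    then show ?thesis unfolding g_def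
      by (intro measurable_compose_countable'[OF _ m countable_finite[OF fin],
            of "\<lambda>a w. indicator S a * f a (snd w)"])
  qed
  have "(\<lambda>w. indicator S (fst w) * f (fst w) (snd w)) \<in> borel_measurable (borel \<Otimes>\<^sub>M M)"
  proof (rule borel_measurable_LIMSEQ_real[where u = "\<lambda>i w. indicator S (fst w) * g i w"])
    fix i show "(\<lambda>w. indicator S (fst w) * g i w) \<in> borel_measurable (borel \<Otimes>\<^sub>M M)"
    proof -
      have [measurable]: "S \<in> sets borel" using S by simp
      show ?thesis using gm[of i] by measurable
    qed
  next
    fix w :: "'a \<times> 'b" assume "w \<in> space (borel \<Otimes>\<^sub>M M)"
    then have w: "snd w \<in> space M" by (auto simp: space_pair_measure)
    show "(\<lambda>i. indicator S (fst w) * g i w) \<longlonglongrightarrow> indicator S (fst w) * f (fst w) (snd w)"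
    proof (cases "fst w \<in> S")
      case True
      have ev: "eventually (\<lambda>i. s i (fst w) \<in> S) sequentially"
        using topological_tendstoD[OF s(2) S True] .
      have "isCont (\<lambda>a. f a (snd w)) (fst w)"
        using cont[OF w] S True by (simp add: continuous_on_eq_continuous_at)
      then have "(\<lambda>i. f (s i (fst w)) (snd w)) \<longlonglongrightarrow> f (fst w) (snd w)"
        by (rule isCont_tendsto_compose[OF _ s(2)])
      moreover have "eventually (\<lambda>i. f (s i (fst w)) (snd w) = indicator S (fst w) * g i w) sequentially"
        using ev by eventually_elim (simp add: g_def True)
      ultimately show ?thesis using True by (simp add: tendsto_cong[THEN iffD1])
    qed auto
  qed
  then show ?thesis by (simp add: case_prod_unfold)
qed

text \<open>Measurability of the derivatives in the integration variable is obtained from that of F,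
  through the difference quotients at x + v / (n + 1).\<close>

lemma measurable_deriv_limit:
  fixes F :: "'a::euclidean_space \<Rightarrow> 'w \<Rightarrow> real"
  assumes S: "open S" "x \<in> S" and der: "\<And>\<omega>. \<omega> \<in> space M \<Longrightarrow> ((\<lambda>x. F x \<omega>) has_derivative (\<lambda>v. D v \<omega>)) (at x)"
    and meas: "\<And>x. x \<in> S \<Longrightarrow> F x \<in> borel_measurable M"
  shows "D v \<in> borel_measurable M"
proof -
  define y where "y n = x + inverse (real (Suc n)) *\<^sub>R v" for n
  have inv: "(\<lambda>n. inverse (real (Suc n))) \<longlonglongrightarrow> 0" by (rule LIMSEQ_inverse_real_of_nat)
  have y: "y \<longlonglongrightarrow> x"
    unfolding y_def using tendsto_add[OF tendsto_const[of x] tendsto_scaleR[OF inv tendsto_const[of v]]] by simp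
  have ev: "eventually (\<lambda>n. y n \<in> S) sequentially" using topological_tendstoD[OF y S] .
  show ?thesis
  \<comment> \<open>The indicator removes the finitely many n with \<open>y n\<close> outside S,
    where F need not be measurable.\<close>
  proof (rule borel_measurable_LIMSEQ_real[where u = "\<lambda>n \<omega>. indicator S (y n) * (real (Suc n) * (F (y n) \<omega> - F x \<omega>))"])
    fix n show "(\<lambda>\<omega>. indicator S (y n) * (real (Suc n) * (F (y n) \<omega> - F x \<omega>))) \<in> borel_measurable M"
      using meas[of "y n"] meas[OF S(2)] by (cases "y n \<in> S") simp_all
  next
    fix \<omega> assume w: "\<omega> \<in> space M"
    have "((\<lambda>s. F (x + s *\<^sub>R v) \<omega>) has_real_derivative D v \<omega>) (at 0)"
      using has_derivative_along_line[of "\<lambda>x. F x \<omega>" "\<lambda>v. D v \<omega>" x 0 v] der[OF w] by simp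
    then have "((\<lambda>h. (F (x + h *\<^sub>R v) \<omega> - F x \<omega>) / h) \<longlongrightarrow> D v \<omega>) (at 0)"
      by (simp add: DERIV_def)
    then have "(\<lambda>n. (F (x + inverse (real (Suc n)) *\<^sub>R v) \<omega> - F x \<omega>) / inverse (real (Suc n))) \<longlonglongrightarrow> D v \<omega>"
      by (rule filterlim_compose) (use inv in \<open>auto simp: filterlim_at\<close>)
    then have "(\<lambda>n. real (Suc n) * (F (y n) \<omega> - F x \<omega>)) \<longlonglongrightarrow> D v \<omega>"
      by (simp add: y_def divide_inverse mult.commute)
    moreover have "eventually (\<lambda>n. real (Suc n) * (F (y n) \<omega> - F x \<omega>) =
        indicator S (y n) * (real (Suc n) * (F (y n) \<omega> - F x \<omega>))) sequentially"
      using ev by eventually_elim simp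
    ultimately show "(\<lambda>n. indicator S (y n) * (real (Suc n) * (F (y n) \<omega> - F x \<omega>))) \<longlonglongrightarrow> D v \<omega>"
      by (rule Lim_transform_eventually)
  qed
qed

text \<open>Pratt's variant of dominated convergence: the dominating functions may vary as long as their
  integrals converge. Truncating \<open>f\<^sub>n\<close> at \<open>\<plusminus>g\<close> reduces it to the classical theorem.\<close>

lemma integral_convergence_Pratt:
  fixes f :: "nat \<Rightarrow> 'w \<Rightarrow> real"
  assumes fm: "\<And>n. f n \<in> borel_measurable M"
    and f: "\<And>\<omega>. \<omega> \<in> space M \<Longrightarrow> (\<lambda>n. f n \<omega>) \<longlonglongrightarrow> f' \<omega>"
    and g: "\<And>\<omega>. \<omega> \<in> space M \<Longrightarrow> (\<lambda>n. g n \<omega>) \<longlonglongrightarrow> g' \<omega>"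
    and le: "\<And>n \<omega>. \<omega> \<in> space M \<Longrightarrow> \<bar>f n \<omega>\<bar> \<le> g n \<omega>"
    and gi: "\<And>n. integrable M (g n)" "integrable M g'"
    and lim: "(\<lambda>n. \<integral>\<omega>. g n \<omega> \<partial>M) \<longlonglongrightarrow> (\<integral>\<omega>. g' \<omega> \<partial>M)"
  shows "(\<lambda>n. \<integral>\<omega>. f n \<omega> \<partial>M) \<longlonglongrightarrow> (\<integral>\<omega>. f' \<omega> \<partial>M)"
proof -
  have fi: "integrable M (f n)" for n
    by (rule integrable_dominated[OF gi(1) fm le])
  have f'm: "f' \<in> borel_measurable M"
    by (rule borel_measurable_LIMSEQ_real[OF f fm])
  have g'pos: "g' \<omega> \<ge> 0" if "\<omega> \<in> space M" for \<omega>
    by (rule LIMSEQ_le_const[OF g[OF that]]) (use le[OF that] in \<open>force intro: order_trans[OF abs_ge_zero]\<close>)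
  have f'le: "\<bar>f' \<omega>\<bar> \<le> g' \<omega>" if "\<omega> \<in> space M" for \<omega>
    by (rule LIMSEQ_le[OF tendsto_rabs[OF f[OF that]] g[OF that]]) (use le[OF that] in auto)
  define h where "h n \<omega> = max (- g' \<omega>) (min (g' \<omega>) (f n \<omega>))" for n \<omega>
  have hm: "h n \<in> borel_measurable M" for n
    unfolding h_def using fm gi(2) by measurable
  have hle: "\<bar>h n \<omega>\<bar> \<le> g' \<omega>" if "\<omega> \<in> space M" for n \<omega>
    using g'pos[OF that] by (auto simp: h_def)
  have hi: "integrable M (h n)" for n
    by (rule integrable_dominated[OF gi(2) hm hle])
  have 1: "(\<lambda>n. \<integral>\<omega>. h n \<omega> \<partial>M) \<longlonglongrightarrow> (\<integral>\<omega>. f' \<omega> \<partial>M)"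
  proof (rule integral_dominated_convergence[where w = g'])
    show "AE \<omega> in M. (\<lambda>n. h n \<omega>) \<longlonglongrightarrow> f' \<omega>"
    proof (rule AE_I2)
      fix \<omega> assume w: "\<omega> \<in> space M"
      have "(\<lambda>n. h n \<omega>) \<longlonglongrightarrow> max (- g' \<omega>) (min (g' \<omega>) (f' \<omega>))"
        unfolding h_def by (intro tendsto_intros f w)
      then show "(\<lambda>n. h n \<omega>) \<longlonglongrightarrow> f' \<omega>" using f'le[OF w] by (simp add: max_def min_def split: if_splits)
    qed
  qed (use f'm hm gi hle in auto)
  \<comment> \<open>The positive part of g' - g_n is at most g' because g_n is nonnegative, so the
    classical theorem sends its integral to 0.\<close>
  define k where "k n \<omega> = max 0 (g' \<omega> - g n \<omega>)" for n \<omega>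
  have km: "k n \<in> borel_measurable M" for n
    unfolding k_def using gi by measurable
  have ki: "integrable M (k n)" for n
    unfolding k_def using gi by (intro integrable_max) auto
  have 2: "(\<lambda>n. \<integral>\<omega>. k n \<omega> \<partial>M) \<longlonglongrightarrow> (\<integral>\<omega>. 0 \<partial>M)"
  proof (rule integral_dominated_convergence[where w = g'])
    show "AE \<omega> in M. (\<lambda>n. k n \<omega>) \<longlonglongrightarrow> 0"
    proof (rule AE_I2)
      fix \<omega> assume w: "\<omega> \<in> space M"
      have "(\<lambda>n. k n \<omega>) \<longlonglongrightarrow> max 0 (g' \<omega> - g' \<omega>)"
        unfolding k_def by (intro tendsto_intros g w)
      then show "(\<lambda>n. k n \<omega>) \<longlonglongrightarrow> 0" by simp
    qed
    show "AE \<omega> in M. norm (k n \<omega>) \<le> g' \<omega>" for n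
      using g'pos le by (intro AE_I2) (force simp: k_def intro: order_trans[OF abs_ge_zero])
  qed (use km gi in auto)
  have 3: "(\<lambda>n. (\<integral>\<omega>. g n \<omega> \<partial>M) - (\<integral>\<omega>. g' \<omega> \<partial>M) + (\<integral>\<omega>. k n \<omega> \<partial>M)) \<longlonglongrightarrow> 0"
    using tendsto_add[OF tendsto_diff[OF lim tendsto_const[of "\<integral>\<omega>. g' \<omega> \<partial>M"]] 2] by simp
  \<comment> \<open>Truncation changes f_n only where it exceeds g' in size, and then by at most the
    positive part of g_n - g', which equals g_n - g' + k_n.\<close>
  have 4: "\<bar>(\<integral>\<omega>. f n \<omega> \<partial>M) - (\<integral>\<omega>. h n \<omega> \<partial>M)\<bar> \<le>
      (\<integral>\<omega>. g n \<omega> \<partial>M) - (\<integral>\<omega>. g' \<omega> \<partial>M) + (\<integral>\<omega>. k n \<omega> \<partial>M)" for n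
  proof -
    have "\<bar>(\<integral>\<omega>. f n \<omega> \<partial>M) - (\<integral>\<omega>. h n \<omega> \<partial>M)\<bar> = \<bar>\<integral>\<omega>. f n \<omega> - h n \<omega> \<partial>M\<bar>"
      using fi hi by simp
    also have "\<dots> \<le> (\<integral>\<omega>. \<bar>f n \<omega> - h n \<omega>\<bar> \<partial>M)" by (rule integral_abs_bound)
    also have "\<dots> \<le> (\<integral>\<omega>. g n \<omega> - g' \<omega> + k n \<omega> \<partial>M)"
    proof (rule integral_mono)
      fix \<omega> assume w: "\<omega> \<in> space M"
      show "\<bar>f n \<omega> - h n \<omega>\<bar> \<le> g n \<omega> - g' \<omega> + k n \<omega>"
        using le[OF w, of n] g'pos[OF w] unfolding h_def k_def by linarith
    qed (use fi hi gi ki in auto)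
    finally show ?thesis using gi ki by simp
  qed
  have "(\<lambda>n. (\<integral>\<omega>. f n \<omega> \<partial>M) - (\<integral>\<omega>. h n \<omega> \<partial>M)) \<longlonglongrightarrow> 0"
    by (rule Lim_null_comparison[OF _ 3]) (use 4 in auto)
  from tendsto_add[OF this 1] show ?thesis by simp
qed

lemma continuous_on_integral_Pratt:
  fixes F G :: "'a::euclidean_space \<Rightarrow> 'w \<Rightarrow> real"
  assumes F: "\<And>\<omega>. \<omega> \<in> space M \<Longrightarrow> continuous_on S (\<lambda>x. F x \<omega>)"
    and G: "\<And>\<omega>. \<omega> \<in> space M \<Longrightarrow> continuous_on S (\<lambda>x. G x \<omega>)"
    and meas: "\<And>x. x \<in> S \<Longrightarrow> F x \<in> borel_measurable M"
    and le: "\<And>x \<omega>. x \<in> S \<Longrightarrow> \<omega> \<in> space M \<Longrightarrow> \<bar>F x \<omega>\<bar> \<le> G x \<omega>"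
    and Gi: "\<And>x. x \<in> S \<Longrightarrow> integrable M (G x)"
    and Gc: "continuous_on S (\<lambda>x. \<integral>\<omega>. G x \<omega> \<partial>M)"
  shows "continuous_on S (\<lambda>x. \<integral>\<omega>. F x \<omega> \<partial>M)"
  unfolding continuous_on_sequentially comp_def
proof (intro allI ballI impI)
  fix y x assume x: "x \<in> S" and y: "(\<forall>n. y n \<in> S) \<and> y \<longlonglongrightarrow> x"
  have sq: "(\<lambda>n. g (y n)) \<longlonglongrightarrow> g x" if "continuous_on S g" for g :: "'a \<Rightarrow> real"
    using that x y unfolding continuous_on_sequentially comp_def by blast
  show "(\<lambda>n. \<integral>\<omega>. F (y n) \<omega> \<partial>M) \<longlonglongrightarrow> (\<integral>\<omega>. F x \<omega> \<partial>M)"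
    by (rule integral_convergence_Pratt[where g = "\<lambda>n. G (y n)" and g' = "G x"])
       (use x y in \<open>auto intro!: meas le Gi sq[OF F] sq[OF G] sq[OF Gc]\<close>)
qed

text \<open>Difference quotients at x are not dominated by G x, since the dominating function moves
  with the point. Instead the increment of F is written as an integral of D along the segment,
  Fubini exchanges the two integrals, and Pratt's theorem makes the integrated partial derivatives
  continuous; continuous partials then give differentiability.\<close>

lemma (in sigma_finite_measure) integral_has_derivative_Pratt:
  fixes F G :: "'e::euclidean_space \<Rightarrow> 'a \<Rightarrow> real" and D :: "'e \<Rightarrow> 'e \<Rightarrow> 'a \<Rightarrow> real"
  assumes S: "open S"
    and der: "\<And>x \<omega>. x \<in> S \<Longrightarrow> \<omega> \<in> space M \<Longrightarrow> ((\<lambda>x. F x \<omega>) has_derivative (\<lambda>v. D x v \<omega>)) (at x)"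
    and Dc: "\<And>b \<omega>. b \<in> Basis \<Longrightarrow> \<omega> \<in> space M \<Longrightarrow> continuous_on S (\<lambda>x. D x b \<omega>)"
    and Gc: "\<And>\<omega>. \<omega> \<in> space M \<Longrightarrow> continuous_on S (\<lambda>x. G x \<omega>)"
    and meas: "\<And>x. x \<in> S \<Longrightarrow> F x \<in> borel_measurable M"
    and Fle: "\<And>x \<omega>. x \<in> S \<Longrightarrow> \<omega> \<in> space M \<Longrightarrow> \<bar>F x \<omega>\<bar> \<le> G x \<omega>"
    and Dle: "\<And>x b \<omega>. x \<in> S \<Longrightarrow> b \<in> Basis \<Longrightarrow> \<omega> \<in> space M \<Longrightarrow> \<bar>D x b \<omega>\<bar> \<le> G x \<omega>"
    and Gi: "\<And>x. x \<in> S \<Longrightarrow> integrable M (G x)"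
    and Gic: "continuous_on S (\<lambda>x. \<integral>\<omega>. G x \<omega> \<partial>M)"
    and x: "x \<in> S"
  shows "((\<lambda>x. \<integral>\<omega>. F x \<omega> \<partial>M) has_derivative (\<lambda>v. \<integral>\<omega>. D x v \<omega> \<partial>M)) (at x)"
proof -
  have Dm: "D x v \<in> borel_measurable M" if "x \<in> S" for x v
    by (rule measurable_deriv_limit[OF S that der[OF that] meas])
  have Dsum: "D x v \<omega> = (\<Sum>b\<in>Basis. (v \<bullet> b) * D x b \<omega>)" if "x \<in> S" "\<omega> \<in> space M" for x v \<omega>
    using linear_sum_Basis[OF has_derivative_linear[OF der[OF that]], of v] by simp
  define L where "L v = (\<Sum>b\<in>Basis. \<bar>v \<bullet> b\<bar>)" for v :: 'e
  have Dle': "\<bar>D x v \<omega>\<bar> \<le> L v * G x \<omega>" if "x \<in> S" "\<omega> \<in> space M" for x v \<omega>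
  proof -
    have "\<bar>D x v \<omega>\<bar> \<le> (\<Sum>b\<in>Basis. \<bar>(v \<bullet> b) * D x b \<omega>\<bar>)"
      by (subst Dsum[OF that]) (rule sum_abs)
    also have "\<dots> \<le> (\<Sum>b\<in>Basis. \<bar>v \<bullet> b\<bar> * G x \<omega>)"
      unfolding abs_mult by (intro sum_mono mult_left_mono Dle that) auto
    finally show ?thesis by (simp add: L_def sum_distrib_right)
  qed
  have Dci: "continuous_on S (\<lambda>x. D x v \<omega>)" if "\<omega> \<in> space M" for v \<omega>
  proof -
    have "continuous_on S (\<lambda>x. \<Sum>b\<in>Basis. (v \<bullet> b) * D x b \<omega>)"
      by (intro continuous_intros Dc that)
    then show ?thesis
      by (rule continuous_on_eq) (rule Dsum[OF _ that, symmetric])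
  qed
  have Di: "integrable M (D x v)" if "x \<in> S" for x v
    by (rule integrable_dominated[OF integrable_mult_right[OF Gi[OF that], of "L v"] Dm[OF that] Dle'[OF that]])
  have Fi: "integrable M (F x)" if "x \<in> S" for x
    by (rule integrable_dominated[OF Gi[OF that] meas[OF that] Fle[OF that]])
  define d where "d x v = (\<integral>\<omega>. D x v \<omega> \<partial>M)" for x v
  have dsum: "d x v = (\<Sum>b\<in>Basis. (v \<bullet> b) * d x b)" if "x \<in> S" for x v
  proof -
    have "d x v = (\<integral>\<omega>. (\<Sum>b\<in>Basis. (v \<bullet> b) * D x b \<omega>) \<partial>M)"
      unfolding d_def by (intro Bochner_Integration.integral_cong refl Dsum that)
    also have "\<dots> = (\<Sum>b\<in>Basis. \<integral>\<omega>. (v \<bullet> b) * D x b \<omega> \<partial>M)"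
      by (rule Bochner_Integration.integral_sum) (intro integrable_mult_right Di that)
    finally show ?thesis by (simp add: d_def)
  qed
  have dc: "continuous_on S (\<lambda>x. d x v)" for v
    unfolding d_def
  proof (rule continuous_on_integral_Pratt[where G = "\<lambda>x \<omega>. L v * G x \<omega>"])
    show "continuous_on S (\<lambda>x. \<integral>\<omega>. L v * G x \<omega> \<partial>M)"
      using Gi Gic by (auto intro!: continuous_intros)
  qed (auto intro!: continuous_intros Dci Gc Dm Dle' integrable_mult_right Gi)
  obtain r where r: "r > 0" "cball x r \<subseteq> S" using S x by (auto simp: open_contains_cball)
  let ?f = "\<lambda>x. \<integral>\<omega>. F x \<omega> \<partial>M"
  have incr: "?f (x + v) - ?f x = (\<integral>\<tau>. d (x + \<tau> *\<^sub>R v) v * indicator {0..1} \<tau> \<partial>lborel)"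
    if v: "norm v < r" for v
  proof -
    \<comment> \<open>\<open>caratheodory_measurable\<close> asks for an open parameter set, so the
      segment is enlarged to T and afterwards cut back to [0, 1].\<close>
    define T where "T = (\<lambda>\<tau>. x + \<tau> *\<^sub>R v) -` S"
    have cl: "continuous_on UNIV (\<lambda>\<tau>. x + \<tau> *\<^sub>R v)" by (intro continuous_intros)
    have T: "open T" unfolding T_def by (rule open_vimage[OF S cl])
    have TS: "x + \<tau> *\<^sub>R v \<in> S" if "\<tau> \<in> T" for \<tau> using that by (simp add: T_def)
    have I: "{0..1} \<subseteq> T"
    proof
      fix \<tau> :: real assume "\<tau> \<in> {0..1}"
      then have "norm (\<tau> *\<^sub>R v) \<le> norm v" by (simp add: mult_left_le_one_le)
      then show "\<tau> \<in> T" using v r by (auto simp: T_def subset_iff dist_norm)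
    qed
    define H where "H \<tau> \<omega> = D (x + \<tau> *\<^sub>R v) v \<omega> * indicator {0..1} \<tau>" for \<tau> \<omega>
    interpret P: pair_sigma_finite lborel M ..
    have Hm: "(\<lambda>(\<tau>, \<omega>). H \<tau> \<omega>) \<in> borel_measurable (lborel \<Otimes>\<^sub>M M)"
    proof -
      have "(\<lambda>(\<tau>, \<omega>). indicator T \<tau> * D (x + \<tau> *\<^sub>R v) v \<omega>) \<in> borel_measurable (borel \<Otimes>\<^sub>M M)"
        by (rule caratheodory_measurable[OF T])
           (auto intro!: continuous_on_compose2[OF Dci] continuous_on_subset[OF cl] Dm TS)
      then have m: "(\<lambda>(\<tau>, \<omega>). indicator T \<tau> * D (x + \<tau> *\<^sub>R v) v \<omega>) \<in> borel_measurable (lborel \<Otimes>\<^sub>M M)"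
        by (simp add: measurable_lborel1 cong: measurable_cong_sets sets_pair_measure_cong)
      have "(\<lambda>w. indicator {0..1} (fst w) * (case w of (\<tau>, \<omega>) \<Rightarrow> indicator T \<tau> * D (x + \<tau> *\<^sub>R v) v \<omega>))
          \<in> borel_measurable (lborel \<Otimes>\<^sub>M M)"
        using m by measurable
      also have "(\<lambda>w. indicator {0..1} (fst w) * (case w of (\<tau>, \<omega>) \<Rightarrow> indicator T \<tau> * D (x + \<tau> *\<^sub>R v) v \<omega>))
          = (\<lambda>(\<tau>, \<omega>). H \<tau> \<omega>)"
        using I by (auto simp: H_def fun_eq_iff indicator_def)
      finally show ?thesis .
    qed
    have gi: "integrable lborel (\<lambda>\<tau>. (\<integral>\<omega>. G (x + \<tau> *\<^sub>R v) \<omega> \<partial>M) * indicator {0..1} \<tau>)"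
    proof -
      have "continuous_on {0..1} (\<lambda>\<tau>. \<integral>\<omega>. G (x + \<tau> *\<^sub>R v) \<omega> \<partial>M)"
        by (rule continuous_on_compose2[OF Gic continuous_on_subset[OF cl]]) (use I TS in auto)
      from borel_integrable_compact[OF _ this] show ?thesis by (simp add: mult.commute indicator_scaleR_eq_if set_integrable_def)
    qed
    have Hi: "integrable (lborel \<Otimes>\<^sub>M M) (\<lambda>(\<tau>, \<omega>). H \<tau> \<omega>)"
    proof (rule P.Fubini_integrable[OF Hm])
      show "AE \<tau> in lborel. integrable M (\<lambda>\<omega>. case (\<tau>, \<omega>) of (\<tau>, \<omega>) \<Rightarrow> H \<tau> \<omega>)"
      proof (rule AE_I2)
        fix \<tau>
        show "integrable M (\<lambda>\<omega>. case (\<tau>, \<omega>) of (\<tau>, \<omega>) \<Rightarrow> H \<tau> \<omega>)"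
          using Di[OF TS, of \<tau> v] I by (cases "\<tau> \<in> {0..1}") (auto simp: H_def)
      qed
      show "integrable lborel (\<lambda>\<tau>. \<integral>\<omega>. norm (case (\<tau>, \<omega>) of (\<tau>, \<omega>) \<Rightarrow> H \<tau> \<omega>) \<partial>M)"
      proof (rule integrable_dominated[OF integrable_mult_right[OF gi, of "L v"]])
        show "(\<lambda>\<tau>. \<integral>\<omega>. norm (case (\<tau>, \<omega>) of (\<tau>, \<omega>) \<Rightarrow> H \<tau> \<omega>) \<partial>M) \<in> borel_measurable lborel"
          using Hm by measurable
        have "(\<integral>\<omega>. \<bar>H \<tau> \<omega>\<bar> \<partial>M) \<le> L v * ((\<integral>\<omega>. G (x + \<tau> *\<^sub>R v) \<omega> \<partial>M) * indicator {0..1} \<tau>)" for \<tau>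
        proof (cases "\<tau> \<in> {0..1}")
          case True
          then have s: "x + \<tau> *\<^sub>R v \<in> S" using TS I by blast
          have "(\<integral>\<omega>. \<bar>D (x + \<tau> *\<^sub>R v) v \<omega>\<bar> \<partial>M) \<le> (\<integral>\<omega>. L v * G (x + \<tau> *\<^sub>R v) \<omega> \<partial>M)"
            by (rule integral_mono) (use Di[OF s] Gi[OF s] Dle'[OF s] in auto)
          then show ?thesis using True by (simp add: H_def)
        qed (simp add: H_def)
        then show "\<bar>\<integral>\<omega>. norm (case (\<tau>, \<omega>) of (\<tau>, \<omega>) \<Rightarrow> H \<tau> \<omega>) \<partial>M\<bar> \<le>
            L v * ((\<integral>\<omega>. G (x + \<tau> *\<^sub>R v) \<omega> \<partial>M) * indicator {0..1} \<tau>)" for \<tau>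
          by (simp add: integral_nonneg_AE)
      qed
    qed
    have pt: "F (x + v) \<omega> - F x \<omega> = (\<integral>\<tau>. H \<tau> \<omega> \<partial>lborel)" if w: "\<omega> \<in> space M" for \<omega>
    proof -
      have "(\<integral>\<tau>. indicator {0..1} \<tau> *\<^sub>R D (x + \<tau> *\<^sub>R v) v \<omega> \<partial>lborel) = F (x + 1 *\<^sub>R v) \<omega> - F (x + 0 *\<^sub>R v) \<omega>"
      proof (rule integral_FTC_atLeastAtMost)
        fix \<tau> :: real assume "0 \<le> \<tau>" "\<tau> \<le> 1"
        then have "x + \<tau> *\<^sub>R v \<in> S" using TS I by auto
        then have "((\<lambda>\<tau>. F (x + \<tau> *\<^sub>R v) \<omega>) has_real_derivative D (x + \<tau> *\<^sub>R v) v \<omega>) (at \<tau>)"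
          using has_derivative_along_line[of "\<lambda>x. F x \<omega>", OF der[OF _ w]] by blast
        then show "((\<lambda>\<tau>. F (x + \<tau> *\<^sub>R v) \<omega>) has_vector_derivative D (x + \<tau> *\<^sub>R v) v \<omega>) (at \<tau> within {0..1})"
          using has_real_derivative_iff_has_vector_derivative has_vector_derivative_at_within by blast
      next
        show "continuous_on {0..1} (\<lambda>\<tau>. D (x + \<tau> *\<^sub>R v) v \<omega>)"
          by (rule continuous_on_compose2[OF Dci[OF w] continuous_on_subset[OF cl]]) (use I TS in auto)
      qed simp
      then show ?thesis by (simp add: H_def mult.commute)
    qed
    have "x + v \<in> S" using TS[OF subsetD[OF I, of 1]] by simp
    then have "?f (x + v) - ?f x = (\<integral>\<omega>. F (x + v) \<omega> - F x \<omega> \<partial>M)"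
      using Fi x by simp
    also have "\<dots> = (\<integral>\<omega>. (\<integral>\<tau>. H \<tau> \<omega> \<partial>lborel) \<partial>M)"
      by (intro Bochner_Integration.integral_cong refl pt)
    also have "\<dots> = (\<integral>\<tau>. (\<integral>\<omega>. H \<tau> \<omega> \<partial>M) \<partial>lborel)"
      by (rule P.Fubini_integral[OF Hi])
    also have "\<dots> = (\<integral>\<tau>. d (x + \<tau> *\<^sub>R v) v * indicator {0..1} \<tau> \<partial>lborel)"
      by (simp add: H_def d_def)
    finally show ?thesis .
  qed
  have "(?f has_derivative d x) (at x)"
    unfolding has_derivative_at_alt
  proof (intro conjI allI impI)
    have "bounded_linear (\<lambda>v. \<Sum>b\<in>Basis. (v \<bullet> b) * d x b)"
      by (intro bounded_linear_sum bounded_linear_mult_const bounded_linear_inner_left)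
    moreover have "d x = (\<lambda>v. \<Sum>b\<in>Basis. (v \<bullet> b) * d x b)" using dsum[OF x] by (rule ext)
    ultimately show "bounded_linear (d x)" by simp
    fix e :: real assume e: "e > 0"
    \<comment> \<open>The DIM many coordinate errors of size e' add up to e / 2.\<close>
    define e' where "e' = e / (2 * DIM('e))"
    have e': "e' > 0" using e by (simp add: e'_def)
    have "\<exists>\<delta>>0. \<forall>y. dist y x < \<delta> \<longrightarrow> \<bar>d y b - d x b\<bar> < e'" for b
      using dc[of b] S x e' unfolding continuous_on_eq_continuous_at[OF S] continuous_at_eps_delta dist_real_def
      by blast
    then obtain \<delta> where \<delta>: "\<And>b. \<delta> b > 0" "\<And>b y. dist y x < \<delta> b \<Longrightarrow> \<bar>d y b - d x b\<bar> < e'" by metis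
    define \<rho> where "\<rho> = min r (Min (\<delta> ` Basis))"
    have \<rho>: "\<rho> > 0" "\<rho> \<le> r" "\<And>b. b \<in> Basis \<Longrightarrow> \<rho> \<le> \<delta> b"
      using r \<delta> by (auto simp: \<rho>_def min.coboundedI2)
    show "\<exists>\<delta>>0. \<forall>y. norm (y - x) < \<delta> \<longrightarrow> norm (?f y - ?f x - d x (y - x)) \<le> e * norm (y - x)"
    proof (intro exI[of _ \<rho>] conjI allI impI \<rho>(1))
      fix y assume y: "norm (y - x) < \<rho>"
      define v where "v = y - x"
      have v: "norm v < r" "y = x + v" using y \<rho> by (auto simp: v_def)
      have close: "\<bar>d (x + \<tau> *\<^sub>R v) v - d x v\<bar> \<le> e / 2 * norm v" and inS: "x + \<tau> *\<^sub>R v \<in> S" if "\<tau> \<in> {0..1}" for \<tau>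
      proof -
        have n: "norm (\<tau> *\<^sub>R v) \<le> norm v" using that by (simp add: mult_left_le_one_le)
        then show inS: "x + \<tau> *\<^sub>R v \<in> S" using v r by (auto simp: subset_iff dist_norm)
        have "d (x + \<tau> *\<^sub>R v) v - d x v = (\<Sum>b\<in>Basis. (v \<bullet> b) * (d (x + \<tau> *\<^sub>R v) b - d x b))"
          by (subst dsum[OF inS, of v], subst dsum[OF x, of v]) (simp add: sum_subtractf right_diff_distrib)
        also have "\<bar>\<dots>\<bar> \<le> (\<Sum>b\<in>Basis. \<bar>v \<bullet> b\<bar> * \<bar>d (x + \<tau> *\<^sub>R v) b - d x b\<bar>)"
          unfolding abs_mult[symmetric] by (rule sum_abs)
        also have "\<dots> \<le> (\<Sum>b\<in>(Basis::'e set). norm v * e')"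
        proof (intro sum_mono mult_mono Basis_le_norm)
          fix b :: 'e assume "b \<in> Basis"
          then have "dist (x + \<tau> *\<^sub>R v) x < \<delta> b"
            using n y \<rho>(3)[of b] by (simp add: dist_norm v_def)
          then show "\<bar>d (x + \<tau> *\<^sub>R v) b - d x b\<bar> \<le> e'" using \<delta>(2)[of "x + \<tau> *\<^sub>R v" b] by simp
        qed auto
        also have "\<dots> = e / 2 * norm v" by (simp add: e'_def)
        finally show "\<bar>d (x + \<tau> *\<^sub>R v) v - d x v\<bar> \<le> e / 2 * norm v" .
      qed
      have ci: "continuous_on {0..1} (\<lambda>\<tau>. d (x + \<tau> *\<^sub>R v) v)"
        by (rule continuous_on_compose2[OF dc]) (use inS in \<open>auto intro!: continuous_intros\<close>)
      have i1: "integrable lborel (\<lambda>\<tau>. d (x + \<tau> *\<^sub>R v) v * indicator {0..1} \<tau>)"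
        using borel_integrable_compact[OF _ ci] by (simp add: mult.commute indicator_scaleR_eq_if)
      have i2: "integrable lborel (\<lambda>\<tau>::real. c * indicator {0..1} \<tau>)" for c :: real
        by (intro integrable_mult_right) (simp add: integrable_indicator_iff)
      have "?f y - ?f x - d x v = (\<integral>\<tau>. d (x + \<tau> *\<^sub>R v) v * indicator {0..1} \<tau> \<partial>lborel)
          - (\<integral>\<tau>. d x v * indicator {0..1::real} \<tau> \<partial>lborel)"
        unfolding v(2) incr[OF v(1)] by simp
      also have "\<dots> = (\<integral>\<tau>. (d (x + \<tau> *\<^sub>R v) v - d x v) * indicator {0..1} \<tau> \<partial>lborel)"
        using i1 i2[of "d x v"] by (simp add: left_diff_distrib)
      also have "\<bar>\<dots>\<bar> \<le> (\<integral>\<tau>. \<bar>(d (x + \<tau> *\<^sub>R v) v - d x v) * indicator {0..1} \<tau>\<bar> \<partial>lborel)"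
        by (rule integral_abs_bound)
      also have "\<dots> \<le> (\<integral>\<tau>. (e / 2 * norm v) * indicator {0..1::real} \<tau> \<partial>lborel)"
      proof (rule integral_mono)
        show "integrable lborel (\<lambda>\<tau>. \<bar>(d (x + \<tau> *\<^sub>R v) v - d x v) * indicator {0..1} \<tau>\<bar>)"
          using i1 i2[of "d x v"] by (simp add: left_diff_distrib)
        show "\<bar>(d (x + \<tau> *\<^sub>R v) v - d x v) * indicator {0..1} \<tau>\<bar> \<le> (e / 2 * norm v) * indicator {0..1} \<tau>" for \<tau>
          using close[of \<tau>] by (cases "\<tau> \<in> {0..1}") auto
      qed (rule i2)
      also have "\<dots> = e / 2 * norm v" by simp
      also have "\<dots> \<le> e * norm v" using e by (intro mult_right_mono) auto
      finally show "norm (?f y - ?f x - d x (y - x)) \<le> e * norm (y - x)" by (simp add: v_def)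
    qed
  qed
  then show ?thesis unfolding d_def[abs_def] .
qed

lemma (in sigma_finite_measure) C2_integral_Pratt:
  fixes F G :: "'e::euclidean_space \<Rightarrow> 'a \<Rightarrow> real"
    and D1 :: "'e \<Rightarrow> 'e \<Rightarrow> 'a \<Rightarrow> real" and D2 :: "'e \<Rightarrow> 'e \<Rightarrow> 'e \<Rightarrow> 'a \<Rightarrow> real"
  assumes S: "open S"
    and der1: "\<And>x \<omega>. x \<in> S \<Longrightarrow> \<omega> \<in> space M \<Longrightarrow> ((\<lambda>x. F x \<omega>) has_derivative (\<lambda>v. D1 x v \<omega>)) (at x)"
    and der2: "\<And>x b \<omega>. x \<in> S \<Longrightarrow> b \<in> Basis \<Longrightarrow> \<omega> \<in> space M \<Longrightarrow>
        ((\<lambda>x. D1 x b \<omega>) has_derivative (\<lambda>v. D2 x b v \<omega>)) (at x)"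
    and D2c: "\<And>b c \<omega>. b \<in> Basis \<Longrightarrow> c \<in> Basis \<Longrightarrow> \<omega> \<in> space M \<Longrightarrow> continuous_on S (\<lambda>x. D2 x b c \<omega>)"
    and Gc: "\<And>\<omega>. \<omega> \<in> space M \<Longrightarrow> continuous_on S (\<lambda>x. G x \<omega>)"
    and meas: "\<And>x. x \<in> S \<Longrightarrow> F x \<in> borel_measurable M"
    and Fle: "\<And>x \<omega>. x \<in> S \<Longrightarrow> \<omega> \<in> space M \<Longrightarrow> \<bar>F x \<omega>\<bar> \<le> G x \<omega>"
    and D1le: "\<And>x b \<omega>. x \<in> S \<Longrightarrow> b \<in> Basis \<Longrightarrow> \<omega> \<in> space M \<Longrightarrow> \<bar>D1 x b \<omega>\<bar> \<le> G x \<omega>"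
    and D2le: "\<And>x b c \<omega>. x \<in> S \<Longrightarrow> b \<in> Basis \<Longrightarrow> c \<in> Basis \<Longrightarrow> \<omega> \<in> space M \<Longrightarrow> \<bar>D2 x b c \<omega>\<bar> \<le> G x \<omega>"
    and Gi: "\<And>x. x \<in> S \<Longrightarrow> integrable M (G x)"
    and Gic: "continuous_on S (\<lambda>x. \<integral>\<omega>. G x \<omega> \<partial>M)"
  shows "C_k_on 2 (\<lambda>x. \<integral>\<omega>. F x \<omega> \<partial>M) S"
    and "x \<in> S \<Longrightarrow> integrable M (F x)"
    and "x \<in> S \<Longrightarrow> b \<in> Basis \<Longrightarrow> integrable M (D1 x b)"
    and "x \<in> S \<Longrightarrow> b \<in> Basis \<Longrightarrow> c \<in> Basis \<Longrightarrow> integrable M (D2 x b c)"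
    and "x \<in> S \<Longrightarrow> pd (\<lambda>x. \<integral>\<omega>. F x \<omega> \<partial>M) x v = (\<integral>\<omega>. D1 x v \<omega> \<partial>M)"
    and "x \<in> S \<Longrightarrow> b \<in> Basis \<Longrightarrow> pd2 (\<lambda>x. \<integral>\<omega>. F x \<omega> \<partial>M) x v b = (\<integral>\<omega>. D2 x b v \<omega> \<partial>M)"
proof -
  have m1: "D1 x b \<in> borel_measurable M" if "x \<in> S" for x b
    by (rule measurable_deriv_limit[OF S that der1[OF that] meas])
  have m2: "D2 x b c \<in> borel_measurable M" if "x \<in> S" "b \<in> Basis" for x b c
    by (rule measurable_deriv_limit[OF S that(1) der2[OF that] m1])
  have D1c: "continuous_on S (\<lambda>x. D1 x b \<omega>)" if "b \<in> Basis" "\<omega> \<in> space M" for b \<omega>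
    using der2[OF _ that] by (meson continuous_at_imp_continuous_on has_derivative_continuous)
  let ?\<Phi> = "\<lambda>x. \<integral>\<omega>. F x \<omega> \<partial>M"
  have d1: "(?\<Phi> has_derivative (\<lambda>v. \<integral>\<omega>. D1 x v \<omega> \<partial>M)) (at x)" if "x \<in> S" for x
    by (rule integral_has_derivative_Pratt[OF S der1 D1c Gc meas Fle D1le Gi Gic that])
  have d2: "((\<lambda>x. \<integral>\<omega>. D1 x b \<omega> \<partial>M) has_derivative (\<lambda>v. \<integral>\<omega>. D2 x b v \<omega> \<partial>M)) (at x)"
    if "x \<in> S" "b \<in> Basis" for x b
    by (rule integral_has_derivative_Pratt[OF S der2[OF _ that(2)] D2c[OF that(2)] Gc m1
          D1le[OF _ that(2)] D2le[OF _ that(2)] Gi Gic that(1)])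
  have c2: "continuous_on S (\<lambda>x. \<integral>\<omega>. D2 x b c \<omega> \<partial>M)" if "b \<in> Basis" "c \<in> Basis" for b c
    by (rule continuous_on_integral_Pratt[OF D2c[OF that] Gc m2[OF _ that(1)] D2le[OF _ that] Gi Gic])
  have "C_k_on (Suc 0) (\<lambda>x. \<integral>\<omega>. D1 x b \<omega> \<partial>M) S" if "b \<in> Basis" for b
    by (rule C_k_on_SucI[OF S d2[OF _ that]]) (simp_all add: c2 that)
  from C_k_on_SucI[OF S d1 this] show "C_k_on 2 ?\<Phi> S" by (simp only: numeral_2_eq_2)
  show "x \<in> S \<Longrightarrow> integrable M (F x)"
    by (rule integrable_dominated[OF Gi meas Fle])
  show "x \<in> S \<Longrightarrow> b \<in> Basis \<Longrightarrow> integrable M (D1 x b)"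
    by (rule integrable_dominated[OF Gi m1 D1le])
  show "x \<in> S \<Longrightarrow> b \<in> Basis \<Longrightarrow> c \<in> Basis \<Longrightarrow> integrable M (D2 x b c)"
    by (rule integrable_dominated[OF Gi m2 D2le])
  have e1: "pd ?\<Phi> x v = (\<integral>\<omega>. D1 x v \<omega> \<partial>M)" if "x \<in> S" for x v
    by (rule pd_eqI[OF d1[OF that]])
  show "x \<in> S \<Longrightarrow> pd ?\<Phi> x v = (\<integral>\<omega>. D1 x v \<omega> \<partial>M)" by (rule e1)
  assume x: "x \<in> S" and b: "b \<in> Basis"
  have "((\<lambda>y. pd ?\<Phi> y b) has_derivative (\<lambda>v. \<integral>\<omega>. D2 x b v \<omega> \<partial>M)) (at x)"
    by (rule has_derivative_transform_within_open[OF d2[OF x b] S x]) (simp add: e1)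
  from pd_eqI[OF this] show "pd2 ?\<Phi> x v b = (\<integral>\<omega>. D2 x b v \<omega> \<partial>M)" .
qed

text \<open>Substitute r = c / t in Euler's integral. The change of variables is carried out for
  Lebesgue measurable functions; measurability of the integrand in the Borel sense brings the result
  back to \<open>lborel\<close>.\<close>

lemma inverse_gamma_integral:
  fixes c \<sigma> :: real
  assumes c: "c > 0" and \<sigma>: "\<sigma> > 0"
  shows "set_integrable lborel {0<..} (\<lambda>t. exp (- c / t) / t powr (1 + \<sigma>))"
    and "(LINT t:{0<..}|lborel. exp (- c / t) / t powr (1 + \<sigma>)) = Gamma \<sigma> / c powr \<sigma>"
proof -
  define f where "f r = r powr (\<sigma> - 1) / exp r" for r :: real
  define g where "g t = c / t" for t
  define g' where "g' t = - c / t\<^sup>2" for t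
  have "(f has_integral Gamma \<sigma>) {0..}" unfolding f_def by (rule Gamma_integral_real[OF \<sigma>])
  then have "((\<lambda>r. if r \<in> {0<..} then f r else 0) has_integral Gamma \<sigma>) {0..}"
    by (rule has_integral_eq[rotated]) (auto simp: f_def not_less)
  then have hi: "(f has_integral Gamma \<sigma>) {0<..}"
    by (subst (asm) has_integral_restrict) auto
  then have "f absolutely_integrable_on {0<..}"
    by (intro nonnegative_absolutely_integrable_1) (auto simp: f_def)
  then have 1: "f absolutely_integrable_on (g ` {0<..}) \<and> integral (g ` {0<..}) f = Gamma \<sigma>"
  proof -
    have "g ` {0<..} = {0<..}"
    proof
      show "{0<..} \<subseteq> g ` {0<..}"
      proof
        fix r :: real assume "r \<in> {0<..}"
        then show "r \<in> g ` {0<..}" using c by (intro image_eqI[of _ _ "c / r"]) (auto simp: g_def)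
      qed
    qed (use c in \<open>auto simp: g_def\<close>)
    then show ?thesis using \<open>f absolutely_integrable_on {0<..}\<close> integral_unique[OF hi] by simp
  qed
  have "(\<lambda>t. \<bar>g' t\<bar> * f (g t)) absolutely_integrable_on {0<..} \<and>
      integral {0<..} (\<lambda>t. \<bar>g' t\<bar> * f (g t)) = Gamma \<sigma>"
  proof (rule iffD2[OF has_absolute_integral_change_of_variables_1'[where g = g and g' = g' and f = f]])
    show "(g has_field_derivative g' t) (at t within {0<..})" if "t \<in> {0<..}" for t
      using that unfolding g_def g'_def by (auto intro!: derivative_eq_intros simp: power2_eq_square)
    show "inj_on g {0<..}" using c by (auto simp: inj_on_def g_def)
  qed (use 1 in auto)
  note A = this
  have eq: "\<bar>g' t\<bar> * f (g t) = c powr \<sigma> * (exp (- c / t) / t powr (1 + \<sigma>))" if "t \<in> {0<..}" for t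
  proof -
    have "\<bar>g' t\<bar> * f (g t) = c / t\<^sup>2 * ((c powr (\<sigma> - 1) / t powr (\<sigma> - 1)) / exp (c / t))"
      using that c by (simp add: g'_def f_def g_def powr_divide)
    also have "\<dots> = (c powr 1 * c powr (\<sigma> - 1)) / (t powr 2 * t powr (\<sigma> - 1)) * exp (- c / t)"
      using that c by (simp add: exp_minus field_simps)
    also have "c powr 1 * c powr (\<sigma> - 1) = c powr \<sigma>" by (simp only: powr_add[symmetric]) simp
    also have "t powr 2 * t powr (\<sigma> - 1) = t powr (1 + \<sigma>)" by (simp only: powr_add[symmetric]) (simp add: add.commute)
    finally show ?thesis by simp
  qed
  have "(\<lambda>t. c powr \<sigma> * (exp (- c / t) / t powr (1 + \<sigma>))) absolutely_integrable_on {0<..}"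
    using A set_integrable_cong[OF refl refl eq, of "{0<..}" "\<lambda>x. x" lebesgue] by simp
  moreover have "integral {0<..} (\<lambda>t. c powr \<sigma> * (exp (- c / t) / t powr (1 + \<sigma>))) = Gamma \<sigma>"
  proof -
    have "integral {0<..} (\<lambda>t. c powr \<sigma> * (exp (- c / t) / t powr (1 + \<sigma>))) = integral {0<..} (\<lambda>t. \<bar>g' t\<bar> * f (g t))"
      by (rule Henstock_Kurzweil_Integration.integral_cong) (simp only: eq)
    then show ?thesis using A by simp
  qed
  ultimately have B: "(\<lambda>t. c powr \<sigma> * h t) absolutely_integrable_on {0<..}" "integral {0<..} (\<lambda>t. c powr \<sigma> * h t) = Gamma \<sigma>"
    if "h = (\<lambda>t. exp (- c / t) / t powr (1 + \<sigma>))" for h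
    unfolding that by auto
  have v: "c powr \<sigma> * integral {0<..} (\<lambda>t. exp (- c / t) / t powr (1 + \<sigma>)) = Gamma \<sigma>"
    using B(2)[OF refl] by (simp only: Henstock_Kurzweil_Integration.integral_mult_right)
  have ai: "(\<lambda>t. exp (- c / t) / t powr (1 + \<sigma>)) absolutely_integrable_on {0<..}"
  proof -
    have "(\<lambda>t. inverse (c powr \<sigma>) * (c powr \<sigma> * (exp (- c / t) / t powr (1 + \<sigma>)))) absolutely_integrable_on {0<..}"
      by (rule set_integrable_mult_right) (rule B(1)[OF refl])
    then show ?thesis using c by (simp add: mult.assoc[symmetric])
  qed
  have m: "(\<lambda>t. indicator {0<..} t *\<^sub>R (exp (- c / t) / t powr (1 + \<sigma>))) \<in> borel_measurable lborel"
    by measurable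
  show si: "set_integrable lborel {0<..} (\<lambda>t. exp (- c / t) / t powr (1 + \<sigma>))"
    using ai m unfolding set_integrable_def by (simp add: integrable_completion)
  show "(LINT t:{0<..}|lborel. exp (- c / t) / t powr (1 + \<sigma>)) = Gamma \<sigma> / c powr \<sigma>"
    using v c set_borel_integral_eq_integral(2)[OF si] by (simp add: field_simps)
qed

text \<open>The constant K makes 1 + r \<le> K (1 + \<epsilon> r / (J + 1)), hence 1 + r \<le> K exp
  (\<epsilon> r / (J + 1)); then take powers. The exponent J + 1 avoids dividing by 0 when J =
  0.\<close>

lemma poly_exp_bound:
  fixes \<epsilon> :: real
  assumes \<epsilon>: "\<epsilon> > 0"
  shows "\<exists>C>0. \<forall>r\<ge>0. (1 + r) ^ J \<le> C * exp (\<epsilon> * r)"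
proof -
  define K where "K = 1 + real (Suc J) / \<epsilon>"
  have K: "K \<ge> 1" using \<epsilon> by (simp add: K_def)
  have "(1 + r) ^ J \<le> K ^ Suc J * exp (\<epsilon> * r)" if r: "r \<ge> 0" for r
  proof -
    have "1 + r \<le> K * (1 + \<epsilon> * r / real (Suc J))"
      using \<epsilon> r by (simp add: K_def field_simps add_nonneg_nonneg del: of_nat_Suc)
    also have "\<dots> \<le> K * exp (\<epsilon> * r / real (Suc J))"
      using K exp_ge_add_one_self[of "\<epsilon> * r / real (Suc J)"] by (intro mult_left_mono) auto
    finally have "(1 + r) ^ Suc J \<le> (K * exp (\<epsilon> * r / real (Suc J))) ^ Suc J"
      using r by (intro power_mono) auto
    also have "\<dots> = K ^ Suc J * exp (\<epsilon> * r)"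
      by (simp only: power_mult_distrib flip: exp_of_nat_mult) (simp add: field_simps del: of_nat_Suc)
    finally have "(1 + r) ^ Suc J \<le> K ^ Suc J * exp (\<epsilon> * r)" .
    moreover have "(1 + r) ^ J \<le> (1 + r) ^ Suc J" using r by (intro power_increasing) auto
    ultimately show ?thesis by linarith
  qed
  then show ?thesis using K by (intro exI[of _ "K ^ Suc J"]) (auto intro: zero_less_power)
qed

text \<open>If f is not integrable, its integral is 0 by convention, so integrability is not a
  hypothesis. This lets the lemma be applied for every y, where Fubini would grant integrability in
  t only for almost every y.\<close>

lemma integral_derivative_half_line:
  fixes F f :: "real \<Rightarrow> real"
  assumes F: "\<And>t. t > 0 \<Longrightarrow> (F has_real_derivative f t) (at t)" and f: "continuous_on {0<..} f"
    and "(F \<longlongrightarrow> 0) (at_right 0)" "(F \<longlongrightarrow> 0) at_top"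
  shows "(LINT t:{0<..}|lborel. f t) = 0"
proof (cases "set_integrable lborel {0<..} f")
  case True
  have "(LBINT t=0..\<infinity>. f t) = 0 - 0"
  proof (rule interval_integral_FTC_integrable)
    show "(F has_vector_derivative f t) (at t)" if "0 < ereal t" for t
      using F that by (simp add: has_real_derivative_iff_has_vector_derivative)
    show "isCont f t" if "0 < ereal t" for t
      using f that by (simp add: continuous_on_eq_continuous_at)
    show "set_integrable lborel (einterval 0 \<infinity>) f"
      using True by (simp add: einterval_def greaterThan_def)
    show "((F \<circ> real_of_ereal) \<longlongrightarrow> 0) (at_right 0)"
      using assms(3) by (simp add: zero_ereal_def ereal_tendsto_simps)
    show "((F \<circ> real_of_ereal) \<longlongrightarrow> 0) (at_left \<infinity>)"
      using assms(4) by (simp add: ereal_tendsto_simps)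
  qed auto
  then show ?thesis by (simp add: interval_lebesgue_integral_def einterval_def greaterThan_def)
next
  case False
  then show ?thesis by (simp add: set_lebesgue_integral_def set_integrable_def not_integrable_integral_eq)
qed

section \<open>The heat equation for the kernel\<close>

fun bump :: "nat \<Rightarrow> real \<Rightarrow> real" where
  "bump j t = (if t > 0 then exp (- (1 / t)) / t ^ j else 0)"

declare bump.simps [simp del]

lemma bump_nonneg: "bump j t \<ge> 0" and bump_pos: "t > 0 \<Longrightarrow> bump j t > 0" and bump_zero: "t \<le> 0 \<Longrightarrow> bump j t = 0"
  by (auto simp: bump.simps)

text \<open>The functions exp(-1/t) / t^j, continued by 0, form a family closed under
  differentiation up to linear combinations. Smoothness at 0 is thereby reduced to one limit,
  r^(j+1) / e^r tending to 0 for r = 1/t.\<close>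

lemma bump_has_derivative: "(bump j has_real_derivative (bump (j + 2) t - real j * bump (j + 1) t)) (at t)"
proof -
  consider "t > 0" | "t < 0" | "t = 0" by linarith
  then show ?thesis
  proof cases
    case 1
    have "((\<lambda>t. exp (- (1 / t)) / t ^ j) has_real_derivative (bump (j + 2) t - real j * bump (j + 1) t)) (at t)"
    proof -
      have P: "((\<lambda>t. t ^ j) has_real_derivative real j * t ^ (j - Suc 0)) (at t)" by (rule DERIV_pow)
      have E: "((\<lambda>t. exp (- (1 / t))) has_real_derivative exp (- (1 / t)) / t\<^sup>2) (at t)"
        using 1 by (auto intro!: derivative_eq_intros simp: power2_eq_square)
      have "((\<lambda>t. exp (- (1 / t)) / t ^ j) has_real_derivative
          (exp (- (1 / t)) / t\<^sup>2 * t ^ j - exp (- (1 / t)) * (real j * t ^ (j - Suc 0))) / (t ^ j * t ^ j)) (at t)"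
        using 1 by (intro DERIV_divide E P) auto
      also have "(exp (- (1 / t)) / t\<^sup>2 * t ^ j - exp (- (1 / t)) * (real j * t ^ (j - Suc 0))) / (t ^ j * t ^ j)
          = bump (j + 2) t - real j * bump (j + 1) t"
        using 1 by (cases j) (simp_all add: bump.simps field_simps power2_eq_square)
      finally show ?thesis .
    qed
    then show ?thesis
      by (rule has_field_derivative_transform_within_open[where S = "{0<..}"])
         (use 1 in \<open>auto simp: bump.simps\<close>)
  next
    case 2
    have "((\<lambda>t. 0) has_real_derivative (bump (j + 2) t - real j * bump (j + 1) t)) (at t)"
      using 2 by (auto simp: bump.simps)
    then show ?thesis
      by (rule has_field_derivative_transform_within_open[where S = "{..<0}"])
         (use 2 in \<open>auto simp: bump.simps\<close>)
  next
    case 3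
    have "((\<lambda>h. bump j h / h) \<longlongrightarrow> 0) (at_right 0)"
    proof -
      have "((\<lambda>h. (inverse h) ^ (j + 1) / exp (inverse h)) \<longlongrightarrow> 0) (at_right (0::real))"
        by (rule filterlim_compose[OF tendsto_power_div_exp_0 filterlim_inverse_at_top_right])
      moreover have "eventually (\<lambda>h. (inverse h) ^ (j + 1) / exp (inverse h) = bump j h / h) (at_right (0::real))"
        unfolding eventually_at_filter
        by (auto intro!: always_eventually simp: bump.simps exp_minus divide_inverse power_inverse)
      ultimately show ?thesis using tendsto_cong by fast
    qed
    moreover have "((\<lambda>h. bump j h / h) \<longlongrightarrow> 0) (at_left 0)"
    proof -
      have "eventually (\<lambda>h. 0 = bump j h / h) (at_left (0::real))"
        unfolding eventually_at_filter by (auto intro!: always_eventually simp: bump.simps)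
      then show ?thesis using tendsto_cong tendsto_const by fast
    qed
    ultimately have "((\<lambda>h. bump j h / h) \<longlongrightarrow> 0) (at 0)"
      by (simp add: filterlim_split_at_real)
    then show ?thesis using 3 by (simp add: DERIV_def bump.simps)
  qed
qed

text \<open>The squared norm keeps the argument polynomial, so the centre is no exception; for r
  \<ge> 0 the function is positive exactly on the open ball.\<close>

definition bump_at :: "'a::euclidean_space \<Rightarrow> real \<Rightarrow> 'a \<Rightarrow> real" where
  "bump_at w0 r w = bump 0 (r\<^sup>2 - (w - w0) \<bullet> (w - w0))"

text \<open>The induction treats all j at once, because a derivative raises the index by 1 or
  2.\<close>

lemma smooth_on_bump_at: "smooth_on (bump_at w0 r) UNIV"
proof -
  define Q where "Q w = r\<^sup>2 - (w - w0) \<bullet> (w - w0)" for w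
  have Q: "(Q has_derivative (\<lambda>v. - 2 * ((w - w0) \<bullet> v))) (at w)" for w
    unfolding Q_def[abs_def] by (auto intro!: derivative_eq_intros simp: inner_commute)
  have "C_k_on k (\<lambda>w. bump j (Q w)) UNIV" for k j
  proof (induction k arbitrary: j)
    case 0
    have "continuous_on UNIV (\<lambda>w. bump j (Q w))"
    proof (rule continuous_on_compose2[of UNIV "bump j"])
      show "continuous_on UNIV (bump j)"
        using bump_has_derivative by (auto intro!: continuous_at_imp_continuous_on DERIV_isCont)
      show "continuous_on UNIV Q" unfolding Q_def by (intro continuous_intros)
    qed auto
    then show ?case by simp
  next
    case (Suc k)
    show ?case
    proof (rule C_k_on_SucI[OF open_UNIV])
      show "((\<lambda>w. bump j (Q w)) has_derivative
          (\<lambda>v. (bump (j + 2) (Q w) + - real j * bump (j + 1) (Q w)) * (- 2 * ((w - w0) \<bullet> v)))) (at w)" for w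
        using has_derivative_compose[OF Q[of w] bump_has_derivative[of j "Q w", unfolded has_field_derivative_def]]
        by simp
      fix b :: 'a assume "b \<in> Basis"
      have l: "C_k_on k (\<lambda>w. (w - w0) \<bullet> b) UNIV"
      proof -
        have "C_k_on k (\<lambda>y. y \<bullet> b + - (w0 \<bullet> b)) UNIV"
          by (intro C_k_on_add C_k_on_linear bounded_linear_inner_left C_k_on_const) auto
        then show ?thesis by (simp add: inner_diff_left)
      qed
      show "C_k_on k (\<lambda>w. (bump (j + 2) (Q w) + - real j * bump (j + 1) (Q w)) * (- 2 * ((w - w0) \<bullet> b))) UNIV"
        by (intro C_k_on_mult C_k_on_add C_k_on_cmult l Suc.IH open_UNIV)
    qed
  qed
  then show ?thesis by (simp add: smooth_on_def bump_at_def[abs_def] Q_def)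
qed

lemma bump_at_nonneg: "bump_at w0 r w \<ge> 0"
  by (simp add: bump_at_def bump_nonneg)

lemma bump_at_outside: "w \<notin> ball w0 r \<Longrightarrow> r \<ge> 0 \<Longrightarrow> bump_at w0 r w = 0"
proof -
  assume "w \<notin> ball w0 r" "r \<ge> 0"
  then have "r\<^sup>2 \<le> (norm (w - w0))\<^sup>2" by (intro power_mono) (auto simp: dist_norm norm_minus_commute)
  then show ?thesis unfolding bump_at_def by (intro bump_zero) (simp add: power2_norm_eq_inner)
qed

lemma continuous_on_compact_integrable:
  fixes f :: "'a::euclidean_space \<Rightarrow> real"
  assumes "compact K" "continuous_on K f"
  shows "integrable lborel (\<lambda>x. indicator K x * f x)"
  using borel_integrable_compact[OF assms] by (simp add: indicator_scaleR_eq_if)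

text \<open>The integral of a difference quotient vanishes by translation invariance.\<close>

lemma integral_pd_zero:
  fixes H :: "'a::euclidean_space \<Rightarrow> real"
  assumes H: "C_k_on 1 H UNIV" and out: "\<And>w. w \<notin> cball w0 r \<Longrightarrow> H w = 0"
  shows "(\<integral>w. pd H w b \<partial>lborel) = 0"
proof -
  have H1: "C_k_on (Suc 0) H UNIV" using H by simp
  note der = C_k_on_Suc_derivative[OF open_UNIV H1 UNIV_I]
  have cont: "continuous_on UNIV (\<lambda>w. pd H w b)"
    using C_k_on_continuous[OF C_k_on_directional[OF open_UNIV H1 C_k_on_const]] .
  have Hc: "continuous_on UNIV H" by (rule C_k_on_continuous[OF H])
  have out': "pd H w b = 0" if "w \<notin> cball w0 r" for w
  proof (rule pd_eqI)
    show "(H has_derivative (\<lambda>_. 0)) (at w)"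
      by (rule has_derivative_transform_within_open[OF has_derivative_const open_Compl[OF closed_cball]])
         (use that out in auto)
  qed
  obtain B where B: "\<And>w. \<bar>pd H w b\<bar> \<le> B" "B \<ge> 0"
  proof -
    have "bounded ((\<lambda>w. pd H w b) ` cball w0 r)"
      by (intro compact_imp_bounded compact_continuous_image continuous_on_subset[OF cont]) auto
    then obtain B where "\<forall>w\<in>cball w0 r. \<bar>pd H w b\<bar> \<le> B" unfolding bounded_iff by auto
    then have "\<bar>pd H w b\<bar> \<le> max B 0" for w using out'[of w] by (cases "w \<in> cball w0 r") (auto simp: max.coboundedI1)
    then show ?thesis using that[of "max B 0"] by auto
  qed
  define q where "q n w = real (Suc n) * (H (inverse (real (Suc n)) *\<^sub>R b + w) - H w)" for n w
  have Hi: "integrable lborel H"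
  proof -
    have "integrable lborel (\<lambda>w. indicator (cball w0 r) w * H w)"
      by (rule continuous_on_compact_integrable[OF compact_cball continuous_on_subset[OF Hc]]) auto
    also have "(\<lambda>w. indicator (cball w0 r) w * H w) = H"
      using out by (auto simp: fun_eq_iff indicator_def)
    finally show ?thesis .
  qed
  have shift: "integrable lborel (\<lambda>w. H (c + w))" "(\<integral>w. H (c + w) \<partial>lborel) = (\<integral>w. H w \<partial>lborel)" for c
  proof -
    have "integrable (distr lborel borel ((+) c)) H" using Hi by (simp add: lborel_distr_plus)
    then show "integrable lborel (\<lambda>w. H (c + w))" by (subst (asm) integrable_distr_eq) (use Hi in auto)
    have "(\<integral>w. H w \<partial>lborel) = (\<integral>w. H w \<partial>distr lborel borel ((+) c))" by (simp add: lborel_distr_plus)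
    also have "\<dots> = (\<integral>w. H (c + w) \<partial>lborel)" by (subst integral_distr) (use Hi in auto)
    finally show "(\<integral>w. H (c + w) \<partial>lborel) = (\<integral>w. H w \<partial>lborel)" by simp
  qed
  have q0: "(\<integral>w. q n w \<partial>lborel) = 0" for n
    unfolding q_def using shift Hi by simp
  have lim: "(\<lambda>n. \<integral>w. q n w \<partial>lborel) \<longlonglongrightarrow> (\<integral>w. pd H w b \<partial>lborel)"
  \<comment> \<open>By the mean value theorem \<open>q n w\<close> is a value of the derivative at a
    point within \<open>norm b\<close> of w, as the step is at most 1; hence the larger
    ball.\<close>
  proof (rule integral_dominated_convergence[where w = "\<lambda>w. B * indicator (cball w0 (r + norm b)) w"])
    show "(\<lambda>w. pd H w b) \<in> borel_measurable lborel"
      using borel_measurable_continuous_onI[OF cont] by simp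
    show "q n \<in> borel_measurable lborel" for n
      unfolding q_def using shift(1)[THEN borel_measurable_integrable] Hi[THEN borel_measurable_integrable]
      by (intro borel_measurable_times borel_measurable_diff) auto
    show "integrable lborel (\<lambda>w. B * indicator (cball w0 (r + norm b)) w)"
      using emeasure_lborel_cball_finite[of w0 "r + norm b"] by (intro integrable_mult_right) (simp add: less_top)
    show "AE w in lborel. (\<lambda>n. q n w) \<longlonglongrightarrow> pd H w b"
    proof (rule AE_I2)
      fix w
      have "((\<lambda>s. H (w + s *\<^sub>R b)) has_real_derivative pd H w b) (at 0)"
        using has_derivative_along_line[of H _ w 0 b] der[of w] by simp
      then have "((\<lambda>h. (H (w + h *\<^sub>R b) - H w) / h) \<longlongrightarrow> pd H w b) (at 0)"
        by (simp add: DERIV_def)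
      then have "(\<lambda>n. (H (w + inverse (real (Suc n)) *\<^sub>R b) - H w) / inverse (real (Suc n))) \<longlonglongrightarrow> pd H w b"
        by (rule filterlim_compose) (use LIMSEQ_inverse_real_of_nat in \<open>auto simp: filterlim_at\<close>)
      then show "(\<lambda>n. q n w) \<longlonglongrightarrow> pd H w b"
        by (simp add: q_def divide_inverse mult.commute add.commute)
    qed
    fix n
    show "AE w in lborel. norm (q n w) \<le> B * indicator (cball w0 (r + norm b)) w"
    proof (rule AE_I2)
      fix w
      define h where "h = inverse (real (Suc n))"
      have h: "h > 0" "h \<le> 1" by (auto simp: h_def inverse_le_1_iff)
      have "DERIV (\<lambda>s. H (w + s *\<^sub>R b)) s :> pd H (w + s *\<^sub>R b) b" for s
        by (rule has_derivative_along_line[OF der])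
      from MVT2[OF h(1) this] obtain z where z: "0 < z" "z < h"
        "H (w + h *\<^sub>R b) - H (w + 0 *\<^sub>R b) = (h - 0) * pd H (w + z *\<^sub>R b) b" by blast
      have q: "q n w = pd H (w + z *\<^sub>R b) b"
        using z(3) h(1) by (simp add: q_def h_def[symmetric] add.commute) (simp add: h_def)
      show "norm (q n w) \<le> B * indicator (cball w0 (r + norm b)) w"
      proof (cases "w \<in> cball w0 (r + norm b)")
        case True
        then show ?thesis using B(1) q by simp
      next
        case False
        have "norm (z *\<^sub>R b) \<le> norm b" using z h by (simp add: mult_left_le_one_le)
        then have "w + z *\<^sub>R b \<notin> cball w0 r"
          using False norm_triangle_ineq4[of "w + z *\<^sub>R b - w0" "z *\<^sub>R b"]
          by (auto simp: dist_norm norm_minus_commute algebra_simps)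
        then show ?thesis using out' q B(2) by simp
      qed
    qed
  qed
  show ?thesis using LIMSEQ_unique[OF lim] q0 by simp
qed

text \<open>In the application W is space-time without the pole of the kernel. H vanishes on W off
  the ball, so its extension by 0 is C^1 everywhere.\<close>

lemma integral_pd_zero_local:
  fixes H :: "'a::euclidean_space \<Rightarrow> real"
  assumes W: "open W" "cball w0 r \<subseteq> W" and H: "C_k_on 1 H W"
    and out: "\<And>w. w \<in> W \<Longrightarrow> w \<notin> cball w0 r \<Longrightarrow> H w = 0"
  shows "(\<integral>w. indicator (cball w0 r) w * pd H w b \<partial>lborel) = 0"
proof -
  define G where "G w = (if w \<in> W then H w else 0)" for w
  have G0: "G w = 0" if "w \<notin> cball w0 r" for w using that out by (simp add: G_def)
  have GW: "C_k_on 1 G W" by (rule C_k_on_cong_imp[OF W(1) _ H]) (simp add: G_def)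
  have GC: "C_k_on 1 G (- cball w0 r)"
    by (rule C_k_on_cong_imp[OF _ _ C_k_on_const[where c = 0]]) (use G0 in auto)
  have G1: "C_k_on 1 G UNIV"
  proof (rule C_k_on_local[OF open_UNIV])
    fix x :: 'a
    show "\<exists>T. open T \<and> x \<in> T \<and> C_k_on 1 G T"
    proof (cases "x \<in> W")
      case True then show ?thesis using GW W(1) by blast
    next
      case False then show ?thesis using GC W(2) by (intro exI[of _ "- cball w0 r"]) auto
    qed
  qed
  have "indicator (cball w0 r) w * pd H w b = pd G w b" for w
  proof (cases "w \<in> cball w0 r")
    case True
    then have w: "w \<in> W" using W by blast
    have "(H has_derivative frechet_derivative H (at w)) (at w)"
      by (rule C_k_on_Suc_derivative[OF W(1) _ w, of 0]) (use H in auto)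
    then have "(G has_derivative frechet_derivative H (at w)) (at w)"
      by (rule has_derivative_transform_within_open[OF _ W(1) w]) (simp add: G_def)
    then show ?thesis using True pd_eqI[of G] by simp
  next
    case False
    have "(G has_derivative (\<lambda>_. 0)) (at w)"
      by (rule has_derivative_transform_within_open[OF has_derivative_const open_Compl[OF closed_cball]])
         (use False G0 in auto)
    then show ?thesis using False pd_eqI[of G] by simp
  qed
  then show ?thesis using integral_pd_zero[OF G1 G0] by simp
qed

section \<open>Slices in space and time, and Green's identity\<close>

lemma C_k_on_slice_fst:
  fixes q :: "'a::euclidean_space \<times> 'b::euclidean_space \<Rightarrow> 'c::real_normed_vector"
  assumes "open W" "C_k_on k q W"
  shows "C_k_on k (\<lambda>x. q (x, t)) {x. (x, t) \<in> W}"
proof -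
  have "bounded_linear (\<lambda>x::'a. (x, 0::'b))" by (intro bounded_linear_intros)
  from C_k_on_affine_compose[OF assms(1) this assms(2), of "(0, t)"] show ?thesis
    by (simp add: vimage_def)
qed

lemma C_k_on_comp_fst:
  fixes f :: "'a::euclidean_space \<Rightarrow> 'c::real_normed_vector"
  assumes "open S" "C_k_on k f S"
  shows "C_k_on k (\<lambda>w :: 'a \<times> 'b::euclidean_space. f (fst w)) (S \<times> UNIV)"
proof -
  have "C_k_on k (\<lambda>w :: 'a \<times> 'b. f (0 + fst w)) ((\<lambda>x. 0 + fst x) -` S)"
    by (rule C_k_on_affine_compose[OF assms(1) bounded_linear_fst assms(2)])
  then show ?thesis by (simp add: vimage_fst)
qed

lemma has_derivative_slice_fst:
  assumes "(q has_derivative q') (at (x, t))"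
  shows "((\<lambda>x. q (x, t)) has_derivative (\<lambda>v. q' (v, 0))) (at x)"
proof -
  have "((\<lambda>x. (x, t)) has_derivative (\<lambda>v. (v, 0))) (at x)"
    by (intro has_derivative_Pair has_derivative_ident has_derivative_const)
  from has_derivative_compose[OF this assms] show ?thesis .
qed

lemma has_derivative_slice_snd:
  assumes "(q has_derivative q') (at (x, t))"
  shows "((\<lambda>t. q (x, t)) has_derivative (\<lambda>v. q' (0, v))) (at t)"
proof -
  have "((\<lambda>t. (x, t)) has_derivative (\<lambda>v. (0, v))) (at t)"
    by (intro has_derivative_Pair has_derivative_ident has_derivative_const)
  from has_derivative_compose[OF this assms] show ?thesis .
qed

lemma has_real_derivative_slice_snd:
  fixes q :: "'a::real_normed_vector \<times> real \<Rightarrow> real"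
  assumes q: "(q has_derivative q') (at (x, t))"
  shows "((\<lambda>t. q (x, t)) has_real_derivative q' (0, 1)) (at t)"
proof -
  have "q' (0, v) = q' (0, 1) * v" for v
  proof -
    have "q' (v *\<^sub>R (0, 1)) = v *\<^sub>R q' (0, 1)" by (rule linear_cmul[OF has_derivative_linear[OF q]])
    then show ?thesis by (simp add: mult.commute)
  qed
  then have "(\<lambda>v. q' (0, v)) = (*) (q' (0, 1))" by (rule ext)
  then show ?thesis using has_derivative_slice_snd[OF q] unfolding has_field_derivative_def by argo
qed

lemma deriv_slice_snd:
  fixes q :: "'a::real_normed_vector \<times> real \<Rightarrow> real"
  assumes q: "(q has_derivative q') (at (x, t))"
  shows "deriv (\<lambda>t. q (x, t)) t = q' (0, 1)"
  by (rule DERIV_imp_deriv[OF has_real_derivative_slice_snd[OF q]])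

lemma open_slice_fst:
  assumes "open (W :: ('a::topological_space \<times> 'b::topological_space) set)"
  shows "open {x. (x, t) \<in> W}"
proof -
  have "continuous_on UNIV (\<lambda>x::'a. (x, t))" by (intro continuous_intros)
  from open_vimage[OF assms this] show ?thesis by (simp add: vimage_def)
qed

lemma pd2_slice_fst:
  fixes q :: "'a::euclidean_space \<times> 'b::euclidean_space \<Rightarrow> real"
  assumes W: "open W" and q: "C_k_on 2 q W" and x: "(x, t) \<in> W"
  shows "pd (\<lambda>\<xi>. q (\<xi>, t)) x c = pd q (x, t) (c, 0)"
    and "pd2 (\<lambda>\<xi>. q (\<xi>, t)) x b c = pd2 q (x, t) (b, 0) (c, 0)"
proof -
  have 1: "pd (\<lambda>\<xi>. q (\<xi>, t)) y c = pd q (y, t) (c, 0)" if "(y, t) \<in> W" for y c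
    by (rule pd_eqI[OF has_derivative_slice_fst[OF C_k_on_2D(1)[OF W q that]]])
  show "pd (\<lambda>\<xi>. q (\<xi>, t)) x c = pd q (x, t) (c, 0)" by (rule 1[OF x])
  note op = open_slice_fst[OF W, of t]
  have "((\<lambda>y. pd (\<lambda>\<xi>. q (\<xi>, t)) y c) has_derivative (\<lambda>v. pd2 q (x, t) (v, 0) (c, 0))) (at x)"
    by (rule has_derivative_transform_within_open[OF has_derivative_slice_fst[OF C_k_on_2D(2)[OF W q x, of "(c, 0)"]] op])
       (use x 1 in auto)
  from pd_eqI[OF this] show "pd2 (\<lambda>\<xi>. q (\<xi>, t)) x b c = pd2 q (x, t) (b, 0) (c, 0)" .
qed

text \<open>The sub-Laplacian in the space variables, in coefficient form, as an operator on
  functions of space-time; Green's identity can then be integrated over balls in all variables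
  together.\<close>

definition lifted_laplacian ::
    "('m::finite \<Rightarrow> 'a::euclidean_space \<Rightarrow> 'a) \<Rightarrow> ('a \<times> real \<Rightarrow> real) \<Rightarrow> 'a \<times> real \<Rightarrow> real" where
  "lifted_laplacian X q w = (\<Sum>b\<in>Basis. \<Sum>c\<in>Basis.
      diffusion X b c (fst w) * pd2 q w (b, 0) (c, 0) + pd (diffusion X b c) (fst w) b * pd q w (c, 0))"

lemma sub_laplacian_slice:
  assumes X: "\<And>i. smooth_on (X i) UNIV" and W: "open W" and q: "C_k_on 2 q W" and x: "(x, t) \<in> W"
  shows "sub_laplacian X (\<lambda>\<xi>. q (\<xi>, t)) x = lifted_laplacian X q (x, t)"
proof -
  note op = open_slice_fst[OF W, of t]
  show ?thesis
    unfolding sub_laplacian_eq[OF X op C_k_on_slice_fst[OF W q], of x, simplified, OF x]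
      lifted_laplacian_def by (simp add: pd2_slice_fst[OF W q x])
qed

text \<open>Components of the vector q A grad \<phi> - \<phi> A grad q of Green's second identity, A
  being the diffusion matrix.\<close>

definition green_flux ::
    "('m::finite \<Rightarrow> 'a::euclidean_space \<Rightarrow> 'a) \<Rightarrow> ('a \<times> real \<Rightarrow> real) \<Rightarrow> ('a \<times> real \<Rightarrow> real) \<Rightarrow>
      'a \<Rightarrow> 'a \<times> real \<Rightarrow> real" where
  "green_flux X q \<phi> b w = (\<Sum>c\<in>Basis. diffusion X b c (fst w) * (q w * pd \<phi> w (c, 0) - \<phi> w * pd q w (c, 0)))"

lemma C_k_on_green_flux:
  fixes X :: "'m::finite \<Rightarrow> 'a::euclidean_space \<Rightarrow> 'a"
  assumes X: "\<And>i. smooth_on (X i) UNIV" and W: "open W" and q: "C_k_on 2 q W" and \<phi>: "C_k_on 2 \<phi> W"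
  shows "C_k_on 1 (green_flux X q \<phi> b) W"
proof -
  have A: "C_k_on 1 (\<lambda>w :: 'a \<times> real. diffusion X b c (fst w)) W" for c
    using C_k_on_comp_fst[OF open_UNIV C_k_on_diffusion[OF X]] by (rule C_k_on_subset) auto
  have 1: "C_k_on 1 q W" "C_k_on 1 \<phi> W" by (rule C_k_on_le[OF q] C_k_on_le[OF \<phi>], simp)+
  have 2: "C_k_on 1 (\<lambda>w. pd f w v) W" if "C_k_on 2 f W" for f v
    by (rule C_k_on_directional[OF W _ C_k_on_const]) (use that in \<open>simp add: numeral_2_eq_2\<close>)
  show ?thesis unfolding green_flux_def[abs_def]
    by (intro C_k_on_sum C_k_on_mult C_k_on_diff W A 1 2 q \<phi>) auto
qed

text \<open>The products of first derivatives of q and \<phi> cancel because the diffusion matrix is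
  symmetric, which is the fact \<open>anti\<close>.\<close>

lemma divergence_green_flux:
  fixes X :: "'m::finite \<Rightarrow> 'a::euclidean_space \<Rightarrow> 'a"
  assumes X: "\<And>i. smooth_on (X i) UNIV" and W: "open W" and q: "C_k_on 2 q W" and \<phi>: "C_k_on 2 \<phi> W"
    and w: "w \<in> W"
  shows "(\<Sum>b\<in>Basis. pd (green_flux X q \<phi> b) w (b, 0)) =
     q w * lifted_laplacian X \<phi> w - \<phi> w * lifted_laplacian X q w"
proof -
  define A where "A b c = diffusion X b c (fst w)" for b c
  define A' where "A' b c = pd (diffusion X b c) (fst w) b" for b c
  have dA: "((\<lambda>w. diffusion X b c (fst w)) has_derivative (\<lambda>v. pd (diffusion X b c) (fst w) (fst v))) (at w)" for b c
  proof -
    have "(diffusion X b c has_derivative frechet_derivative (diffusion X b c) (at (fst w))) (at (fst w))"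
      by (rule C_k_on_Suc_derivative[OF open_UNIV C_k_on_diffusion[OF X, of "Suc 0"] UNIV_I])
    from has_derivative_compose[OF has_derivative_fst[OF has_derivative_ident] this] show ?thesis .
  qed
  define G where "G b c = q w * pd \<phi> w (c, 0) - \<phi> w * pd q w (c, 0)" for b c :: 'a
  define G' where "G' b c = (q w * pd2 \<phi> w (b, 0) (c, 0) + pd q w (b, 0) * pd \<phi> w (c, 0))
     - (\<phi> w * pd2 q w (b, 0) (c, 0) + pd \<phi> w (b, 0) * pd q w (c, 0))" for b c :: 'a
  have pdG: "pd (green_flux X q \<phi> b) w (b, 0) = (\<Sum>c\<in>Basis. A b c * G' b c + A' b c * G b c)" for b
  proof -
    have "(green_flux X q \<phi> b has_derivative (\<lambda>v. \<Sum>c\<in>Basis.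
        diffusion X b c (fst w) * ((q w * pd2 \<phi> w v (c, 0) + pd q w v * pd \<phi> w (c, 0))
           - (\<phi> w * pd2 q w v (c, 0) + pd \<phi> w v * pd q w (c, 0)))
        + pd (diffusion X b c) (fst w) (fst v) * (q w * pd \<phi> w (c, 0) - \<phi> w * pd q w (c, 0)))) (at w)"
      unfolding green_flux_def[abs_def]
      by (intro has_derivative_sum has_derivative_mult has_derivative_diff dA
          C_k_on_2D(1)[OF W q w] C_k_on_2D(1)[OF W \<phi> w] C_k_on_2D(2)[OF W q w] C_k_on_2D(2)[OF W \<phi> w])
    from pd_eqI[OF this, of "(b, 0)"] show ?thesis
      by (simp add: A_def A'_def G_def G'_def)
  qed
  have anti: "(\<Sum>b\<in>Basis. \<Sum>c\<in>Basis. A b c * (pd q w (b, 0) * pd \<phi> w (c, 0))) =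
     (\<Sum>b\<in>Basis. \<Sum>c\<in>Basis. A b c * (pd \<phi> w (b, 0) * pd q w (c, 0)))"
    by (subst sum.swap) (simp add: A_def diffusion_commute[of X] mult.commute)
  have "(\<Sum>b\<in>Basis. pd (green_flux X q \<phi> b) w (b, 0)) =
     (\<Sum>b\<in>Basis. \<Sum>c\<in>Basis. (q w * (A b c * pd2 \<phi> w (b, 0) (c, 0) + A' b c * pd \<phi> w (c, 0))
        - \<phi> w * (A b c * pd2 q w (b, 0) (c, 0) + A' b c * pd q w (c, 0)))
        + (A b c * (pd q w (b, 0) * pd \<phi> w (c, 0)) - A b c * (pd \<phi> w (b, 0) * pd q w (c, 0))))"
    unfolding pdG G_def G'_def by (intro sum.cong refl) (simp add: algebra_simps)
  also have "\<dots> = q w * lifted_laplacian X \<phi> w - \<phi> w * lifted_laplacian X q w"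
    using anti unfolding lifted_laplacian_def A_def[symmetric] A'_def[symmetric]
    by (simp add: sum.distrib sum_subtractf sum_distrib_left distrib_left)
  finally show ?thesis .
qed

lemma continuous_on_lifted_laplacian:
  fixes X :: "'m::finite \<Rightarrow> 'a::euclidean_space \<Rightarrow> 'a"
  assumes X: "\<And>i. smooth_on (X i) UNIV" and W: "open W" and q: "C_k_on 2 q W"
  shows "continuous_on W (lifted_laplacian X q)"
proof (cases "W = {}")
  case False
  then obtain w where w: "w \<in> W" by blast
  have "continuous_on UNIV (diffusion X b c)" for b c
    by (rule C_k_on_continuous[OF C_k_on_diffusion[OF X, of 0]])
  then have 1: "continuous_on W (\<lambda>w. diffusion X b c (fst w))" for b c
    by (rule continuous_on_compose2) (auto intro: continuous_intros)
  have "continuous_on UNIV (\<lambda>x. pd (diffusion X b c) x v)" for b c v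
    by (rule C_k_on_continuous[OF C_k_on_directional[OF open_UNIV C_k_on_diffusion[OF X, of "Suc 0"] C_k_on_const]])
  then have 2: "continuous_on W (\<lambda>w. pd (diffusion X b c) (fst w) v)" for b c v
    by (rule continuous_on_compose2) (auto intro: continuous_intros)
  show ?thesis unfolding lifted_laplacian_def[abs_def]
    by (intro continuous_intros 1 2 C_k_on_2D(3,4)[OF W q w])
qed simp

text \<open>Weyl's argument for a function that is already smooth: Green's identity moves the heat operator
  from the test function onto \<open>q\<close>, and a bump function localizes the resulting integral.\<close>

lemma heat_kernel_equation:
  fixes X :: "'m::finite \<Rightarrow> 'a::euclidean_space \<Rightarrow> 'a"
  assumes X: "\<And>i. smooth_on (X i) UNIV" and p: "heat_kernel X p" and t0: "t0 > 0"
  shows "deriv (\<lambda>\<tau>. p x0 y \<tau>) t0 = sub_laplacian X (\<lambda>\<xi>. p \<xi> y t0) x0"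
proof -
  define q where "q = (\<lambda>(x, t). p x y t)"
  define W where "W = UNIV - {(y, 0::real)}"
  have W: "open W" by (simp add: W_def open_delete)
  have qs: "smooth_on q W"
  proof -
    have "smooth_on (\<lambda>(x, t). p x y (t - 0)) (UNIV - {(y, 0)})"
      using p unfolding heat_kernel_def by blast
    then show ?thesis by (simp add: q_def W_def)
  qed
  have q2: "C_k_on 2 q W" by (rule smooth_on_C_k[OF qs])
  have q1: "C_k_on 1 q W" by (rule smooth_on_C_k[OF qs])
  \<comment> \<open>The defect in the heat equation; it has to vanish at w0.\<close>
  define g where "g w = pd q w (0, 1) - lifted_laplacian X q w" for w
  define w0 where "w0 = (x0, t0)"
  have w0: "w0 \<in> W" using t0 by (simp add: w0_def W_def)
  have gc: "continuous_on W g" unfolding g_def[abs_def]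
    by (intro continuous_intros C_k_on_2D(3)[OF W q2 w0] continuous_on_lifted_laplacian[OF X W q2])
  have zero: "(\<integral>w. indicator (cball w0 r) w * (bump_at w0 r w * g w) \<partial>lborel) = 0"
    if r: "r > 0" and sub: "cball w0 r \<subseteq> W" for r
  proof -
    define \<phi> where "\<phi> = bump_at w0 r"
    have \<phi>s: "smooth_on \<phi> UNIV" unfolding \<phi>_def by (rule smooth_on_bump_at)
    have \<phi>U: "C_k_on 2 \<phi> UNIV" by (rule smooth_on_C_k[OF \<phi>s])
    have \<phi>W: "C_k_on k \<phi> W" for k by (rule C_k_on_subset[OF smooth_on_C_k[OF \<phi>s]]) simp
    have out: "\<phi> w = 0" if "w \<notin> cball w0 r" for w
      using bump_at_outside[of w w0 r] that r by (auto simp: \<phi>_def)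
    have out1: "pd \<phi> w v = 0" if "w \<notin> cball w0 r" for w v
      by (rule pd_eqI[OF has_derivative_transform_within_open[OF has_derivative_const open_Compl[OF closed_cball]]])
         (use that out in auto)
    have out2: "pd2 \<phi> w u v = 0" if w: "w \<notin> cball w0 r" for w u v
    proof -
      have "((\<lambda>y. pd \<phi> y v) has_derivative (\<lambda>_. 0)) (at w)"
        by (rule has_derivative_transform_within_open[OF has_derivative_const[of 0] open_Compl[OF closed_cball]])
           (use w out1 in simp_all)
      from pd_eqI[OF this] show ?thesis .
    qed
    have test: "test_function \<phi>"
      unfolding test_function_def using \<phi>s out by (intro conjI exI[of _ "cball w0 r"]) auto
    have adj: "heat_adjoint X \<phi> w = - pd \<phi> w (0, 1) - lifted_laplacian X \<phi> w" for w
    proof (cases w)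
      case (Pair x t)
      show ?thesis unfolding Pair heat_adjoint_def
        by (simp add: sub_laplacian_slice[OF X open_UNIV \<phi>U UNIV_I] deriv_slice_snd[OF C_k_on_2D(1)[OF open_UNIV \<phi>U UNIV_I]])
    qed
    have "(\<integral>w. q w * heat_adjoint X \<phi> w \<partial>lborel) = \<phi> (y, 0)"
    proof -
      have "(\<integral>w. (case (y, 0::real) of (\<xi>, \<tau>) \<Rightarrow> \<lambda>(x, t). p x \<xi> (t - \<tau>)) w * heat_adjoint X \<phi> w \<partial>lborel) = \<phi> (y, 0)"
        using p test unfolding heat_kernel_def fundamental_solution_def by blast
      then show ?thesis by (simp add: q_def)
    qed
    \<comment> \<open>The ball avoids the pole, so the delta distribution contributes
      nothing.\<close>
    also have "\<phi> (y, 0) = 0" using sub by (intro out) (auto simp: W_def)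
    \<comment> \<open>Pointwise, q times the adjoint operator on \<phi> is \<phi> g minus the time
      derivative of q \<phi> minus the spatial divergence of the Green flux; the last two integrate
      to 0.\<close>
    also have "(\<integral>w. q w * heat_adjoint X \<phi> w \<partial>lborel) =
      (\<integral>w. indicator (cball w0 r) w * (\<phi> w * g w) - indicator (cball w0 r) w * pd (\<lambda>w. q w * \<phi> w) w (0, 1)
         - (\<Sum>b\<in>Basis. indicator (cball w0 r) w * pd (green_flux X q \<phi> b) w (b, 0)) \<partial>lborel)"
    proof (intro Bochner_Integration.integral_cong refl)
      fix w
      show "q w * heat_adjoint X \<phi> w = indicator (cball w0 r) w * (\<phi> w * g w)
         - indicator (cball w0 r) w * pd (\<lambda>w. q w * \<phi> w) w (0, 1)
         - (\<Sum>b\<in>Basis. indicator (cball w0 r) w * pd (green_flux X q \<phi> b) w (b, 0))"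
      proof (cases "w \<in> cball w0 r")
        case True
        then have w: "w \<in> W" using sub by blast
        have "pd (\<lambda>w. q w * \<phi> w) w (0, 1) = q w * pd \<phi> w (0, 1) + pd q w (0, 1) * \<phi> w"
          by (rule pd_eqI[OF has_derivative_mult[OF C_k_on_2D(1)[OF W q2 w] C_k_on_2D(1)[OF W \<phi>W w]]])
        then show ?thesis using True
          by (simp add: adj g_def divergence_green_flux[OF X W q2 \<phi>W w] algebra_simps)
      next
        case False
        then show ?thesis by (simp add: adj lifted_laplacian_def out1 out2)
      qed
    qed
    also have "\<dots> = (\<integral>w. indicator (cball w0 r) w * (\<phi> w * g w) \<partial>lborel)"
    proof -
      have c0: "continuous_on (cball w0 r) f" if "continuous_on W f" for f :: "'a \<times> real \<Rightarrow> real"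
        using that sub continuous_on_subset by blast
      have i1: "integrable lborel (\<lambda>w. indicator (cball w0 r) w * (\<phi> w * g w))"
        by (intro continuous_on_compact_integrable compact_cball c0 continuous_on_mult gc C_k_on_continuous[OF \<phi>W[of 0]])
      have qp: "C_k_on 1 (\<lambda>w. q w * \<phi> w) W" by (intro C_k_on_mult W q1 \<phi>W)
      have pc: "continuous_on W (\<lambda>w. pd f w v)" if "C_k_on 1 f W" for f v
        by (rule C_k_on_continuous[OF C_k_on_directional[OF W _ C_k_on_const], of 0]) (use that in simp)
      have i2: "integrable lborel (\<lambda>w. indicator (cball w0 r) w * pd (\<lambda>w. q w * \<phi> w) w (0, 1))"
        by (intro continuous_on_compact_integrable compact_cball c0 pc qp)
      have i3: "integrable lborel (\<lambda>w. indicator (cball w0 r) w * pd (green_flux X q \<phi> b) w (b, 0))" for b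
        by (intro continuous_on_compact_integrable compact_cball c0 pc C_k_on_green_flux[OF X W q2 \<phi>W])
      have z2: "(\<integral>w. indicator (cball w0 r) w * pd (\<lambda>w. q w * \<phi> w) w (0, 1) \<partial>lborel) = 0"
        by (rule integral_pd_zero_local[OF W sub qp]) (simp add: out)
      have z3: "(\<integral>w. indicator (cball w0 r) w * pd (green_flux X q \<phi> b) w (b, 0) \<partial>lborel) = 0" for b
        by (rule integral_pd_zero_local[OF W sub C_k_on_green_flux[OF X W q2 \<phi>W]])
           (simp add: green_flux_def out out1)
      have i4: "integrable lborel (\<lambda>w. \<Sum>b\<in>Basis. indicator (cball w0 r) w * pd (green_flux X q \<phi> b) w (b, 0))"
        by (rule Bochner_Integration.integrable_sum[OF i3])
      have z4: "(\<integral>w. (\<Sum>b\<in>Basis. indicator (cball w0 r) w * pd (green_flux X q \<phi> b) w (b, 0)) \<partial>lborel) = 0"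
        by (subst Bochner_Integration.integral_sum[OF i3]) (simp only: z3 sum.neutral_const)
      show ?thesis
        unfolding Bochner_Integration.integral_diff[OF Bochner_Integration.integrable_diff[OF i1 i2] i4]
          Bochner_Integration.integral_diff[OF i1 i2] z2 z4 by simp
    qed
    finally show ?thesis by (simp add: \<phi>_def)
  qed
  have "g w0 = 0"
  proof (rule ccontr)
    assume g0: "g w0 \<noteq> 0"
    define m where "m = \<bar>g w0\<bar> / 2"
    have m: "m > 0" using g0 by (simp add: m_def)
    have "isCont g w0" using gc w0 W by (simp add: continuous_on_eq_continuous_at)
    then obtain r1 where r1: "r1 > 0" "\<And>w. dist w w0 < r1 \<Longrightarrow> \<bar>g w - g w0\<bar> < m"
      using m unfolding continuous_at_eps_delta dist_real_def by blast
    obtain r2 where r2: "r2 > 0" "cball w0 r2 \<subseteq> W" using W w0 by (auto simp: open_contains_cball)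
    define r where "r = min (r1 / 2) r2"
    have r: "r > 0" "cball w0 r \<subseteq> W" using r1 r2 by (auto simp: r_def)
    define s where "s = sgn (g w0)"
    have sg: "s * g w \<ge> m" if "w \<in> cball w0 r" for w
    proof -
      have "dist w w0 < r1" using that r1 by (auto simp: r_def dist_commute)
      then show ?thesis using r1(2)[of w] g0 unfolding s_def m_def
        by (auto simp: sgn_if abs_if split: if_splits)
    qed
    \<comment> \<open>A positive lower bound of the bump on the ball of half the radius; together
      with m it forces a positive integral.\<close>
    define c where "c = bump 0 (r\<^sup>2 - (r / 2)\<^sup>2)"
    have c: "c > 0" unfolding c_def using r by (intro bump_pos) (simp add: power2_eq_square)
    have bc: "bump_at w0 r w \<ge> c" if "w \<in> ball w0 (r / 2)" for w
    proof -
      have "(norm (w - w0))\<^sup>2 \<le> (r / 2)\<^sup>2" using that by (intro power_mono) (auto simp: dist_norm norm_minus_commute)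
      then have le: "r\<^sup>2 - (r / 2)\<^sup>2 \<le> r\<^sup>2 - (w - w0) \<bullet> (w - w0)" by (simp add: power2_norm_eq_inner)
      have pos: "0 < r\<^sup>2 - (r / 2)\<^sup>2" using r by (simp add: power2_eq_square)
      show ?thesis unfolding c_def bump_at_def using le pos by (auto simp: bump.simps frac_le)
    qed
    have "(\<integral>w. (m * c) * indicator (ball w0 (r / 2)) w \<partial>lborel)
        \<le> (\<integral>w. s * (indicator (cball w0 r) w * (bump_at w0 r w * g w)) \<partial>lborel)"
    proof (rule integral_mono)
      show "integrable lborel (\<lambda>w. (m * c) * indicator (ball w0 (r / 2)) w)"
        using emeasure_lborel_ball_finite[of w0 "r / 2"] by (intro integrable_mult_right) (simp add: less_top)
      show "integrable lborel (\<lambda>w. s * (indicator (cball w0 r) w * (bump_at w0 r w * g w)))"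
        by (intro integrable_mult_right continuous_on_compact_integrable compact_cball continuous_on_mult
            continuous_on_subset[OF gc r(2)] continuous_on_subset[OF C_k_on_continuous[OF smooth_on_C_k[OF smooth_on_bump_at, where k = 0]]]) auto
      fix w
      show "(m * c) * indicator (ball w0 (r / 2)) w \<le> s * (indicator (cball w0 r) w * (bump_at w0 r w * g w))"
      proof (cases "w \<in> cball w0 r")
        case True
        have "(m * c) * indicator (ball w0 (r / 2)) w \<le> (s * g w) * bump_at w0 r w"
        proof (cases "w \<in> ball w0 (r / 2)")
          case b: True
          show ?thesis using b sg[OF True] bc[OF b] m c by (auto intro!: mult_mono)
        next
          case False
          then show ?thesis using sg[OF True] m bump_at_nonneg[of w0 r w] by auto
        qed
        then show ?thesis using True by (simp add: mult_ac)
      next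
        case False
        then have "w \<notin> ball w0 (r / 2)" using r by auto
        then show ?thesis using False by simp
      qed
    qed
    also have "\<dots> = 0" using zero[OF r] by simp
    finally have "m * c * measure lborel (ball w0 (r / 2)) \<le> 0" by simp
    moreover have "measure lborel (ball w0 (r / 2)) > 0" using content_ball_pos[of "r / 2" w0] r by simp
    ultimately show False using m c by (simp add: mult_le_0_iff)
  qed
  then have "pd q (x0, t0) (0, 1) = lifted_laplacian X q (x0, t0)" by (simp add: g_def w0_def)
  moreover have w0': "(x0, t0) \<in> W" using w0 by (simp add: w0_def)
  ultimately show ?thesis
    using deriv_slice_snd[OF C_k_on_2D(1)[OF W q2 w0']] sub_laplacian_slice[where X = X, OF X W q2 w0']
    by (simp add: q_def)
qed

section \<open>Carnot-Caratheodory distance\<close>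

lemma filterlim_reflect:
  fixes T t :: real
  shows "filterlim (\<lambda>s. T - s) (at_right (T - t)) (at_left t)"
    and "filterlim (\<lambda>s. T - s) (at_left (T - t)) (at_right t)"
proof -
  have *: "((\<lambda>s. T - s) \<longlongrightarrow> T - t) (at t within A)" for A by (intro tendsto_intros)
  show "filterlim (\<lambda>s. T - s) (at_right (T - t)) (at_left t)"
    using * unfolding filterlim_at by (auto simp: eventually_at_filter)
  show "filterlim (\<lambda>s. T - s) (at_left (T - t)) (at_right t)"
    using * unfolding filterlim_at by (auto simp: eventually_at_filter)
qed

lemma filterlim_shift:
  fixes S t :: real
  shows "filterlim (\<lambda>s. s - S) (at_right (t - S)) (at_right t)"
    and "filterlim (\<lambda>s. s - S) (at_left (t - S)) (at_left t)"
proof -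
  have *: "((\<lambda>s. s - S) \<longlongrightarrow> t - S) (at t within A)" for A by (intro tendsto_intros)
  show "filterlim (\<lambda>s. s - S) (at_right (t - S)) (at_right t)"
    using * unfolding filterlim_at by (auto simp: eventually_at_filter)
  show "filterlim (\<lambda>s. s - S) (at_left (t - S)) (at_left t)"
    using * unfolding filterlim_at by (auto simp: eventually_at_filter)
qed

lemma piecewise_continuous_on_reverse:
  assumes "piecewise_continuous_on 0 T f"
  shows "piecewise_continuous_on 0 T (\<lambda>t. - f (T - t))"
proof -
  from assms obtain S where S: "finite S" "continuous_on ({0..T} - S) f"
    and l: "\<And>t. t \<in> {0<..T} \<Longrightarrow> \<exists>l. (f \<longlongrightarrow> l) (at_left t)"
    and r: "\<And>t. t \<in> {0..<T} \<Longrightarrow> \<exists>l. (f \<longlongrightarrow> l) (at_right t)"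
    unfolding piecewise_continuous_on_def by blast
  have "continuous_on ({0..T} - (\<lambda>s. T - s) ` S) (\<lambda>t. - f (T - t))"
    by (intro continuous_intros continuous_on_compose2[OF S(2)]) force+
  moreover have "\<exists>l. ((\<lambda>t. - f (T - t)) \<longlongrightarrow> l) (at_left t)" if tt: "t \<in> {0<..T}" for t
  proof -
    obtain l where "(f \<longlongrightarrow> l) (at_right (T - t))" using r[of "T - t"] tt by auto
    from tendsto_minus[OF filterlim_compose[OF this filterlim_reflect(1)]] show ?thesis by blast
  qed
  moreover have "\<exists>l. ((\<lambda>t. - f (T - t)) \<longlongrightarrow> l) (at_right t)" if tt: "t \<in> {0..<T}" for t
  proof -
    obtain l' where "(f \<longlongrightarrow> l') (at_left (T - t))" using l[of "T - t"] tt by auto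
    from tendsto_minus[OF filterlim_compose[OF this filterlim_reflect(2)]] show ?thesis by blast
  qed
  ultimately show ?thesis
    unfolding piecewise_continuous_on_def using S(1) by (meson finite_imageI)
qed

lemma piecewise_continuous_on_join:
  assumes f: "piecewise_continuous_on 0 S f" and g: "piecewise_continuous_on 0 T g" and "0 \<le> S" "0 \<le> T"
  shows "piecewise_continuous_on 0 (S + T) (\<lambda>t. if t \<le> S then f t else g (t - S))" (is "piecewise_continuous_on _ _ ?h")
proof -
  from f obtain A where A: "finite A" "continuous_on ({0..S} - A) f"
    and fl: "\<And>t. t \<in> {0<..S} \<Longrightarrow> \<exists>l. (f \<longlongrightarrow> l) (at_left t)"
    and fr: "\<And>t. t \<in> {0..<S} \<Longrightarrow> \<exists>l. (f \<longlongrightarrow> l) (at_right t)"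
    unfolding piecewise_continuous_on_def by blast
  from g obtain B where B: "finite B" "continuous_on ({0..T} - B) g"
    and gl: "\<And>t. t \<in> {0<..T} \<Longrightarrow> \<exists>l. (g \<longlongrightarrow> l) (at_left t)"
    and gr: "\<And>t. t \<in> {0..<T} \<Longrightarrow> \<exists>l. (g \<longlongrightarrow> l) (at_right t)"
    unfolding piecewise_continuous_on_def by blast
  \<comment> \<open>The junction S is made exceptional, since the coefficients may jump there; the
    one-sided limits are checked separately.\<close>
  define C where "C = insert S (A \<union> (\<lambda>s. S + s) ` B)"
  have "continuous_on ({0..S+T} - C) ?h"
    unfolding continuous_on_eq_continuous_within
  proof
    fix t assume t: "t \<in> {0..S+T} - C"
    show "continuous (at t within {0..S+T} - C) ?h"
    proof (cases "t < S")
      case True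
      have "continuous (at t within {0..S} - A) f"
        using A(2) t True by (auto simp: continuous_on_eq_continuous_within C_def)
      then have "continuous (at t within ({0..S+T} - C) \<inter> {..<S}) f"
        by (rule continuous_within_subset) (auto simp: C_def)
      then have "continuous (at t within ({0..S+T} - C) \<inter> {..<S}) ?h"
        by (rule continuous_transform_within[OF _ zero_less_one]) (use t True in auto)
      moreover have "at t within ({0..S+T} - C) \<inter> {..<S} = at t within {0..S+T} - C"
        by (rule at_within_nhd[where S = "{..<S}"]) (use True in auto)
      ultimately show ?thesis by simp
    next
      case False
      with t have tS: "t > S" by (auto simp: C_def)
      have "continuous_on ({S..S+T} - (\<lambda>s. S + s) ` B) (\<lambda>t. g (t - S))"
        by (intro continuous_on_compose2[OF B(2)] continuous_intros) (force simp: image_iff)+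
      then have "continuous (at t within {S..S+T} - (\<lambda>s. S + s) ` B) (\<lambda>t. g (t - S))"
        using t tS by (auto simp: continuous_on_eq_continuous_within C_def)
      then have "continuous (at t within ({0..S+T} - C) \<inter> {S<..}) (\<lambda>t. g (t - S))"
        by (rule continuous_within_subset) (auto simp: C_def)
      then have "continuous (at t within ({0..S+T} - C) \<inter> {S<..}) ?h"
        by (rule continuous_transform_within[OF _ zero_less_one]) (use t tS in auto)
      moreover have "at t within ({0..S+T} - C) \<inter> {S<..} = at t within {0..S+T} - C"
        by (rule at_within_nhd[where S = "{S<..}"]) (use tS in auto)
      ultimately show ?thesis by simp
    qed
  qed
  moreover have "\<exists>l. (?h \<longlongrightarrow> l) (at_left t)" if tt: "t \<in> {0<..S+T}" for t
  proof (cases "t \<le> S")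
    case True
    then obtain l where l: "(f \<longlongrightarrow> l) (at_left t)" using fl[of t] tt by auto
    have "eventually (\<lambda>s. f s = ?h s) (at_left t)"
      using True by (auto simp: eventually_at_filter)
    then have "(?h \<longlongrightarrow> l) (at_left t)" using l tendsto_cong by fast
    then show ?thesis by blast
  next
    case False
    then obtain l where l: "(g \<longlongrightarrow> l) (at_left (t - S))" using gl[of "t - S"] tt by auto
    have "eventually (\<lambda>s. s > S) (at_left t)"
      using False eventually_at_left[of S t] by (meson linorder_not_le)
    then have "eventually (\<lambda>s. g (s - S) = ?h s) (at_left t)"
      by eventually_elim auto
    then have "(?h \<longlongrightarrow> l) (at_left t)"
      using filterlim_compose[OF l filterlim_shift(2)] tendsto_cong by fast
    then show ?thesis by blast
  qed
  moreover have "\<exists>l. (?h \<longlongrightarrow> l) (at_right t)" if tt: "t \<in> {0..<S+T}" for t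
  proof (cases "t < S")
    case True
    then obtain l where l: "(f \<longlongrightarrow> l) (at_right t)" using fr[of t] tt by auto
    have "eventually (\<lambda>s. s < S) (at_right t)"
      using True eventually_at_right[of t S] by blast
    then have "eventually (\<lambda>s. f s = ?h s) (at_right t)"
      by eventually_elim auto
    then have "(?h \<longlongrightarrow> l) (at_right t)" using l tendsto_cong by fast
    then show ?thesis by blast
  next
    case False
    then obtain l where l: "(g \<longlongrightarrow> l) (at_right (t - S))" using gr[of "t - S"] tt by auto
    have "eventually (\<lambda>s. g (s - S) = ?h s) (at_right t)"
      using False by (auto simp: eventually_at_filter)
    then have "(?h \<longlongrightarrow> l) (at_right t)"
      using filterlim_compose[OF l filterlim_shift(1)] tendsto_cong by fast
    then show ?thesis by blast
  qed
  ultimately show ?thesis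
    unfolding piecewise_continuous_on_def C_def using A(1) B(1) by (meson finite_UnI finite_imageI finite_insert)
qed

text \<open>Running backwards negates the coefficients, which the constraint on the sum of their
  absolute values does not notice. This makes the distance symmetric.\<close>

lemma subunit_curve_reverse:
  assumes "subunit_curve X x y T \<gamma>"
  shows "subunit_curve X y x T (\<lambda>t. \<gamma> (T - t))"
proof -
  from assms obtain a S where T: "0 \<le> T" and pw: "\<gamma> piecewise_C1_differentiable_on {0..T}"
    and ends: "\<gamma> 0 = x" "\<gamma> T = y"
    and a: "\<And>i. piecewise_continuous_on 0 T (a i)" "\<And>t. t \<in> {0..T} \<Longrightarrow> (\<Sum>i\<in>UNIV. \<bar>a i t\<bar>) \<le> 1"
    and S: "finite S" "\<And>t. t \<in> {0..T} - S \<Longrightarrow>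
           (\<gamma> has_vector_derivative (\<Sum>i\<in>UNIV. a i t *\<^sub>R X i (\<gamma> t))) (at t within {0..T})"
    unfolding subunit_curve_def by blast
  have im: "(\<lambda>t. T - t) ` {0..T} = {0..T}" by (auto simp: image_iff intro: bexI[of _ "T - _"])
  have pw': "(\<lambda>t. \<gamma> (T - t)) piecewise_C1_differentiable_on {0..T}"
    using piecewise_C1_differentiable_affine[of \<gamma> "-1" T "{0..T}"] pw im by (simp add: o_def)
  have der: "((\<lambda>t. \<gamma> (T - t)) has_vector_derivative (\<Sum>i\<in>UNIV. (- a i (T - t)) *\<^sub>R X i (\<gamma> (T - t)))) (at t within {0..T})"
    if "t \<in> {0..T} - (\<lambda>s. T - s) ` S" for t
  proof -
    have t: "T - t \<in> {0..T} - S" using that by (auto simp: image_iff)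
    have 1: "((\<lambda>t. T - t) has_vector_derivative -1) (at t within {0..T})"
      by (auto intro!: derivative_eq_intros)
    have 2: "(\<gamma> has_vector_derivative (\<Sum>i\<in>UNIV. a i (T - t) *\<^sub>R X i (\<gamma> (T - t)))) (at (T - t) within (\<lambda>t. T - t) ` {0..T})"
      using S(2)[OF t] im by simp
    show ?thesis
      using vector_diff_chain_within[OF 1 2] by (simp add: o_def sum_negf)
  qed
  show ?thesis unfolding subunit_curve_def
  proof (intro conjI exI[of _ "\<lambda>i t. - a i (T - t)"] allI ballI)
    show "\<exists>S. finite S \<and> (\<forall>t\<in>{0..T} - S. ((\<lambda>t. \<gamma> (T - t)) has_vector_derivative
        (\<Sum>i\<in>UNIV. - a i (T - t) *\<^sub>R X i (\<gamma> (T - t)))) (at t within {0..T}))"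
      using der S(1) by (intro exI[of _ "(\<lambda>s. T - s) ` S"]) simp
    show "(\<Sum>i\<in>UNIV. \<bar>- a i (T - t)\<bar>) \<le> 1" if tt: "t \<in> {0..T}" for t
      using a(2)[of "T - t"] that by simp
  qed (use T ends pw' piecewise_continuous_on_reverse[OF a(1)] in simp_all)
qed

lemma subunit_curve_join:
  assumes "subunit_curve X x y S \<gamma>" "subunit_curve X y z T \<delta>"
  shows "subunit_curve X x z (S + T) (\<lambda>t. if t \<le> S then \<gamma> t else \<delta> (t - S))" (is "subunit_curve _ _ _ _ ?h")
proof -
  from assms(1) obtain a A where S: "0 \<le> S" and pw: "\<gamma> piecewise_C1_differentiable_on {0..S}"
    and ends: "\<gamma> 0 = x" "\<gamma> S = y"
    and a: "\<And>i. piecewise_continuous_on 0 S (a i)" "\<And>t. t \<in> {0..S} \<Longrightarrow> (\<Sum>i\<in>UNIV. \<bar>a i t\<bar>) \<le> 1"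
    and A: "finite A" "\<And>t. t \<in> {0..S} - A \<Longrightarrow>
           (\<gamma> has_vector_derivative (\<Sum>i\<in>UNIV. a i t *\<^sub>R X i (\<gamma> t))) (at t within {0..S})"
    unfolding subunit_curve_def by blast
  from assms(2) obtain b B where T: "0 \<le> T" and pw': "\<delta> piecewise_C1_differentiable_on {0..T}"
    and ends': "\<delta> 0 = y" "\<delta> T = z"
    and b: "\<And>i. piecewise_continuous_on 0 T (b i)" "\<And>t. t \<in> {0..T} \<Longrightarrow> (\<Sum>i\<in>UNIV. \<bar>b i t\<bar>) \<le> 1"
    and B: "finite B" "\<And>t. t \<in> {0..T} - B \<Longrightarrow>
           (\<delta> has_vector_derivative (\<Sum>i\<in>UNIV. b i t *\<^sub>R X i (\<delta> t))) (at t within {0..T})"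
    unfolding subunit_curve_def by blast
  have im: "(\<lambda>t. t - S) ` {S..S+T} = {0..T}" by (auto simp: image_iff intro!: bexI[of _ "S + _"])
  have "(\<lambda>t. \<delta> (t - S)) piecewise_C1_differentiable_on {S..S+T}"
    using piecewise_C1_differentiable_affine[of \<delta> 1 "-S" "{S..S+T}"] pw' im by (simp add: o_def)
  then have PW: "?h piecewise_C1_differentiable_on {0..S+T}"
    by (intro piecewise_C1_differentiable_cases pw) (use S T ends ends' in auto)
  define c where "c i t = (if t \<le> S then a i t else b i (t - S))" for i t
  define C where "C = insert S (A \<union> (\<lambda>s. S + s) ` B)"
  have der: "(?h has_vector_derivative (\<Sum>i\<in>UNIV. c i t *\<^sub>R X i (?h t))) (at t within {0..S+T})"
    if t: "t \<in> {0..S+T} - C" for t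
  proof (cases "t < S")
    case True
    then have "(\<gamma> has_vector_derivative (\<Sum>i\<in>UNIV. c i t *\<^sub>R X i (?h t))) (at t within {0..S})"
      using A(2)[of t] t by (simp add: c_def C_def)
    moreover have "at t within {0..S+T} = at t within {0..S}"
      by (rule at_within_nhd[where S = "{..<S}"]) (use True T in auto)
    ultimately have "(\<gamma> has_vector_derivative (\<Sum>i\<in>UNIV. c i t *\<^sub>R X i (?h t))) (at t within {0..S+T})"
      by simp
    then show ?thesis
      by (rule has_vector_derivative_transform_within[where d = "S - t"])
         (use True t in \<open>auto simp: dist_real_def\<close>)
  next
    case False
    with t have tS: "t > S" by (auto simp: C_def)
    have 1: "((\<lambda>t. t - S) has_vector_derivative 1) (at t within {S..S+T})"
      by (auto intro!: derivative_eq_intros)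
    have "t - S \<in> {0..T} - B" using t tS by (auto simp: C_def image_iff)
    from B(2)[OF this] have 2: "(\<delta> has_vector_derivative (\<Sum>i\<in>UNIV. b i (t - S) *\<^sub>R X i (\<delta> (t - S)))) (at (t - S) within (\<lambda>t. t - S) ` {S..S+T})"
      using im by simp
    have "((\<lambda>t. \<delta> (t - S)) has_vector_derivative (\<Sum>i\<in>UNIV. c i t *\<^sub>R X i (?h t))) (at t within {S..S+T})"
      using vector_diff_chain_within[OF 1 2] tS by (simp add: o_def c_def)
    moreover have "at t within {0..S+T} = at t within {S..S+T}"
      by (rule at_within_nhd[where S = "{S<..}"]) (use tS S in auto)
    ultimately have "((\<lambda>t. \<delta> (t - S)) has_vector_derivative (\<Sum>i\<in>UNIV. c i t *\<^sub>R X i (?h t))) (at t within {0..S+T})"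
      by simp
    then show ?thesis
      by (rule has_vector_derivative_transform_within[where d = "t - S"])
         (use tS t in \<open>auto simp: dist_real_def\<close>)
  qed
  show ?thesis unfolding subunit_curve_def
  proof (intro conjI exI[of _ c] allI ballI)
    show "\<exists>S'. finite S' \<and> (\<forall>t\<in>{0..S+T} - S'. (?h has_vector_derivative
        (\<Sum>i\<in>UNIV. c i t *\<^sub>R X i (?h t))) (at t within {0..S+T}))"
      using der A(1) B(1) by (intro exI[of _ C]) (simp add: C_def)
    show "(\<Sum>i\<in>UNIV. \<bar>c i t\<bar>) \<le> 1" if tt: "t \<in> {0..S+T}" for t
      using a(2)[of t] b(2)[of "t - S"] that by (cases "t \<le> S") (auto simp: c_def)
    show "piecewise_continuous_on 0 (S + T) (c i)" for i
      unfolding c_def by (rule piecewise_continuous_on_join[OF a(1) b(1) S T])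
    \<comment> \<open>For T = 0 the endpoint is read from the first arc, and y = z.\<close>
    show "?h (S + T) = z" using ends ends' T by (cases "T = 0") auto
  qed (use S T ends PW in auto)
qed

section \<open>The distance function\<close>

lemma cc_dist_nonneg: "0 \<le> cc_dist X x y"
  unfolding cc_dist_def by (rule INF_greatest) (auto simp: subunit_curve_def)

lemma cc_dist_less_iff:
  "cc_dist X x y < ereal r \<longleftrightarrow> (\<exists>T \<gamma>. subunit_curve X x y T \<gamma> \<and> T < r)"
  by (auto simp: cc_dist_def INF_less_iff)

lemma cc_dist_commute: "cc_dist X x y = cc_dist X y x"
proof -
  have "{T. \<exists>\<gamma>. subunit_curve X x y T \<gamma>} = {T. \<exists>\<gamma>. subunit_curve X y x T \<gamma>}"
    using subunit_curve_reverse by blast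
  then show ?thesis by (simp add: cc_dist_def)
qed

lemma cc_dist_triangle: "cc_dist X x z \<le> cc_dist X x y + cc_dist X y z"
proof (rule ereal_le_epsilon2)
  fix e :: real assume e: "0 < e"
  show "cc_dist X x z \<le> cc_dist X x y + cc_dist X y z + ereal e"
  proof (cases "cc_dist X x y = \<infinity> \<or> cc_dist X y z = \<infinity>")
    case True
    then show ?thesis using cc_dist_nonneg[of X x y] cc_dist_nonneg[of X y z] by auto
  next
    case False
    then obtain r s where r: "cc_dist X x y = ereal r" and s: "cc_dist X y z = ereal s"
      using cc_dist_nonneg[of X x y] cc_dist_nonneg[of X y z] by (metis abs_ereal_ge0 ereal_infinity_cases ereal_cases MInfty_neq_PInfty(1) ereal_less_eq(6) not_MInfty_nonneg)
    have "cc_dist X x y < ereal (r + e / 2)" "cc_dist X y z < ereal (s + e / 2)" using e r s by auto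
    then obtain T \<gamma> T' \<gamma>' where c: "subunit_curve X x y T \<gamma>" "T < r + e / 2" "subunit_curve X y z T' \<gamma>'" "T' < s + e / 2"
      unfolding cc_dist_less_iff by blast
    have "cc_dist X x z < ereal (r + s + e)"
      unfolding cc_dist_less_iff
      using subunit_curve_join[OF c(1,3)] c(2,4) by (intro exI conjI) (assumption, simp)
    then show ?thesis using r s by (simp add: less_imp_le)
  qed
qed

text \<open>A subunit curve has speed at most \<Lambda>, because the absolute coefficients sum to at
  most 1; integrate the velocity and take the infimum over T. Finiteness matters, as
  \<open>real_of_ereal\<close> sends \<infinity> to 0.\<close>

lemma norm_le_cc_dist:
  assumes \<Lambda>: "\<And>i x. norm (X i x) \<le> \<Lambda>" and fin: "cc_dist X x y \<noteq> \<infinity>"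
  shows "norm (x - y) \<le> \<Lambda> * real_of_ereal (cc_dist X x y)"
proof -
  have \<Lambda>0: "\<Lambda> \<ge> 0" using \<Lambda>[of undefined undefined] norm_ge_zero order_trans by blast
  obtain r where r: "cc_dist X x y = ereal r"
    using cc_dist_nonneg[of X x y] fin by (cases "cc_dist X x y") auto
  have "norm (x - y) \<le> \<Lambda> * (r + e)" if e: "e > 0" for e
  proof -
    have "cc_dist X x y < ereal (r + e)" using e r by simp
    then obtain T \<gamma> where c: "subunit_curve X x y T \<gamma>" "T < r + e" unfolding cc_dist_less_iff by blast
    then obtain a S where T: "0 \<le> T" and pw: "\<gamma> piecewise_C1_differentiable_on {0..T}"
      and ends: "\<gamma> 0 = x" "\<gamma> T = y"
      and a: "\<And>t. t \<in> {0..T} \<Longrightarrow> (\<Sum>i\<in>UNIV. \<bar>a i t\<bar>) \<le> 1"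
      and S: "finite S" "\<And>t. t \<in> {0..T} - S \<Longrightarrow>
           (\<gamma> has_vector_derivative (\<Sum>i\<in>UNIV. a i t *\<^sub>R X i (\<gamma> t))) (at t within {0..T})"
      unfolding subunit_curve_def by blast
    define v where "v t = (\<Sum>i\<in>UNIV. a i t *\<^sub>R X i (\<gamma> t))" for t
    have v: "norm (v t) \<le> \<Lambda>" if tt: "t \<in> {0..T}" for t
    proof -
      have "norm (v t) \<le> (\<Sum>i\<in>UNIV. \<bar>a i t\<bar> * \<Lambda>)"
        unfolding v_def by (rule order_trans[OF norm_sum]) (auto intro!: sum_mono mult_left_mono \<Lambda>)
      also have "\<dots> = (\<Sum>i\<in>UNIV. \<bar>a i t\<bar>) * \<Lambda>" by (simp add: sum_distrib_right)
      also have "\<dots> \<le> 1 * \<Lambda>" by (rule mult_right_mono[OF a[OF that] \<Lambda>0])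
      finally show ?thesis by simp
    qed
    define w where "w t = (if t \<in> S then 0 else v t)" for t
    have "(w has_integral (\<gamma> T - \<gamma> 0)) {0..T}"
    proof (rule fundamental_theorem_of_calculus_interior_strong[OF S(1) T])
      show "continuous_on {0..T} \<gamma>" using pw by (simp add: piecewise_C1_differentiable_on_def)
      fix t assume t: "t \<in> {0<..<T} - S"
      then have "(\<gamma> has_vector_derivative w t) (at t within {0..T})"
        using S(2)[of t] by (simp add: w_def v_def)
      moreover have "at t within {0..T} = at t" using t by (intro at_within_interior) auto
      ultimately show "(\<gamma> has_vector_derivative w t) (at t)" by simp
    qed
    then have "norm (\<gamma> T - \<gamma> 0) \<le> \<Lambda> * measure lborel {0..T}"
      by (rule has_integral_bound_real[OF \<Lambda>0 finite.emptyI]) (auto simp: w_def \<Lambda>0 intro: v)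
    also have "\<dots> = \<Lambda> * T" using T by simp
    also have "\<dots> \<le> \<Lambda> * (r + e)" using c(2) \<Lambda>0 by (intro mult_left_mono) auto
    finally show ?thesis using ends by (simp add: norm_minus_commute)
  qed
  then have "norm (x - y) \<le> \<Lambda> * r + e" if "e > 0" for e
  proof (cases "\<Lambda> = 0")
    case True
    then show ?thesis using \<open>\<And>e. 0 < e \<Longrightarrow> norm (x - y) \<le> \<Lambda> * (r + e)\<close>[OF that] that by simp
  next
    case False
    then have "norm (x - y) \<le> \<Lambda> * (r + e / \<Lambda>)" using \<open>\<And>e. 0 < e \<Longrightarrow> norm (x - y) \<le> \<Lambda> * (r + e)\<close>[of "e / \<Lambda>"] that \<Lambda>0 by simp
    then show ?thesis using False by (simp add: distrib_left)
  qed
  then have "norm (x - y) \<le> \<Lambda> * r" by (rule field_le_epsilon)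
  then show ?thesis using r by simp
qed

section \<open>Consequences of the Gaussian bounds\<close>

locale gaussian_heat_kernel =
  fixes X :: "'m::finite \<Rightarrow> 'a::euclidean_space \<Rightarrow> 'a" and p :: "'a \<Rightarrow> 'a \<Rightarrow> real \<Rightarrow> real" and M :: real
  assumes smooth_fields: "\<And>i. smooth_on (X i) UNIV"
    and hormander: "hormander X"
    and off_compact: "laplacian_off_compact X"
    and kernel: "heat_kernel X p"
    and M: "M > 0"
    and upper: "gaussian_upper X M p"
    and lower: "gaussian_lower X M p"
    and mass: "\<And>x t. t > 0 \<Longrightarrow> has_bochner_integral lborel (\<lambda>y. p x y t) 1"
begin

abbreviation d where "d \<equiv> cc_dist X"
abbreviation V where "V \<equiv> cc_volume X"

lemma p_pos: "t > 0 \<Longrightarrow> p x y t > 0" and p_zero: "t \<le> 0 \<Longrightarrow> p x y t = 0"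
  using kernel by (auto simp: heat_kernel_def)

lemma p_nonneg: "p x y t \<ge> 0"
  using p_pos[of t x y] p_zero[of t x y] by (cases "t > 0") (auto intro: less_imp_le)

section \<open>Finite distances, positive volumes and doubling\<close>

lemma p_upper: "\<exists>C>0. \<forall>x y t. t > 0 \<longrightarrow> p x y t \<le> C / V x (sqrt t) * gaussian M (d x y) t"
proof -
  obtain C where C: "C > 0" "\<forall>js. length js = 0 \<longrightarrow> (\<forall>x y t. t > 0 \<longrightarrow>
        \<bar>(deriv ^^ 0) (\<lambda>\<tau>. vf_word X js (\<lambda>\<xi>. p \<xi> y \<tau>) x) t\<bar>
          \<le> C / (t powr (real 0 + real 0 / 2) * cc_volume X x (sqrt t)) * gaussian M (cc_dist X x y) t)"
    using upper unfolding gaussian_upper_def by blast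
  have "p x y t \<le> C / V x (sqrt t) * gaussian M (d x y) t" if "t > 0" for x y t
    using C(2)[rule_format, of "[]" t y x] that by auto
  then show ?thesis using C(1) by blast
qed

lemma gaussian_nonneg: "gaussian \<theta> e t \<ge> 0"
  by (simp add: gaussian_def)

text \<open>At infinite distance the Gaussian in the upper bound is 0 by convention, against p > 0.
  This takes the place of Chow's theorem.\<close>

lemma d_finite: "d x y \<noteq> \<infinity>"
proof
  assume "d x y = \<infinity>"
  obtain C where "\<And>x y t. t > 0 \<Longrightarrow> p x y t \<le> C / V x (sqrt t) * gaussian M (d x y) t"
    using p_upper by blast
  from this[of 1 x y] \<open>d x y = \<infinity>\<close> have "p x y 1 \<le> 0" by (simp add: gaussian_def)
  then show False using p_pos[of 1 x y] by simp
qed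

definition dr where "dr x y = real_of_ereal (d x y)"

lemma d_eq: "d x y = ereal (dr x y)"
  using d_finite[of x y] cc_dist_nonneg[of X x y] unfolding dr_def by (cases "d x y") auto

lemma dr_nonneg: "dr x y \<ge> 0"
  using cc_dist_nonneg[of X x y] by (simp add: d_eq)

lemma dr_commute: "dr x y = dr y x"
  by (simp add: dr_def cc_dist_commute)

lemma dr_triangle: "dr x z \<le> dr x y + dr y z"
  using cc_dist_triangle[of X x z y] by (simp add: d_eq)

lemma gaussian_eq: "gaussian \<theta> (d x y) t = exp (- \<theta> * (dr x y)\<^sup>2 / t)"
  by (simp add: gaussian_def d_eq)

text \<open>Volume 0 would turn the upper bound into 0, as division by 0 gives 0, again against p >
  0.\<close>

lemma V_pos: "r > 0 \<Longrightarrow> V x r > 0"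
proof (rule ccontr)
  assume r: "r > 0" "\<not> V x r > 0"
  then have "V x (sqrt (r\<^sup>2)) = 0" using measure_nonneg[of lborel] by (simp add: cc_volume_def order_less_le)
  then have "p x x (r\<^sup>2) \<le> 0" using p_upper r(1) by (metis div_by_0 mult_zero_left zero_less_power)
  then show False using p_pos[of "r\<^sup>2" x x] r(1) by simp
qed

text \<open>\<open>measure\<close> is 0 on nonmeasurable sets and on sets of infinite measure, so
  positive volume yields both claims without any topology of the balls.\<close>

lemma cc_ball_sets: "r > 0 \<Longrightarrow> cc_ball X x r \<in> sets lborel"
  and cc_ball_finite: "r > 0 \<Longrightarrow> emeasure lborel (cc_ball X x r) < \<infinity>"
proof -
  assume "r > 0"
  then have *: "measure lborel (cc_ball X x r) > 0" using V_pos by (simp add: cc_volume_def)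
  then show "cc_ball X x r \<in> sets lborel" using measure_notin_sets by fastforce
  show "emeasure lborel (cc_ball X x r) < \<infinity>"
    using * by (metis infinity_ennreal_def less_irrefl measure_eq_AE enn2real_top measure_def top.not_eq_extremum)
qed

lemma mem_cc_ball: "y \<in> cc_ball X x r \<longleftrightarrow> dr x y < r"
  by (simp add: cc_ball_def d_eq)

lemma p_integrable: "integrable lborel (\<lambda>y. p x y t)"
  using mass[of t x] p_zero[of t x] by (cases "t > 0") (auto simp: has_bochner_integral_iff)

lemma p_integral: "t > 0 \<Longrightarrow> (\<integral>y. p x y t \<partial>lborel) = 1"
  using mass[of t x] by (auto simp: has_bochner_integral_iff)

text \<open>The lower Gaussian bound has total mass at most one. Comparing it with the measure of a ball
  yields volume doubling, without any ball-box estimate.\<close>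

lemma volume_growth: "\<exists>C>0. \<forall>x R t. R > 0 \<longrightarrow> t > 0 \<longrightarrow> V x R \<le> C * exp (R\<^sup>2 / (M * t)) * V x (sqrt t)"
proof -
  obtain C where C: "C > 0" "\<And>x y t. t > 0 \<Longrightarrow>
        p x y t \<ge> inverse C / cc_volume X x (sqrt t) * gaussian (inverse M) (cc_dist X x y) t"
    using lower unfolding gaussian_lower_def by blast
  have "V x R \<le> C * exp (R\<^sup>2 / (M * t)) * V x (sqrt t)" if R: "R > 0" and t: "t > 0" for x R t
  proof -
    \<comment> \<open>The value at distance R of the lower Gaussian bound, hence a lower bound for p
      on the ball.\<close>
    define c where "c = inverse C / V x (sqrt t) * exp (- (R\<^sup>2 / (M * t)))"
    have V: "V x (sqrt t) > 0" using V_pos t by simp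
    have "(\<integral>y. c * indicator (cc_ball X x R) y \<partial>lborel) \<le> (\<integral>y. p x y t \<partial>lborel)"
    proof (rule integral_mono[OF _ p_integrable])
      show "integrable lborel (\<lambda>y. c * indicator (cc_ball X x R) y)"
        using cc_ball_sets[OF R] cc_ball_finite[OF R] by (intro integrable_mult_right) simp
      fix y
      show "c * indicator (cc_ball X x R) y \<le> p x y t"
      proof (cases "y \<in> cc_ball X x R")
        case True
        then have "dr x y < R" by (simp add: mem_cc_ball)
        then have "(dr x y)\<^sup>2 \<le> R\<^sup>2" using dr_nonneg by (intro power_mono) auto
        then have "exp (- (R\<^sup>2 / (M * t))) \<le> gaussian (inverse M) (d x y) t"
          using M t by (simp add: gaussian_eq field_simps)
        then have "c \<le> inverse C / V x (sqrt t) * gaussian (inverse M) (d x y) t"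
          unfolding c_def using C(1) V by (intro mult_left_mono) auto
        then show ?thesis using C(2)[OF t, of x y] True by simp
      qed (simp add: p_nonneg)
    qed
    then have "c * V x R \<le> 1" using p_integral[OF t] cc_ball_sets[OF R] by (simp add: cc_volume_def)
    then show ?thesis using C(1) V by (simp add: c_def exp_minus field_simps)
  qed
  then show ?thesis using C(1) by blast
qed

text \<open>At time t / (M \<theta>) the Gaussian of the lower bound has exactly the exponent
  \<theta> d^2 / t, and \<open>volume_growth\<close> exchanges the volumes at the two time
  scales.\<close>

lemma gaussian_le_p:
  assumes \<theta>: "\<theta> > 0"
  shows "\<exists>C>0. \<forall>x y t. t > 0 \<longrightarrow> gaussian \<theta> (d x y) t / V x (sqrt t) \<le> C * p x y (t / (M * \<theta>))"
proof -
  obtain C where C: "C > 0" "\<And>x y t. t > 0 \<Longrightarrow>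
        p x y t \<ge> inverse C / cc_volume X x (sqrt t) * gaussian (inverse M) (cc_dist X x y) t"
    using lower unfolding gaussian_lower_def by blast
  obtain D where D: "D > 0" "\<And>x R t. R > 0 \<Longrightarrow> t > 0 \<Longrightarrow> V x R \<le> D * exp (R\<^sup>2 / (M * t)) * V x (sqrt t)"
    using volume_growth by blast
  \<comment> \<open>\<open>volume_growth\<close> with R^2 = t / (M \<theta>): the exponent R^2 / (M
    t) no longer depends on t.\<close>
  define K where "K = D * exp (1 / (M * (M * \<theta>)))"
  have K: "K > 0" using D by (simp add: K_def)
  have "gaussian \<theta> (d x y) t / V x (sqrt t) \<le> (K * C) * p x y (t / (M * \<theta>))" if t: "t > 0" for x y t
  proof -
    define t' where "t' = t / (M * \<theta>)"
    have t': "t' > 0" using t M \<theta> by (simp add: t'_def)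
    have V: "V x (sqrt t) > 0" "V x (sqrt t') > 0" using V_pos t t' by auto
    have g: "gaussian \<theta> (d x y) t = gaussian (inverse M) (d x y) t'"
      using M \<theta> by (simp add: gaussian_eq t'_def field_simps)
    have "V x (sqrt t') \<le> K * V x (sqrt t)"
      using D(2)[of "sqrt t'" t x] t t' M \<theta> by (simp add: K_def t'_def field_simps)
    then have "1 / V x (sqrt t) \<le> K / V x (sqrt t')"
      using V by (simp add: field_simps)
    then have "gaussian \<theta> (d x y) t / V x (sqrt t) \<le> gaussian \<theta> (d x y) t * (K / V x (sqrt t'))"
      using mult_left_mono[OF _ gaussian_nonneg[of \<theta> "d x y" t]] by fastforce
    also have "\<dots> = K * C * (inverse C / V x (sqrt t') * gaussian (inverse M) (d x y) t')"
      using C(1) by (simp add: g)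
    also have "\<dots> \<le> K * C * p x y t'"
      using C K t' by (intro mult_left_mono) auto
    finally show ?thesis by (simp add: t'_def)
  qed
  then show ?thesis using K C(1) by (intro exI[of _ "K * C"]) auto
qed

text \<open>The time factor of \<open>gaussian_le_p\<close> for \<theta> = M, the exponent of the
  upper bound.\<close>

definition \<kappa> where "\<kappa> = 1 / (M * M)"

lemma \<kappa>_pos: "\<kappa> > 0" using M by (simp add: \<kappa>_def)

text \<open>Upper Gaussian followed by \<open>gaussian_le_p\<close>. The factor t^(-j/2) is weakened
  to (1 + 1/t)^j, which increases with j, so that words of different lengths can share one
  bound.\<close>

lemma vf_word_le_p:
  "\<exists>C>0. \<forall>js x y t. length js = j \<longrightarrow> t > 0 \<longrightarrow>
     \<bar>vf_word X js (\<lambda>\<xi>. p \<xi> y t) x\<bar> \<le> C * (1 + 1 / t) ^ j * p x y (\<kappa> * t)"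
proof -
  obtain C where C: "C > 0" "\<forall>js. length js = j \<longrightarrow> (\<forall>x y t. t > 0 \<longrightarrow>
        \<bar>(deriv ^^ 0) (\<lambda>\<tau>. vf_word X js (\<lambda>\<xi>. p \<xi> y \<tau>) x) t\<bar>
          \<le> C / (t powr (real 0 + real j / 2) * cc_volume X x (sqrt t)) * gaussian M (cc_dist X x y) t)"
    using upper unfolding gaussian_upper_def by blast
  obtain D where D: "D > 0" "\<And>x y t. t > 0 \<Longrightarrow> gaussian M (d x y) t / V x (sqrt t) \<le> D * p x y (t / (M * M))"
    using gaussian_le_p[OF M] by blast
  have "\<bar>vf_word X js (\<lambda>\<xi>. p \<xi> y t) x\<bar> \<le> (C * D) * (1 + 1 / t) ^ j * p x y (\<kappa> * t)"
    if js: "length js = j" and t: "t > 0" for js x y t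
  proof -
    have pw: "1 / t powr (real j / 2) \<le> (1 + 1 / t) ^ j"
    proof -
      have "1 / t powr (real j / 2) = (1 / t) powr (real j / 2)"
        using t by (simp add: powr_divide)
      also have "\<dots> \<le> (1 + 1 / t) powr (real j / 2)" using t by (intro powr_mono2) auto
      also have "\<dots> \<le> (1 + 1 / t) powr (real j)" using t by (intro powr_mono) auto
      also have "\<dots> = (1 + 1 / t) ^ j" using t by (intro powr_realpow) (auto simp: add_pos_pos)
      finally show ?thesis .
    qed
    have g0: "0 \<le> gaussian M (d x y) t / V x (sqrt t)" using gaussian_nonneg V_pos t by (simp add: less_imp_le)
    have "\<bar>vf_word X js (\<lambda>\<xi>. p \<xi> y t) x\<bar> \<le> C / (t powr (real j / 2) * V x (sqrt t)) * gaussian M (d x y) t"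
      using C(2) js t by simp
    also have "\<dots> = C * (1 / t powr (real j / 2)) * (gaussian M (d x y) t / V x (sqrt t))" by simp
    also have "\<dots> \<le> C * (1 + 1 / t) ^ j * (D * p x y (t / (M * M)))"
      using C(1) t by (intro mult_mono mult_left_mono pw D g0) auto
    finally show ?thesis by (simp add: \<kappa>_def mult_ac)
  qed
  then show ?thesis using C(1) D(1) by (intro exI[of _ "C * D"]) auto
qed

lemma vf_words_le_p:
  "\<exists>C>0. \<forall>js x y t. length js \<le> J \<longrightarrow> t > 0 \<longrightarrow>
     \<bar>vf_word X js (\<lambda>\<xi>. p \<xi> y t) x\<bar> \<le> C * (1 + 1 / t) ^ J * p x y (\<kappa> * t)"
proof -
  obtain C where C: "\<And>j. C j > 0" "\<And>j js x y t. length js = j \<Longrightarrow> t > 0 \<Longrightarrow>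
     \<bar>vf_word X js (\<lambda>\<xi>. p \<xi> y t) x\<bar> \<le> C j * (1 + 1 / t) ^ j * p x y (\<kappa> * t)"
    using vf_word_le_p by metis
  have "\<bar>vf_word X js (\<lambda>\<xi>. p \<xi> y t) x\<bar> \<le> (\<Sum>j\<le>J. C j) * (1 + 1 / t) ^ J * p x y (\<kappa> * t)"
    if "length js \<le> J" "t > 0" for js x y t
  proof -
    have "C (length js) \<le> (\<Sum>j\<le>J. C j)"
      using that(1) C(1) by (intro member_le_sum) (auto intro: less_imp_le)
    moreover have "(1 + 1 / t) ^ length js \<le> (1 + 1 / t) ^ J"
      using that by (intro power_increasing) auto
    ultimately have "C (length js) * (1 + 1 / t) ^ length js * p x y (\<kappa> * t) \<le> (\<Sum>j\<le>J. C j) * (1 + 1 / t) ^ J * p x y (\<kappa> * t)"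
      using C(1) that(2) by (intro mult_right_mono mult_mono p_nonneg sum_nonneg) (auto intro: less_imp_le)
    then show ?thesis using C(2)[OF refl that(2), of js y x] by linarith
  qed
  moreover have "(\<Sum>j\<le>J. C j) > 0" using C(1) by (intro sum_pos) auto
  ultimately show ?thesis by blast
qed

text \<open>Doubling from a fixed radius R with R^2 = M \<epsilon> gives 1 / V x (sqrt t) \<le>
  const exp (\<epsilon> / t). The constant depends on x but not on y, and \<epsilon> can be chosen
  below the exponent z^2 / 4 of the weight.\<close>

lemma p_small_time:
  assumes "\<epsilon> > 0"
  shows "\<exists>C>0. \<forall>y t. t > 0 \<longrightarrow> p x y t \<le> C * exp (\<epsilon> / t)"
proof -
  obtain C where C: "C > 0" "\<And>x y t. t > 0 \<Longrightarrow> p x y t \<le> C / V x (sqrt t) * gaussian M (d x y) t"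
    using p_upper by blast
  obtain D where D: "D > 0" "\<And>x R t. R > 0 \<Longrightarrow> t > 0 \<Longrightarrow> V x R \<le> D * exp (R\<^sup>2 / (M * t)) * V x (sqrt t)"
    using volume_growth by blast
  define R where "R = sqrt (M * \<epsilon>)"
  have R: "R > 0" "R\<^sup>2 = M * \<epsilon>" using M assms by (auto simp: R_def)
  have "p x y t \<le> C * D / V x R * exp (\<epsilon> / t)" if t: "t > 0" for y t
  proof -
    have V: "V x (sqrt t) > 0" "V x R > 0" using V_pos t R by auto
    have "V x R \<le> D * exp (\<epsilon> / t) * V x (sqrt t)" using D(2)[OF R(1) t, of x] R(2) M by simp
    then have 1: "1 / V x (sqrt t) \<le> D * exp (\<epsilon> / t) / V x R" using V by (simp add: field_simps)
    have "gaussian M (d x y) t \<le> 1" using M t by (simp add: gaussian_eq)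
    then have "C / V x (sqrt t) * gaussian M (d x y) t \<le> C / V x (sqrt t) * 1"
      using C V by (intro mult_left_mono) auto
    also have "\<dots> \<le> C * (D * exp (\<epsilon> / t) / V x R)" using mult_left_mono[OF 1, of C] C(1) by simp
    finally show ?thesis using C(2)[OF t, of x y] by (simp add: mult_ac)
  qed
  then show ?thesis using C D V_pos[OF R(1), of x] by (intro exI[of _ "C * D / V x R"]) auto
qed

text \<open>Volume growth at the time scale \<open>4 t / M\<^sup>2\<close> bounds the ratio of the two ball volumes by a factor
  that half of the Gaussian absorbs.\<close>

lemma p_swap: "\<exists>C>0. \<forall>x y t. t > 0 \<longrightarrow> p x y t \<le> C * p y x (2 * \<kappa> * t)"
proof -
  obtain C where C: "C > 0" "\<And>x y t. t > 0 \<Longrightarrow> p x y t \<le> C / V x (sqrt t) * gaussian M (d x y) t"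
    using p_upper by blast
  obtain D where D: "D > 0" "\<And>x R t. R > 0 \<Longrightarrow> t > 0 \<Longrightarrow> V x R \<le> D * exp (R\<^sup>2 / (M * t)) * V x (sqrt t)"
    using volume_growth by blast
  obtain E where E: "E > 0" "\<And>x y t. t > 0 \<Longrightarrow> gaussian (M/2) (d x y) t / V x (sqrt t) \<le> E * p x y (t / (M * (M/2)))"
    using gaussian_le_p[of "M/2"] M by auto
  define \<Lambda> where "\<Lambda> = 4 / (M * M)"
  have \<Lambda>: "\<Lambda> > 0" using M by (simp add: \<Lambda>_def)
  define K where "K = D * exp (M / 2) * (D * exp (\<Lambda> / M))"
  have K: "K > 0" using D by (simp add: K_def)
  have "p x y t \<le> (C * K * E) * p y x (2 * \<kappa> * t)" if t: "t > 0" for x y t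
  proof -
    define \<rho> where "\<rho> = dr x y"
    have \<rho>: "\<rho> \<ge> 0" by (simp add: \<rho>_def dr_nonneg)
    have V: "V x (sqrt t) > 0" "V y (sqrt t) > 0" using V_pos t by auto
    define R where "R = sqrt t + \<rho>"
    have R: "R > 0" using t \<rho> by (simp add: R_def add_pos_nonneg)
    have "cc_ball X y (sqrt t) \<subseteq> cc_ball X x R"
    proof
      fix w assume "w \<in> cc_ball X y (sqrt t)"
      then show "w \<in> cc_ball X x R" using dr_triangle[of x w y] by (simp add: mem_cc_ball R_def \<rho>_def)
    qed
    then have "V y (sqrt t) \<le> V x R"
      unfolding cc_volume_def using cc_ball_sets[OF R] cc_ball_finite[OF R] cc_ball_sets[of "sqrt t" y] t
      by (intro measure_mono_fmeasurable) (auto simp: fmeasurable_def)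
    also have "\<dots> \<le> D * exp (R\<^sup>2 / (M * (\<Lambda> * t))) * V x (sqrt (\<Lambda> * t))"
      using D(2)[OF R] \<Lambda> t by simp
    also have "\<dots> \<le> D * exp (M / 2 + M / 2 * \<rho>\<^sup>2 / t) * (D * exp (\<Lambda> / M) * V x (sqrt t))"
    \<comment> \<open>From R^2 \<le> 2 t + 2 \<rho>^2 and \<Lambda> = 4 / M^2 the exponent becomes M
      / 2 + (M / 2) \<rho>^2 / t, that is, half of the Gaussian and a constant.\<close>
    proof (intro mult_mono)
      have "R\<^sup>2 \<le> 2 * t + 2 * \<rho>\<^sup>2"
        using t sum_squares_bound[of "sqrt t" \<rho>] by (simp add: R_def power2_sum)
      then have "R\<^sup>2 / (M * (\<Lambda> * t)) \<le> (2 * t + 2 * \<rho>\<^sup>2) / (M * (\<Lambda> * t))"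
        using M \<Lambda> t by (intro divide_right_mono) auto
      also have "\<dots> = M / 2 + M / 2 * \<rho>\<^sup>2 / t"
        using M t by (simp add: \<Lambda>_def field_simps)
      finally show "exp (R\<^sup>2 / (M * (\<Lambda> * t))) \<le> exp (M / 2 + M / 2 * \<rho>\<^sup>2 / t)" by simp
      show "V x (sqrt (\<Lambda> * t)) \<le> D * exp (\<Lambda> / M) * V x (sqrt t)"
        using D(2)[of "sqrt (\<Lambda> * t)" t x] \<Lambda> t by simp
    qed (use D V in \<open>auto simp: cc_volume_def\<close>)
    also have "\<dots> = K * exp (M / 2 * \<rho>\<^sup>2 / t) * V x (sqrt t)"
      by (simp add: K_def exp_add mult_ac)
    finally have "1 / V x (sqrt t) \<le> K * exp (M / 2 * \<rho>\<^sup>2 / t) / V y (sqrt t)"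
      using V by (simp add: field_simps)
    then have "1 / V x (sqrt t) * gaussian M (d x y) t \<le> K * exp (M / 2 * \<rho>\<^sup>2 / t) / V y (sqrt t) * gaussian M (d x y) t"
      by (intro mult_right_mono gaussian_nonneg)
    also have "exp (M / 2 * \<rho>\<^sup>2 / t) * gaussian M (d x y) t = gaussian (M/2) (d y x) t"
      by (simp add: gaussian_eq dr_commute[of y x] \<rho>_def flip: exp_add)
    then have "K * exp (M / 2 * \<rho>\<^sup>2 / t) / V y (sqrt t) * gaussian M (d x y) t = K * (gaussian (M/2) (d y x) t / V y (sqrt t))"
      by (metis (no_types, opaque_lifting) mult.assoc times_divide_eq_left times_divide_eq_right)
    also have "\<dots> \<le> K * (E * p y x (t / (M * (M/2))))"
      using K by (intro mult_left_mono E t) auto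
    finally have "C * (1 / V x (sqrt t) * gaussian M (d x y) t) \<le> C * (K * (E * p y x (t / (M * (M/2)))))"
      using C(1) by (intro mult_left_mono) auto
    moreover have "t / (M * (M/2)) = 2 * \<kappa> * t" using M by (simp add: \<kappa>_def)
    ultimately show ?thesis using C(2)[OF t, of x y] by (simp add: mult_ac)
  qed
  then show ?thesis using C K E by (intro exI[of _ "C * K * E"]) auto
qed

text \<open>Split the Gaussian into two halves exp(-r). One absorbs the squared distance, a multiple
  of t r, by r exp(-r) \<le> 1; the other returns to the kernel by \<open>gaussian_le_p\<close> for
  \<theta> = M / 2, whence the time 2 \<kappa> t.\<close>

lemma p_dist_sq: "\<exists>C>0. \<forall>x y t. t > 0 \<longrightarrow> (dr x y)\<^sup>2 * p x y t \<le> C * t * p x y (2 * \<kappa> * t)"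
proof -
  obtain C where C: "C > 0" "\<And>x y t. t > 0 \<Longrightarrow> p x y t \<le> C / V x (sqrt t) * gaussian M (d x y) t"
    using p_upper by blast
  obtain E where E: "E > 0" "\<And>x y t. t > 0 \<Longrightarrow> gaussian (M/2) (d x y) t / V x (sqrt t) \<le> E * p x y (t / (M * (M/2)))"
    using gaussian_le_p[of "M/2"] M by auto
  have "(dr x y)\<^sup>2 * p x y t \<le> (2 / M * C * E) * t * p x y (2 * \<kappa> * t)" if t: "t > 0" for x y t
  proof -
    define r where "r = M / 2 * (dr x y)\<^sup>2 / t"
    have r: "r \<ge> 0" "(dr x y)\<^sup>2 = 2 / M * t * r" using M t by (auto simp: r_def)
    have V: "V x (sqrt t) > 0" using V_pos t by auto
    have gM: "gaussian M (d x y) t = exp (- r) * exp (- r)" and gM2: "gaussian (M/2) (d x y) t = exp (- r)"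
      by (simp_all add: gaussian_eq r_def flip: exp_add)
    have "r \<le> exp r" using exp_ge_add_one_self[of r] by linarith
    then have re: "r * exp (- r) \<le> 1" by (simp add: exp_minus field_simps)
    have "(dr x y)\<^sup>2 * p x y t \<le> (dr x y)\<^sup>2 * (C / V x (sqrt t) * gaussian M (d x y) t)"
      by (intro mult_left_mono C t) auto
    also have "\<dots> = 2 / M * t * C / V x (sqrt t) * (r * exp (- r)) * exp (- r)"
      by (simp add: r(2) gM)
    also have "\<dots> \<le> 2 / M * t * C / V x (sqrt t) * 1 * exp (- r)"
      using M t C V by (intro mult_right_mono mult_left_mono re) auto
    also have "\<dots> = 2 / M * t * C * (gaussian (M/2) (d x y) t / V x (sqrt t))" by (simp add: gM2)
    also have "\<dots> \<le> 2 / M * t * C * (E * p x y (t / (M * (M/2))))"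
      using M t C by (intro mult_left_mono E) auto
    also have "t / (M * (M/2)) = 2 * \<kappa> * t" using M by (simp add: \<kappa>_def)
    finally show ?thesis by (simp add: mult_ac)
  qed
  then show ?thesis using C E M by (intro exI[of _ "2 / M * C * E"]) auto
qed

end

section \<open>The weight of the Poisson kernel\<close>

text \<open>The inverse gamma density of shape s and scale z^2 / 4. The value 0 for t \<le> 0 allows
  integration over the whole line.\<close>

definition weight :: "real \<Rightarrow> real \<Rightarrow> real \<Rightarrow> real" where
  "weight s z t = (if t > 0 then 1 / (2 powr (2 * s) * Gamma s) * z powr (2 * s) *
     (exp (- z\<^sup>2 / (4 * t)) / t powr (1 + s)) else 0)"

text \<open>\<open>weight1\<close> and \<open>weight2\<close> are the first two z-derivatives,
  written as the weight times a factor: the logarithmic derivative 2s/z - z/(2t), then its square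
  plus its own derivative.\<close>

definition weight1 :: "real \<Rightarrow> real \<Rightarrow> real \<Rightarrow> real" where
  "weight1 s z t = weight s z t * (2 * s / z - z / (2 * t))"

definition weight2 :: "real \<Rightarrow> real \<Rightarrow> real \<Rightarrow> real" where
  "weight2 s z t = weight s z t * ((2 * s / z - z / (2 * t))\<^sup>2 - 2 * s / z\<^sup>2 - 1 / (2 * t))"

lemma weight_has_derivative:
  assumes z: "z > 0"
  shows "((\<lambda>z. weight s z t) has_real_derivative weight1 s z t) (at z)"
proof (cases "t > 0")
  case True
  have P: "((\<lambda>z. z powr (2 * s)) has_real_derivative 2 * s * z powr (2 * s - 1)) (at z)"
    using z by (rule has_real_derivative_powr)
  have p1: "z powr (2 * s - 1) = z powr (2 * s) / z" using z by (simp add: powr_diff)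
  define k where "k = 1 / (2 powr (2 * s) * Gamma s) / t powr (1 + s)"
  have w: "weight s z t = k * (z powr (2 * s) * exp (- z\<^sup>2 / (4 * t)))" for z
    using True by (simp add: weight_def k_def)
  have E: "((\<lambda>z. exp (- z\<^sup>2 / (4 * t))) has_real_derivative exp (- z\<^sup>2 / (4 * t)) * (- (z / (2 * t)))) (at z)"
    using True by (auto intro!: derivative_eq_intros simp: field_simps)
  show ?thesis
    unfolding weight1_def w
    by (rule DERIV_cong[OF DERIV_cmult[OF DERIV_mult[OF P E]]]) (simp only: p1, simp add: algebra_simps)
qed (simp add: weight1_def weight_def)

lemma weight1_has_derivative:
  assumes z: "z > 0"
  shows "((\<lambda>z. weight1 s z t) has_real_derivative weight2 s z t) (at z)"
proof (cases "t > 0")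
  case True
  have "((\<lambda>z. 2 * s / z - z / (2 * t)) has_real_derivative (- 2 * s / z\<^sup>2 - 1 / (2 * t))) (at z)"
    using z True by (auto intro!: derivative_eq_intros simp: power2_eq_square)
  from DERIV_mult[OF weight_has_derivative[OF z, of s t] this]
  have "((\<lambda>z. weight1 s z t) has_real_derivative
      weight1 s z t * (2 * s / z - z / (2 * t)) + (- 2 * s / z\<^sup>2 - 1 / (2 * t)) * weight s z t) (at z)"
    by (simp only: weight1_def[symmetric])
  then show ?thesis
    by (rule DERIV_cong) (simp add: weight1_def weight2_def power2_eq_square algebra_simps)
qed (simp add: weight1_def weight2_def weight_def)

lemma weight_has_derivative_time:
  assumes t: "t > 0"
  shows "(weight s z has_real_derivative weight s z t * (z\<^sup>2 / (4 * t\<^sup>2) - (1 + s) / t)) (at t)"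
proof -
  define c where "c = 1 / (2 powr (2 * s) * Gamma s) * z powr (2 * s)"
  have P: "((\<lambda>t. t powr (1 + s)) has_real_derivative (1 + s) * t powr (1 + s - 1)) (at t)"
    using t by (rule has_real_derivative_powr)
  have p1: "t powr (1 + s - 1) = t powr (1 + s) / t" using t by (simp add: powr_add)
  have E: "((\<lambda>t. exp (- z\<^sup>2 / (4 * t))) has_real_derivative exp (- z\<^sup>2 / (4 * t)) * (z\<^sup>2 / (4 * t\<^sup>2))) (at t)"
    using t by (auto intro!: derivative_eq_intros simp: power2_eq_square field_simps)
  have "((\<lambda>t. c * (exp (- z\<^sup>2 / (4 * t)) / t powr (1 + s))) has_real_derivative
      c * ((exp (- z\<^sup>2 / (4 * t)) * (z\<^sup>2 / (4 * t\<^sup>2)) * t powr (1 + s) - exp (- z\<^sup>2 / (4 * t)) * ((1 + s) * t powr (1 + s - 1)))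
        / (t powr (1 + s) * t powr (1 + s)))) (at t)"
    using t by (intro DERIV_cmult DERIV_divide E P) auto
  also have "c * ((exp (- z\<^sup>2 / (4 * t)) * (z\<^sup>2 / (4 * t\<^sup>2)) * t powr (1 + s) - exp (- z\<^sup>2 / (4 * t)) * ((1 + s) * t powr (1 + s - 1)))
        / (t powr (1 + s) * t powr (1 + s))) = weight s z t * (z\<^sup>2 / (4 * t\<^sup>2) - (1 + s) / t)"
  proof -
    have alg: "c * ((e * q * T - e * ((1 + s) * (T / t))) / (T * T)) = c * (e / T) * (q - (1 + s) / t)"
      if "T > 0" for e q T :: real
      using that t by (simp add: field_simps)
    have w: "weight s z t = c * (exp (- z\<^sup>2 / (4 * t)) / t powr (1 + s))" using t by (simp add: weight_def c_def)
    show ?thesis unfolding p1 w by (rule alg) (use t in simp)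
  qed
  finally show ?thesis
    by (rule has_field_derivative_transform_within_open[where S = "{0<..}"])
       (use t in \<open>auto simp: weight_def c_def\<close>)
qed

text \<open>The right-hand side is the time derivative of the weight.\<close>

lemma weight_bessel:
  assumes "z > 0" "t > 0"
  shows "weight2 s z t + (1 - 2 * s) / z * weight1 s z t = weight s z t * (z\<^sup>2 / (4 * t\<^sup>2) - (1 + s) / t)"
proof -
  have "(2 * s / z - z / (2 * t))\<^sup>2 - 2 * s / z\<^sup>2 - 1 / (2 * t) + (1 - 2 * s) / z * (2 * s / z - z / (2 * t))
      = z\<^sup>2 / (4 * t\<^sup>2) - (1 + s) / t"
    using assms by (simp add: field_simps power2_eq_square)
  then show ?thesis unfolding weight1_def weight2_def
    by (metis (no_types, opaque_lifting) distrib_left mult.left_commute)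
qed

lemma weight_nonneg: "s > 0 \<Longrightarrow> weight s z t \<ge> 0"
  by (simp add: weight_def)

text \<open>On a strip of z away from 0 and infinity, each differentiation in z costs at most a
  constant times 1 + 1/t, hence the square; the exponential is largest at z = \<zeta>.\<close>

lemma weight_bounds:
  assumes \<zeta>: "0 < \<zeta>" and s: "s > 0"
  shows "\<exists>C>0. \<forall>z t. \<zeta> < z \<longrightarrow> z < Z \<longrightarrow> t > 0 \<longrightarrow>
    \<bar>weight s z t\<bar> \<le> C * ((1 + 1 / t)\<^sup>2 * (exp (- \<zeta>\<^sup>2 / (4 * t)) / t powr (1 + s))) \<and>
    \<bar>weight1 s z t\<bar> \<le> C * ((1 + 1 / t)\<^sup>2 * (exp (- \<zeta>\<^sup>2 / (4 * t)) / t powr (1 + s))) \<and>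
    \<bar>weight2 s z t\<bar> \<le> C * ((1 + 1 / t)\<^sup>2 * (exp (- \<zeta>\<^sup>2 / (4 * t)) / t powr (1 + s)))"
proof -
  define c where "c = 1 / (2 powr (2 * s) * Gamma s) * (\<bar>Z\<bar> + 1) powr (2 * s)"
  have c: "c > 0" using s by (simp add: c_def Gamma_real_pos)
  define A where "A = 2 * s / \<zeta> + \<bar>Z\<bar>"
  have A: "A > 0" using s \<zeta> by (simp add: A_def add_pos_nonneg)
  define B where "B = 1 + A + (A\<^sup>2 + 2 * s / \<zeta>\<^sup>2 + 1)"
  have B: "B \<ge> 1" "A \<le> B" "A\<^sup>2 + 2 * s / \<zeta>\<^sup>2 + 1 \<le> B" using A s \<zeta> by (auto simp: B_def)
  have "\<bar>weight s z t\<bar> \<le> (c * B) * ((1 + 1 / t)\<^sup>2 * e) \<and> \<bar>weight1 s z t\<bar> \<le> (c * B) * ((1 + 1 / t)\<^sup>2 * e)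
      \<and> \<bar>weight2 s z t\<bar> \<le> (c * B) * ((1 + 1 / t)\<^sup>2 * e)"
    if z: "\<zeta> < z" "z < Z" and t: "t > 0" and e: "e = exp (- \<zeta>\<^sup>2 / (4 * t)) / t powr (1 + s)" for z t e
  proof -
    have z0: "z > 0" using z \<zeta> by simp
    define \<tau> where "\<tau> = 1 + 1 / t"
    have \<tau>: "\<tau> \<ge> 1" "1 / t \<le> \<tau>" using t by (auto simp: \<tau>_def)
    have \<tau>2: "\<tau> \<le> \<tau>\<^sup>2" "1 \<le> \<tau>\<^sup>2" using \<tau> by (auto simp: power2_eq_square intro: mult_ge1_I)
    have e0: "e \<ge> 0" by (simp add: e)
    have w: "\<bar>weight s z t\<bar> \<le> c * e"
    proof -
      have "\<zeta>\<^sup>2 \<le> z\<^sup>2" using z \<zeta> by (intro power_mono) auto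
      then have 1: "exp (- z\<^sup>2 / (4 * t)) \<le> exp (- \<zeta>\<^sup>2 / (4 * t))" using t by (simp add: divide_right_mono)
      have 2: "z powr (2 * s) \<le> (\<bar>Z\<bar> + 1) powr (2 * s)" using z z0 s by (intro powr_mono2) auto
      have "weight s z t \<le> c * e"
        using t s 1 2 unfolding weight_def c_def e
        by (auto intro!: mult_mono divide_right_mono simp: Gamma_real_pos less_imp_le)
      then show ?thesis using weight_nonneg[OF s, of z t] by simp
    qed
    define g where "g = 2 * s / z - z / (2 * t)"
    have g: "\<bar>g\<bar> \<le> A * \<tau>"
    proof -
      have "\<bar>g\<bar> \<le> 2 * s / z + z / (2 * t)" unfolding g_def using z0 t s by (simp add: abs_le_iff)
      also have "\<dots> \<le> 2 * s / \<zeta> * \<tau> + \<bar>Z\<bar> * \<tau>"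
      proof (rule add_mono)
        have "2 * s / z \<le> 2 * s / \<zeta>" using z \<zeta> s by (intro divide_left_mono) auto
        also have "\<dots> \<le> 2 * s / \<zeta> * \<tau>" using \<tau> s \<zeta> mult_left_mono[of 1 \<tau> "2 * s / \<zeta>"] by simp
        finally show "2 * s / z \<le> 2 * s / \<zeta> * \<tau>" .
        have "z / (2 * t) \<le> z * (1 / t)" using z0 t by (simp add: field_simps)
        also have "\<dots> \<le> \<bar>Z\<bar> * \<tau>" using z z0 \<tau> t by (intro mult_mono) auto
        finally show "z / (2 * t) \<le> \<bar>Z\<bar> * \<tau>" .
      qed
      finally show ?thesis by (simp add: A_def distrib_right)
    qed
    have "\<bar>weight s z t\<bar> \<le> c * e * (B * \<tau>\<^sup>2)"
    proof -
      have "1 \<le> B * \<tau>\<^sup>2" using B(1) \<tau>2(2) by (rule mult_ge1_I)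
      then have "c * e * 1 \<le> c * e * (B * \<tau>\<^sup>2)" using c e0 by (intro mult_left_mono) auto
      then show ?thesis using w by simp
    qed
    moreover have "\<bar>weight1 s z t\<bar> \<le> c * e * (B * \<tau>\<^sup>2)"
    proof -
      have "\<bar>g\<bar> \<le> B * \<tau>\<^sup>2" using g mult_mono[OF B(2) \<tau>2(1)] B \<tau> by simp
      then show ?thesis unfolding weight1_def g_def[symmetric] abs_mult
        using w by (intro mult_mono) (use c e0 in auto)
    qed
    moreover have "\<bar>weight2 s z t\<bar> \<le> c * e * (B * \<tau>\<^sup>2)"
    proof -
      have "g\<^sup>2 \<le> (A * \<tau>)\<^sup>2" using g A \<tau> by (intro abs_le_square_iff[THEN iffD1]) (simp add: abs_mult)
      moreover have "2 * s / z\<^sup>2 \<le> 2 * s / \<zeta>\<^sup>2 * \<tau>\<^sup>2"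
      proof -
        have "2 * s / z\<^sup>2 \<le> 2 * s / \<zeta>\<^sup>2" using z \<zeta> s by (intro divide_left_mono power_mono) auto
        also have "\<dots> \<le> 2 * s / \<zeta>\<^sup>2 * \<tau>\<^sup>2" using \<tau>2 s \<zeta> mult_left_mono[of 1 "\<tau>\<^sup>2" "2 * s / \<zeta>\<^sup>2"] by simp
        finally show ?thesis .
      qed
      moreover have "1 / (2 * t) \<le> \<tau>\<^sup>2"
      proof -
        have "1 / (2 * t) \<le> 1 / t" using t by (intro divide_left_mono) auto
        then show ?thesis using \<tau>(2) \<tau>2(1) by linarith
      qed
      moreover have "0 \<le> 2 * s / z\<^sup>2" "0 \<le> 1 / (2 * t)" "0 \<le> g\<^sup>2" using s t by auto
      ultimately have "\<bar>g\<^sup>2 - 2 * s / z\<^sup>2 - 1 / (2 * t)\<bar> \<le> (A\<^sup>2 + 2 * s / \<zeta>\<^sup>2 + 1) * \<tau>\<^sup>2"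
        unfolding distrib_right power_mult_distrib by linarith
      also have "\<dots> \<le> B * \<tau>\<^sup>2" using B(3) by (intro mult_right_mono) auto
      finally show ?thesis unfolding weight2_def g_def[symmetric] abs_mult
        using w by (intro mult_mono) (use c e0 in auto)
    qed
    ultimately show ?thesis by (simp add: \<tau>_def mult_ac)
  qed
  then show ?thesis using c B by (intro exI[of _ "c * B"]) auto
qed

lemma weight_measurable [measurable]: "weight s z \<in> borel_measurable borel"
  unfolding weight_def[abs_def] by measurable

text \<open>The constant in front of the Poisson kernel is exactly the normalization that makes the
  weight a probability density.\<close>

lemma weight_integral:
  assumes s: "s > 0" and z: "z > 0"
  shows "integrable lborel (weight s z)" "(\<integral>t. weight s z t \<partial>lborel) = 1"
proof -
  define c where "c = z\<^sup>2 / 4"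
  have c: "c > 0" using z by (simp add: c_def)
  define k where "k = 1 / (2 powr (2 * s) * Gamma s) * z powr (2 * s)"
  have eq: "weight s z = (\<lambda>t. k * (indicator {0<..} t *\<^sub>R (exp (- c / t) / t powr (1 + s))))"
    by (auto simp: weight_def k_def c_def fun_eq_iff indicator_def)
  note G = inverse_gamma_integral[OF c s, unfolded set_integrable_def set_lebesgue_integral_def]
  show "integrable lborel (weight s z)" unfolding eq by (intro integrable_mult_right G)
  have "c powr s = z powr (2 * s) / 2 powr (2 * s)"
  proof -
    have "c = (z / 2) powr 2" using z by (simp add: c_def power2_eq_square)
    then have "c powr s = (z / 2) powr (2 * s)" by (simp add: powr_powr)
    then show ?thesis using z by (simp add: powr_divide)
  qed
  then have "k * (Gamma s / c powr s) = 1"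
    using z s by (simp add: k_def Gamma_real_pos less_imp_neq[symmetric])
  then show "(\<integral>t. weight s z t \<partial>lborel) = 1"
    unfolding eq Bochner_Integration.integral_mult_right_zero G(2) .
qed

text \<open>Half of the exponent, \<epsilon> = \<zeta>^2 / 8, absorbs the polynomial in 1/t; the
  other half still gives a convergent inverse gamma integral.\<close>

lemma dominating_weight_integrable:
  fixes \<zeta> s :: real
  assumes \<zeta>: "\<zeta> > 0" and s: "s > 0"
  shows "set_integrable lborel {0<..} (\<lambda>t. (1 + 1 / t) ^ J * (exp (- \<zeta>\<^sup>2 / (4 * t)) / t powr (1 + s)))"
proof -
  define \<epsilon> where "\<epsilon> = \<zeta>\<^sup>2 / 8"
  have \<epsilon>: "\<epsilon> > 0" using \<zeta> by (simp add: \<epsilon>_def)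
  obtain C where C: "C > 0" "\<And>r. r \<ge> 0 \<Longrightarrow> (1 + r) ^ J \<le> C * exp (\<epsilon> * r)"
    using poly_exp_bound[OF \<epsilon>] by blast
  note G = inverse_gamma_integral(1)[OF \<epsilon> s, unfolded set_integrable_def]
  show ?thesis unfolding set_integrable_def
  proof (rule integrable_dominated[OF integrable_mult_right[OF G, of C]])
    fix t :: real
    show "\<bar>indicator {0<..} t *\<^sub>R ((1 + 1 / t) ^ J * (exp (- \<zeta>\<^sup>2 / (4 * t)) / t powr (1 + s)))\<bar>
      \<le> C * (indicator {0<..} t *\<^sub>R (exp (- \<epsilon> / t) / t powr (1 + s)))"
    proof (cases "t > 0")
      case True
      have "(1 + 1 / t) ^ J * exp (- \<zeta>\<^sup>2 / (4 * t)) \<le> C * exp (\<epsilon> * (1 / t)) * exp (- \<zeta>\<^sup>2 / (4 * t))"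
        using True by (intro mult_right_mono C) auto
      also have "\<dots> = C * exp (- \<epsilon> / t)"
        using True by (simp add: \<epsilon>_def mult.assoc flip: exp_add)
      finally have "(1 + 1 / t) ^ J * exp (- \<zeta>\<^sup>2 / (4 * t)) / t powr (1 + s) \<le> C * exp (- \<epsilon> / t) / t powr (1 + s)"
        by (rule divide_right_mono) simp
      then show ?thesis using True by simp
    qed simp
  qed measurable
qed

section \<open>Schwartz functions\<close>

text \<open>Sum over shells k \<le> |x| < k + 1, each enlarged to the full ball of radius k + 1; the
  exponent DIM + 2 leaves a multiple of the series of 1 / (k + 1)^2.\<close>

lemma integrable_inverse_power_norm:
  "integrable lborel (\<lambda>x :: 'a::euclidean_space. 1 / (1 + norm x) ^ (DIM('a) + 2))"
proof (rule integrableI_nonneg)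
  let ?m = "DIM('a) + 2"
  define f where "f k x = ennreal (1 / (1 + real k) ^ ?m) * indicator (ball (0::'a) (real k + 1)) x" for k x
  show "(\<lambda>x :: 'a. 1 / (1 + norm x) ^ ?m) \<in> borel_measurable lborel" by measurable
  have "(\<integral>\<^sup>+x. ennreal (1 / (1 + norm (x :: 'a)) ^ ?m) \<partial>lborel) \<le> (\<integral>\<^sup>+x. (\<Sum>k. f k x) \<partial>lborel)"
  proof (rule nn_integral_mono)
    fix x :: 'a
    define k where "k = nat \<lfloor>norm x\<rfloor>"
    have k: "real k \<le> norm x" "norm x < real k + 1" unfolding k_def by (auto simp: of_nat_nat)
    have "ennreal (1 / (1 + norm x) ^ ?m) \<le> f k x"
    proof -
      have "(1 + real k) ^ ?m \<le> (1 + norm x) ^ ?m" using k by (intro power_mono) auto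
      then have "1 / (1 + norm x) ^ ?m \<le> 1 / (1 + real k) ^ ?m" by (intro divide_left_mono) (auto intro!: mult_pos_pos zero_less_power simp: add_pos_nonneg)
      then show ?thesis using k by (simp add: f_def ennreal_leI)
    qed
    also have "f k x \<le> (\<Sum>k. f k x)"
      using sum_le_suminf[of "\<lambda>k. f k x" "{k}"] by simp
    finally show "ennreal (1 / (1 + norm x) ^ ?m) \<le> (\<Sum>k. f k x)" .
  qed
  also have "\<dots> = (\<Sum>k. \<integral>\<^sup>+x. f k x \<partial>lborel)"
  proof (rule nn_integral_suminf)
    show "f k \<in> borel_measurable lborel" for k
    proof -
      have [measurable]: "ball (0::'a) (real k + 1) \<in> sets borel" by simp
      show ?thesis unfolding f_def by measurable
    qed
  qed
  also have "\<dots> = (\<Sum>k. ennreal (unit_ball_vol (real DIM('a)) * inverse (real (Suc k) ^ 2)))"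
  proof (rule suminf_cong)
    fix k
    have "(\<integral>\<^sup>+x. f k x \<partial>lborel) = ennreal (1 / (1 + real k) ^ ?m) * ennreal (unit_ball_vol (real DIM('a)) * (real k + 1) ^ DIM('a))"
      unfolding f_def by (simp add: nn_integral_cmult_indicator emeasure_ball)
    also have "\<dots> = ennreal (1 / (1 + real k) ^ ?m * (unit_ball_vol (real DIM('a)) * (real k + 1) ^ DIM('a)))"
      by (rule ennreal_mult[symmetric]) auto
    also have "1 / (1 + real k) ^ ?m * (unit_ball_vol (real DIM('a)) * (real k + 1) ^ DIM('a))
        = unit_ball_vol (real DIM('a)) * inverse (real (Suc k) ^ 2)"
    proof -
      have "1 / q ^ ?m * (v * q ^ DIM('a)) = v * inverse (q ^ 2)" if "q > 0" for q v :: real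
        using that by (simp add: power_add divide_inverse power2_eq_square)
      from this[of "1 + real k"] show ?thesis by (simp add: add.commute)
    qed
    finally show "(\<integral>\<^sup>+x. f k x \<partial>lborel) = ennreal (unit_ball_vol (real DIM('a)) * inverse (real (Suc k) ^ 2))" .
  qed
  also have "\<dots> < \<infinity>"
  proof -
    have "summable (\<lambda>k. inverse (real (Suc k) ^ 2))"
      using inverse_power_summable[of 2, where 'a = real] by (subst summable_Suc_iff) simp
    then have "summable (\<lambda>k. unit_ball_vol (real DIM('a)) * inverse (real (Suc k) ^ 2))" by (rule summable_mult)
    then show ?thesis by (subst suminf_ennreal2) auto
  qed
  finally show "(\<integral>\<^sup>+x. ennreal (1 / (1 + norm (x :: 'a)) ^ ?m) \<partial>lborel) < \<infinity>" .
qed auto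

text \<open>The seminorms with weights of order 0 and m suffice, because (1 + r)^m \<le> 2^m (1 +
  r^m).\<close>

lemma schwartz_decay:
  fixes u :: "'a::euclidean_space \<Rightarrow> real"
  assumes u: "schwartz u" and bs: "set bs \<subseteq> Basis"
  shows "\<exists>C\<ge>0. \<forall>x. \<bar>pderivs bs u x\<bar> \<le> C / (1 + norm x) ^ m"
proof -
  have "bs \<in> lists Basis" using bs by (auto simp: in_lists_conv_set)
  then have bd: "bounded (range (\<lambda>x. norm x ^ k * pderivs bs u x))" for k :: nat
    using u unfolding schwartz_def by blast
  obtain A where A: "\<And>x. \<bar>pderivs bs u x\<bar> \<le> A" using bd[of 0] by (auto simp: bounded_iff)
  obtain B where B: "\<And>x. \<bar>norm x ^ m * pderivs bs u x\<bar> \<le> B" using bd[of m] by (auto simp: bounded_iff)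
  define C where "C = 2 ^ m * (A + B)"
  have A0: "A \<ge> 0" and B0: "B \<ge> 0" using A[of 0] B[of 0] by linarith+
  have "\<bar>pderivs bs u x\<bar> \<le> C / (1 + norm x) ^ m" for x
  proof -
    have "(1 + norm x) ^ m \<le> 2 ^ m * (1 + norm x ^ m)"
    proof -
      have "(1 + norm x) ^ m \<le> (2 * max 1 (norm x)) ^ m" by (intro power_mono) auto
      also have "\<dots> = 2 ^ m * max 1 (norm x) ^ m" by (rule power_mult_distrib)
      also have "\<dots> \<le> 2 ^ m * (1 + norm x ^ m)" by (intro mult_left_mono) (auto simp: max_def)
      finally show ?thesis .
    qed
    then have "(1 + norm x) ^ m * \<bar>pderivs bs u x\<bar> \<le> 2 ^ m * (1 + norm x ^ m) * \<bar>pderivs bs u x\<bar>"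
      by (rule mult_right_mono) simp
    also have "\<dots> = 2 ^ m * (\<bar>pderivs bs u x\<bar> + \<bar>norm x ^ m * pderivs bs u x\<bar>)"
      by (simp add: abs_mult algebra_simps)
    also have "\<dots> \<le> C" unfolding C_def by (intro mult_left_mono add_mono A B) simp
    finally show ?thesis by (simp add: pos_le_divide_eq add_pos_nonneg mult.commute)
  qed
  moreover have "C \<ge> 0" using A0 B0 by (simp add: C_def)
  ultimately show ?thesis by blast
qed

text \<open>Two bounds with one majorant: the crude one serves large times, the one with the squared
  distance serves small times. The form h x + h y lets the kernel be integrated out in whichever
  variable h does not contain.\<close>

lemma schwartz_increment:
  fixes u :: "'a::euclidean_space \<Rightarrow> real"
  assumes u: "schwartz u"
  shows "\<exists>h. integrable lborel h \<and> (\<forall>x. 0 \<le> h x) \<and> (\<forall>x. (u x)\<^sup>2 \<le> h x) \<and>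
    (\<forall>x y. (u x - u y)\<^sup>2 \<le> h x + h y) \<and> (\<forall>x y. (u x - u y)\<^sup>2 \<le> (norm (x - y))\<^sup>2 * (h x + h y))"
proof -
  define m where "m = DIM('a) + 2"
  obtain C where C: "C \<ge> 0" "\<And>x. \<bar>u x\<bar> \<le> C / (1 + norm x) ^ m"
    using schwartz_decay[OF u, of "[]" m] by (auto simp: pderivs_def)
  have "\<exists>D\<ge>0. \<forall>x. \<bar>frechet_derivative u (at x) b\<bar> \<le> D / (1 + norm x) ^ m" if "b \<in> Basis" for b
    using schwartz_decay[OF u, of "[b]" m] that by (auto simp: pderivs_def)
  then obtain D where D: "\<And>b. b \<in> Basis \<Longrightarrow> D b \<ge> 0"
    "\<And>b x. b \<in> Basis \<Longrightarrow> \<bar>frechet_derivative u (at x) b\<bar> \<le> D b / (1 + norm x) ^ m" by metis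
  define E where "E = (\<Sum>b\<in>Basis. D b)"
  have E: "E \<ge> 0" unfolding E_def by (intro sum_nonneg D)
  have us: "smooth_on u UNIV" using u by (simp add: schwartz_def)
  note du = smooth_on_has_derivative[OF open_UNIV us UNIV_I]
  define \<rho> where "\<rho> x = 1 / (1 + norm x) ^ m" for x :: 'a
  have r: "0 < \<rho> x" "\<rho> x \<le> 1" for x
    by (auto simp: \<rho>_def add_pos_nonneg divide_le_eq_1 one_le_power)
  have r2: "(a * \<rho> x)\<^sup>2 \<le> a\<^sup>2 * \<rho> x" for a x
  proof -
    have "(\<rho> x)\<^sup>2 \<le> \<rho> x" using r[of x] by (simp add: power2_eq_square mult_left_le_one_le)
    then show ?thesis by (simp add: power_mult_distrib mult_left_mono)
  qed
  have uC: "\<bar>u x\<bar> \<le> C * \<rho> x" for x using C(2)[of x] by (simp add: \<rho>_def)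
  define K where "K = 2 * C\<^sup>2 + (E * 2 ^ m)\<^sup>2"
  have K: "C\<^sup>2 \<le> K" "2 * C\<^sup>2 \<le> K" "(E * 2 ^ m)\<^sup>2 \<le> K" "K \<ge> 0" by (auto simp: K_def)
  define h where "h x = K * \<rho> x" for x
  have h0: "h x \<ge> 0" for x using K r[of x] by (simp add: h_def)
  have u2: "(u x)\<^sup>2 \<le> C\<^sup>2 * \<rho> x" for x
  proof -
    have "(u x)\<^sup>2 \<le> (C * \<rho> x)\<^sup>2" using uC[of x] C r[of x] by (intro abs_le_square_iff[THEN iffD1]) (auto simp: abs_mult)
    then show ?thesis using r2[of C x] by linarith
  qed
  have uh: "(u x)\<^sup>2 \<le> h x" for x
    unfolding h_def using u2[of x] mult_right_mono[OF K(1) less_imp_le[OF r(1)[of x]]] by (rule order_trans)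
  have uu: "(u x - u y)\<^sup>2 \<le> h x + h y" for x y
  proof -
    have "(u x - u y)\<^sup>2 \<le> 2 * (u x)\<^sup>2 + 2 * (u y)\<^sup>2"
      using zero_le_power2[of "u x + u y"] by (simp add: power2_eq_square algebra_simps)
    also have "\<dots> \<le> 2 * (C\<^sup>2 * \<rho> x) + 2 * (C\<^sup>2 * \<rho> y)" using u2[of x] u2[of y] by linarith
    also have "\<dots> \<le> h x + h y"
      unfolding h_def using mult_right_mono[OF K(2) less_imp_le[OF r(1)[of x]]]
        mult_right_mono[OF K(2) less_imp_le[OF r(1)[of y]]] by linarith
    finally show ?thesis .
  qed
  have ud: "(u x - u y)\<^sup>2 \<le> (norm (x - y))\<^sup>2 * (h x + h y)" for x y
  proof (cases "norm (x - y) \<ge> 1")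
    case True
    then have "1 \<le> (norm (x - y))\<^sup>2" by (simp add: one_le_power)
    then have "1 * (h x + h y) \<le> (norm (x - y))\<^sup>2 * (h x + h y)"
      using h0[of x] h0[of y] by (intro mult_right_mono) auto
    then show ?thesis using uu[of x y] by simp
  next
    case False
    define v where "v = y - x"
    have "DERIV (\<lambda>t. u (x + t *\<^sub>R v)) t :> frechet_derivative u (at (x + t *\<^sub>R v)) v" for t
      by (rule has_derivative_along_line[OF du])
    from MVT2[OF zero_less_one this] obtain t where t: "0 < t" "t < 1"
      "u (x + 1 *\<^sub>R v) - u (x + 0 *\<^sub>R v) = (1 - 0) * frechet_derivative u (at (x + t *\<^sub>R v)) v" by blast
    define \<xi> where "\<xi> = x + t *\<^sub>R v"
    have eq: "u y - u x = frechet_derivative u (at \<xi>) v" using t(3) by (simp add: v_def \<xi>_def)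
    have nv: "norm v < 1" using False by (simp add: v_def norm_minus_commute)
    have "norm (t *\<^sub>R v) \<le> norm v" using t by (simp add: mult_left_le_one_le)
    \<comment> \<open>The intermediate point is within 1 of x, so decay at \<xi> becomes decay at x
      up to the factor 2^m.\<close>
    then have "norm x \<le> norm \<xi> + 1"
      using norm_triangle_ineq4[of \<xi> "t *\<^sub>R v"] nv by (simp add: \<xi>_def)
    then have "1 + norm x \<le> 2 + 2 * norm \<xi>" using norm_ge_zero[of \<xi>] by linarith
    then have "1 + norm x \<le> 2 * (1 + norm \<xi>)" by simp
    then have "(1 + norm x) ^ m \<le> (2 * (1 + norm \<xi>)) ^ m" by (intro power_mono) auto
    then have le: "(1 + norm x) ^ m \<le> 2 ^ m * (1 + norm \<xi>) ^ m" by (simp only: power_mult_distrib)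
    have alg: "1 / a \<le> c * (1 / b)" if "b \<le> c * a" "a > 0" "b > 0" for a b c :: real
      using that by (simp add: field_simps)
    have rx: "\<rho> \<xi> \<le> 2 ^ m * \<rho> x"
      unfolding \<rho>_def by (rule alg[OF le]) (simp_all add: add_pos_nonneg)
    have "\<bar>u y - u x\<bar> \<le> norm v * (\<Sum>b\<in>Basis. \<bar>frechet_derivative u (at \<xi>) b\<bar>)"
      unfolding eq by (rule functional_bound[OF has_derivative_linear[OF du]])
    also have "\<dots> \<le> norm v * (\<Sum>b\<in>Basis. D b * \<rho> \<xi>)"
      using D(2)[of _ \<xi>] by (intro mult_left_mono sum_mono) (auto simp: \<rho>_def)
    also have "\<dots> = norm v * (E * \<rho> \<xi>)" by (simp add: E_def sum_distrib_right)
    also have "\<dots> \<le> norm v * (E * (2 ^ m * \<rho> x))" by (intro mult_left_mono rx E) auto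
    finally have "\<bar>u x - u y\<bar> \<le> norm v * (E * 2 ^ m * \<rho> x)" by (simp add: mult.assoc abs_minus_commute)
    then have "(u x - u y)\<^sup>2 \<le> (norm v * (E * 2 ^ m * \<rho> x))\<^sup>2"
      using E r[of x] by (intro abs_le_square_iff[THEN iffD1]) (simp add: abs_mult)
    also have "\<dots> \<le> (norm v)\<^sup>2 * ((E * 2 ^ m)\<^sup>2 * \<rho> x)"
      unfolding power_mult_distrib[of "norm v"] by (intro mult_left_mono r2) auto
    also have "\<dots> \<le> (norm v)\<^sup>2 * (h x + h y)"
    proof (rule mult_left_mono)
      show "(E * 2 ^ m)\<^sup>2 * \<rho> x \<le> h x + h y"
        using mult_right_mono[OF K(3) less_imp_le[OF r(1)[of x]]] h0[of y] unfolding h_def[of x] by linarith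
    qed simp
    finally show ?thesis by (simp add: v_def norm_minus_commute)
  qed
  have "integrable lborel h"
    unfolding h_def \<rho>_def m_def by (intro integrable_mult_right integrable_inverse_power_norm)
  then show ?thesis using h0 uh uu ud by blast
qed

text \<open>Nonnegativity of the variance, with m the mean.\<close>

lemma weighted_jensen:
  fixes \<rho> f :: "'w \<Rightarrow> real"
  assumes \<rho>: "integrable M \<rho>" "\<And>\<omega>. \<rho> \<omega> \<ge> 0" "(\<integral>\<omega>. \<rho> \<omega> \<partial>M) = 1"
    and f: "integrable M (\<lambda>\<omega>. \<rho> \<omega> * f \<omega>)" "integrable M (\<lambda>\<omega>. \<rho> \<omega> * (f \<omega>)\<^sup>2)"
  shows "(\<integral>\<omega>. \<rho> \<omega> * f \<omega> \<partial>M)\<^sup>2 \<le> (\<integral>\<omega>. \<rho> \<omega> * (f \<omega>)\<^sup>2 \<partial>M)"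
proof -
  define m where "m = (\<integral>\<omega>. \<rho> \<omega> * f \<omega> \<partial>M)"
  have "0 \<le> (\<integral>\<omega>. \<rho> \<omega> * (f \<omega> - m)\<^sup>2 \<partial>M)"
    by (intro integral_nonneg_AE AE_I2 mult_nonneg_nonneg \<rho>(2)) auto
  also have "\<dots> = (\<integral>\<omega>. \<rho> \<omega> * (f \<omega>)\<^sup>2 - 2 * m * (\<rho> \<omega> * f \<omega>) + m\<^sup>2 * \<rho> \<omega> \<partial>M)"
    by (intro Bochner_Integration.integral_cong refl) (simp add: power2_eq_square algebra_simps)
  also have "\<dots> = (\<integral>\<omega>. \<rho> \<omega> * (f \<omega>)\<^sup>2 \<partial>M) - 2 * m * m + m\<^sup>2"
    using \<rho> f by (simp add: m_def)
  finally show ?thesis by (simp add: m_def power2_eq_square)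
qed

text \<open>The order s/2 is chosen below s, where moments stop existing. Multiplying by t^(s/2)
  turns the density into an inverse gamma integral of shape s/2, and z^(2s) divided by z^s leaves
  z^s.\<close>

lemma weight_moment:
  assumes s: "s > 0"
  shows "\<exists>C\<ge>0. \<forall>z>0. integrable lborel (\<lambda>t. weight s z t * t powr (s / 2)) \<and>
     (\<integral>t. weight s z t * t powr (s / 2) \<partial>lborel) = C * z powr s"
proof -
  define C where "C = Gamma (s / 2) * 4 powr (s / 2) / (2 powr (2 * s) * Gamma s)"
  have "integrable lborel (\<lambda>t. weight s z t * t powr (s / 2)) \<and>
     (\<integral>t. weight s z t * t powr (s / 2) \<partial>lborel) = C * z powr s" if z: "z > 0" for z
  proof -
    define c where "c = z\<^sup>2 / 4"
    have c: "c > 0" using z by (simp add: c_def)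
    define k where "k = 1 / (2 powr (2 * s) * Gamma s) * z powr (2 * s)"
    have s2: "s / 2 > 0" using s by simp
    have eq: "(\<lambda>t. weight s z t * t powr (s / 2)) = (\<lambda>t. k * (indicator {0<..} t *\<^sub>R (exp (- c / t) / t powr (1 + s / 2))))"
    proof
      fix t
      have "t powr (s / 2) / t powr (1 + s) = 1 / t powr (1 + s / 2)" if "t > 0"
      proof -
        have "t powr (1 + s) = t powr (s / 2) * t powr (1 + s / 2)"
          by (subst powr_add[symmetric]) (rule arg_cong[where f = "(powr) t"], simp)
        then show ?thesis using that by simp
      qed
      then show "weight s z t * t powr (s / 2) = k * (indicator {0<..} t *\<^sub>R (exp (- c / t) / t powr (1 + s / 2)))"
      proof (cases "t > 0")
        case True
        then have "weight s z t * t powr (s / 2) = k * (exp (- c / t) * (t powr (s / 2) / t powr (1 + s)))"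
          by (simp add: weight_def k_def c_def)
        then show ?thesis using True \<open>t > 0 \<Longrightarrow> t powr (s / 2) / t powr (1 + s) = 1 / t powr (1 + s / 2)\<close> by simp
      qed (simp add: weight_def)
    qed
    note G = inverse_gamma_integral[OF c s2, unfolded set_integrable_def set_lebesgue_integral_def]
    have "c powr (s / 2) = z powr s / 4 powr (s / 2)"
    proof -
      have "c = z powr 2 / 4" using z by (simp add: c_def)
      then have "c powr (s / 2) = (z powr 2) powr (s / 2) / 4 powr (s / 2)"
        by (simp only: powr_divide)
      then show ?thesis by (simp add: powr_powr)
    qed
    moreover have "z powr (2 * s) = z powr s * z powr s" by (simp flip: powr_add)
    ultimately have "k * (Gamma (s / 2) / c powr (s / 2)) = C * z powr s"
      using z by (simp add: k_def C_def)
    then show ?thesis unfolding eq Bochner_Integration.integral_mult_right_zero G(2)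
      using integrable_mult_right[OF G(1)] by blast
  qed
  moreover have "C \<ge> 0" using s by (simp add: C_def Gamma_real_pos less_imp_le)
  ultimately show ?thesis by blast
qed

section \<open>The extension problem\<close>

context gaussian_heat_kernel
begin

section \<open>Regularity of the kernel\<close>

lemma p_smooth_off_pole: "smooth_on (\<lambda>(x, t). p x y t) (UNIV - {(y, 0)})"
proof -
  have "smooth_on (\<lambda>(x, t). p x y (t - 0)) (UNIV - {(y, 0)})"
    using kernel unfolding heat_kernel_def by blast
  then show ?thesis by simp
qed

lemma open_off_pole: "open (UNIV - {(y :: 'a, 0 :: real)})"
  by (simp add: open_delete)

lemma p_smooth: "smooth_on (\<lambda>\<xi>. p \<xi> y t) UNIV"
proof (cases "t > 0")
  case True
  have "C_k_on k (\<lambda>\<xi>. p \<xi> y t) UNIV" for k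
  proof -
    have "C_k_on k (\<lambda>(x, t). p x y t) (UNIV - {(y, 0)})" by (rule smooth_on_C_k[OF p_smooth_off_pole])
    from C_k_on_slice_fst[OF open_off_pole this, of t] show ?thesis using True by simp
  qed
  then show ?thesis by (simp add: smooth_on_def)
next
  case False
  then show ?thesis by (simp add: p_zero smooth_on_const)
qed

lemma p_continuous: "continuous_on {w. snd w > 0} (\<lambda>w. p (fst w) y (snd w))"
proof -
  have "continuous_on (UNIV - {(y, 0)}) (\<lambda>(x, t). p x y t)"
    by (rule C_k_on_continuous[OF smooth_on_C_k[OF p_smooth_off_pole, where k = 0]])
  then have "continuous_on (UNIV - {(y, 0)}) (\<lambda>w. p (fst w) y (snd w))" by (simp add: case_prod_unfold)
  then show ?thesis by (rule continuous_on_subset) auto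
qed

text \<open>No regularity in the pole y is assumed: the kernel is continuous in (x, t) for fixed y
  and, being integrable, measurable in y for fixed (x, t). This is a Caratheodory function, and the
  indicator disappears because p vanishes for t \<le> 0.\<close>

lemma p_measurable:
  assumes [measurable]: "f \<in> borel_measurable N" "g \<in> borel_measurable N" "h \<in> borel_measurable N"
  shows "(\<lambda>w. p (f w) (g w) (h w)) \<in> borel_measurable N"
proof -
  let ?S = "{a :: 'a \<times> real. snd a > 0}"
  have S: "open ?S" by (intro open_Collect_less continuous_intros)
  have "(\<lambda>(a, y). indicator ?S a * p (fst a) y (snd a)) \<in> borel_measurable (borel \<Otimes>\<^sub>M lborel)"
    by (rule caratheodory_measurable[OF S p_continuous])
       (rule borel_measurable_integrable[OF p_integrable])
  also have "(\<lambda>(a, y). indicator ?S a * p (fst a) y (snd a)) = (\<lambda>(a, y). p (fst a) y (snd a))"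
    by (auto simp: fun_eq_iff indicator_def p_zero)
  finally have m: "(\<lambda>(a, y). p (fst a) y (snd a)) \<in> borel_measurable (borel \<Otimes>\<^sub>M lborel)" .
  have "(\<lambda>w. ((f w, h w), g w)) \<in> N \<rightarrow>\<^sub>M borel \<Otimes>\<^sub>M lborel"
    by (intro measurable_Pair) (auto simp: borel_prod[symmetric])
  from measurable_compose[OF this m] show ?thesis by simp
qed

lemma p_has_derivative_time:
  assumes t: "t > 0"
  shows "(p x y has_real_derivative sub_laplacian X (\<lambda>\<xi>. p \<xi> y t) x) (at t)"
proof -
  have "((\<lambda>(x, t). p x y t) has_derivative frechet_derivative (\<lambda>(x, t). p x y t) (at (x, t))) (at (x, t))"
    by (rule smooth_on_has_derivative[OF open_off_pole p_smooth_off_pole]) (use t in auto)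
  from has_real_derivative_slice_snd[OF this]
  have "(p x y has_real_derivative frechet_derivative (\<lambda>(x, t). p x y t) (at (x, t)) (0, 1)) (at t)"
    by simp
  then show ?thesis
    using heat_kernel_equation[where X = X, OF smooth_fields kernel t, of x y] DERIV_imp_deriv by fastforce
qed

text \<open>The fundamental theorem of calculus in t needs a continuous derivative; the lifted form
  is continuous off the pole in all variables.\<close>

lemma continuous_on_p_time_derivative:
  "continuous_on {0<..} (\<lambda>t. sub_laplacian X (\<lambda>\<xi>. p \<xi> y t) x)"
proof -
  let ?q = "\<lambda>(x, t). p x y t" and ?W = "UNIV - {(y, 0)}"
  have q: "C_k_on 2 ?q ?W" by (rule smooth_on_C_k[OF p_smooth_off_pole])
  have "continuous_on {0<..} (\<lambda>t. lifted_laplacian X ?q (x, t))"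
    by (rule continuous_on_compose2[OF continuous_on_lifted_laplacian[OF smooth_fields open_off_pole q]])
       (auto intro!: continuous_intros)
  moreover have "lifted_laplacian X ?q (x, t) = sub_laplacian X (\<lambda>\<xi>. p \<xi> y t) x" if "t \<in> {0<..}" for t
    using sub_laplacian_slice[where X = X, OF smooth_fields open_off_pole q, of x t] that by simp
  ultimately show ?thesis by (rule continuous_on_eq)
qed

text \<open>The frame makes the bounds local in x, while the constants are uniform in y and t. The
  empty word covers p itself.\<close>

lemma p_derivative_bounds:
  "\<exists>\<delta>>0. \<exists>C>0. \<exists>J. \<forall>x\<in>ball x0 \<delta>. \<forall>y t. t > 0 \<longrightarrow>
     p x y t \<le> C * (1 + 1 / t) ^ J * p x y (\<kappa> * t) \<and>
     (\<forall>b\<in>Basis. \<bar>pd (\<lambda>\<xi>. p \<xi> y t) x b\<bar> \<le> C * (1 + 1 / t) ^ J * p x y (\<kappa> * t)) \<and>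
     (\<forall>b\<in>Basis. \<forall>c\<in>Basis. \<bar>pd2 (\<lambda>\<xi>. p \<xi> y t) x c b\<bar> \<le> C * (1 + 1 / t) ^ J * p x y (\<kappa> * t))"
proof -
  from hormander_derivative_bounds[where X = X and ?x0.0 = x0, OF smooth_fields hormander]
  obtain \<delta> C J where \<delta>: "\<delta> > 0" and C: "C \<ge> 0" and H: "\<forall>x\<in>ball x0 \<delta>. \<forall>f A. smooth_on f UNIV \<longrightarrow>
    (\<forall>js. length js \<le> J \<longrightarrow> \<bar>vf_word X js f x\<bar> \<le> A) \<longrightarrow>
    (\<forall>b\<in>Basis. \<bar>pd f x b\<bar> \<le> C * A) \<and> (\<forall>b\<in>Basis. \<forall>c\<in>Basis. \<bar>pd2 f x c b\<bar> \<le> C * A)"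
    by (elim exE conjE)
  obtain D where D: "D > 0" "\<And>js x y t. length js \<le> J \<Longrightarrow> t > 0 \<Longrightarrow>
     \<bar>vf_word X js (\<lambda>\<xi>. p \<xi> y t) x\<bar> \<le> D * (1 + 1 / t) ^ J * p x y (\<kappa> * t)"
    using vf_words_le_p[of J] by blast
  define K where "K = (C + 1) * D"
  have K: "K > 0" "C * D \<le> K" "D \<le> K" using C D(1) by (auto simp: K_def distrib_right add_nonneg_pos)
  have main: "p x y t \<le> K * (1 + 1 / t) ^ J * p x y (\<kappa> * t) \<and>
     (\<forall>b\<in>Basis. \<bar>pd (\<lambda>\<xi>. p \<xi> y t) x b\<bar> \<le> K * (1 + 1 / t) ^ J * p x y (\<kappa> * t)) \<and>
     (\<forall>b\<in>Basis. \<forall>c\<in>Basis. \<bar>pd2 (\<lambda>\<xi>. p \<xi> y t) x c b\<bar> \<le> K * (1 + 1 / t) ^ J * p x y (\<kappa> * t))"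
    if x: "x \<in> ball x0 \<delta>" and t: "t > 0" for x y t
  proof -
    define B where "B = (1 + 1 / t) ^ J * p x y (\<kappa> * t)"
    have B: "B \<ge> 0" using t by (simp add: B_def p_nonneg)
    have "\<forall>js. length js \<le> J \<longrightarrow> \<bar>vf_word X js (\<lambda>\<xi>. p \<xi> y t) x\<bar> \<le> D * B"
      using D(2)[OF _ t] by (simp add: B_def mult.assoc)
    note h = mp[OF mp[OF spec[OF spec[OF bspec[OF H x]]] p_smooth] this]
    have "C * (D * B) \<le> K * B" using mult_right_mono[OF K(2) B] by (simp add: mult.assoc)
    moreover have "p x y t \<le> D * B" using D(2)[of "[]" t y x] t by (simp add: B_def mult.assoc)
    moreover have "D * B \<le> K * B" by (rule mult_right_mono[OF K(3) B])
    ultimately have "p x y t \<le> K * B \<and>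
      (\<forall>b\<in>Basis. \<bar>pd (\<lambda>\<xi>. p \<xi> y t) x b\<bar> \<le> K * B) \<and>
      (\<forall>b\<in>Basis. \<forall>c\<in>Basis. \<bar>pd2 (\<lambda>\<xi>. p \<xi> y t) x c b\<bar> \<le> K * B)"
      using h by (meson order_trans)
    then show ?thesis by (simp add: B_def mult.assoc)
  qed
  show ?thesis
    by (rule exI[of _ \<delta>], rule conjI[OF \<delta>], rule exI[of _ K], rule conjI[OF K(1)], rule exI[of _ J])
       (intro ballI allI impI main)
qed

text \<open>Tonelli, integrating first in y, where the kernel has mass one. That the result does not
  contain x is what supplies the convergence of integrals in Pratt's theorem.\<close>

lemma kernel_weight_integral:
  fixes h :: "real \<Rightarrow> real"
  assumes h: "integrable lborel h" "\<And>t. h t \<ge> 0" "\<And>t. t \<le> 0 \<Longrightarrow> h t = 0" and c: "c > 0"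
  shows "integrable lborel (\<lambda>(y, t). h t * p x y (c * t))"
    and "(\<integral>w. (case w of (y, t) \<Rightarrow> h t * p x y (c * t)) \<partial>lborel) = (\<integral>t. h t \<partial>lborel)"
proof -
  note [measurable] = borel_measurable_integrable[OF h(1), simplified] p_measurable
  have m: "(\<lambda>w :: 'a \<times> real. h (snd w) * p x (fst w) (c * snd w)) \<in> borel_measurable (lborel \<Otimes>\<^sub>M lborel)"
    by measurable
  have inner: "(\<integral>\<^sup>+y. ennreal (h t * p x y (c * t)) \<partial>lborel) = ennreal (h t)" for t
  proof (cases "t > 0")
    case True
    have "(\<integral>\<^sup>+y. ennreal (p x y (c * t)) \<partial>lborel) = 1"
      using nn_integral_eq_integral[OF p_integrable] p_nonneg p_integral[of "c * t" x] True c
      by (simp add: AE_I2)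
    moreover have "(\<integral>\<^sup>+y. ennreal (h t * p x y (c * t)) \<partial>lborel) = ennreal (h t) * (\<integral>\<^sup>+y. ennreal (p x y (c * t)) \<partial>lborel)"
      by (simp add: ennreal_mult h(2) p_nonneg nn_integral_cmult borel_measurable_integrable[OF p_integrable])
    ultimately show ?thesis by simp
  qed (simp add: h(3))
  have nn: "(\<integral>\<^sup>+w. ennreal (h (snd w) * p x (fst w) (c * snd w)) \<partial>(lborel \<Otimes>\<^sub>M lborel)) = ennreal (\<integral>t. h t \<partial>lborel)"
  proof -
    have "(\<integral>\<^sup>+w. ennreal (h (snd w) * p x (fst w) (c * snd w)) \<partial>(lborel \<Otimes>\<^sub>M lborel)) =
       (\<integral>\<^sup>+t. (\<integral>\<^sup>+y. ennreal (h t * p x y (c * t)) \<partial>lborel) \<partial>lborel)"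
      using lborel_pair.nn_integral_snd[of "\<lambda>w :: 'a \<times> real. ennreal (h (snd w) * p x (fst w) (c * snd w))"] m by simp
    then show ?thesis unfolding inner using nn_integral_eq_integral[OF h(1)] h(2) by simp
  qed
  have i: "integrable (lborel \<Otimes>\<^sub>M lborel) (\<lambda>w :: 'a \<times> real. h (snd w) * p x (fst w) (c * snd w))"
    by (rule integrableI_nonneg[OF m]) (auto simp: h(2) p_nonneg nn)
  then show "integrable lborel (\<lambda>(y, t). h t * p x y (c * t))" by (simp add: lborel_prod case_prod_unfold)
  have "(\<integral>w. h (snd w) * p x (fst w) (c * snd w) \<partial>(lborel \<Otimes>\<^sub>M lborel)) = (\<integral>t. h t \<partial>lborel)"
    using integral_eq_nn_integral[of "\<lambda>w :: 'a \<times> real. h (snd w) * p x (fst w) (c * snd w)"] m h(2) p_nonneg nn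
    by (simp add: integral_nonneg_AE)
  then show "(\<integral>w. (case w of (y, t) \<Rightarrow> h t * p x y (c * t)) \<partial>lborel) = (\<integral>t. h t \<partial>lborel)"
    by (simp add: lborel_prod case_prod_unfold)
qed


section \<open>Regularity of the extension\<close>

definition ext_integrand :: "real \<Rightarrow> ('a \<Rightarrow> real) \<Rightarrow> 'a \<times> real \<Rightarrow> 'a \<times> real \<Rightarrow> real" where
  "ext_integrand s u w \<omega> = weight s (snd w) (snd \<omega>) * p (fst w) (fst \<omega>) (snd \<omega>) * u (fst \<omega>)"

definition ext_D1 :: "real \<Rightarrow> ('a \<Rightarrow> real) \<Rightarrow> 'a \<times> real \<Rightarrow> 'a \<times> real \<Rightarrow> 'a \<times> real \<Rightarrow> real" where
  "ext_D1 s u w v \<omega> = (weight s (snd w) (snd \<omega>) * pd (\<lambda>\<xi>. p \<xi> (fst \<omega>) (snd \<omega>)) (fst w) (fst v)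
     + snd v * weight1 s (snd w) (snd \<omega>) * p (fst w) (fst \<omega>) (snd \<omega>)) * u (fst \<omega>)"

text \<open>The parameter w is (x, z) and the integration variable \<omega> is (y, t); treating (x,
  z) as one variable yields joint C^2 regularity at once. The integrand is differentiated along v
  first and along v' second.\<close>

definition ext_D2 ::
    "real \<Rightarrow> ('a \<Rightarrow> real) \<Rightarrow> 'a \<times> real \<Rightarrow> 'a \<times> real \<Rightarrow> 'a \<times> real \<Rightarrow> 'a \<times> real \<Rightarrow> real" where
  "ext_D2 s u w v v' \<omega> =
     (weight s (snd w) (snd \<omega>) * pd2 (\<lambda>\<xi>. p \<xi> (fst \<omega>) (snd \<omega>)) (fst w) (fst v') (fst v)
     + snd v' * weight1 s (snd w) (snd \<omega>) * pd (\<lambda>\<xi>. p \<xi> (fst \<omega>) (snd \<omega>)) (fst w) (fst v)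
     + snd v * (weight1 s (snd w) (snd \<omega>) * pd (\<lambda>\<xi>. p \<xi> (fst \<omega>) (snd \<omega>)) (fst w) (fst v')
          + snd v' * weight2 s (snd w) (snd \<omega>) * p (fst w) (fst \<omega>) (snd \<omega>))) * u (fst \<omega>)"

lemma p_C2: "C_k_on 2 (\<lambda>\<xi>. p \<xi> y t) UNIV"
  by (rule smooth_on_C_k[OF p_smooth])

lemma has_derivative_comp_snd:
  assumes "(f has_real_derivative f') (at (snd w))"
  shows "((\<lambda>w :: 'a \<times> real. f (snd w)) has_derivative (\<lambda>v. f' * snd v)) (at w)"
  using has_derivative_compose[OF has_derivative_snd[OF has_derivative_ident] assms[unfolded has_field_derivative_def]] .

lemma has_derivative_comp_fst:
  assumes "(f has_derivative f') (at (fst w))"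
  shows "((\<lambda>w :: 'a \<times> real. f (fst w)) has_derivative (\<lambda>v. f' (fst v))) (at w)"
  using has_derivative_compose[OF has_derivative_fst[OF has_derivative_ident] assms] .

lemma ext_integrand_has_derivative:
  assumes "snd w > 0"
  shows "((\<lambda>w. ext_integrand s u w \<omega>) has_derivative (\<lambda>v. ext_D1 s u w v \<omega>)) (at w)"
proof -
  note W = has_derivative_comp_snd[OF weight_has_derivative[OF assms, of s "snd \<omega>"]]
  note P = has_derivative_comp_fst[OF C_k_on_2D(1)[OF open_UNIV p_C2[of "fst \<omega>" "snd \<omega>"] UNIV_I]]
  show ?thesis unfolding ext_integrand_def[abs_def] ext_D1_def
    by (rule has_derivative_eq_rhs[OF has_derivative_mult_left[OF has_derivative_mult[OF W P]]])
       (simp add: algebra_simps)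
qed

lemma ext_D1_has_derivative:
  assumes "snd w > 0"
  shows "((\<lambda>w. ext_D1 s u w v \<omega>) has_derivative (\<lambda>v'. ext_D2 s u w v v' \<omega>)) (at w)"
proof -
  note W = has_derivative_comp_snd[OF weight_has_derivative[OF assms, of s "snd \<omega>"]]
  note W1 = has_derivative_comp_snd[OF weight1_has_derivative[OF assms, of s "snd \<omega>"]]
  note P = has_derivative_comp_fst[OF C_k_on_2D(1)[OF open_UNIV p_C2[of "fst \<omega>" "snd \<omega>"] UNIV_I]]
  note P1 = has_derivative_comp_fst[OF C_k_on_2D(2)[OF open_UNIV p_C2[of "fst \<omega>" "snd \<omega>"] UNIV_I, of "fst v"]]
  show ?thesis unfolding ext_D1_def[abs_def] ext_D2_def
    by (rule has_derivative_eq_rhs[OF has_derivative_mult_left[OF has_derivative_add[OF has_derivative_mult[OF W P1]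
            has_derivative_mult[OF has_derivative_mult_right[OF W1] P]]]])
       (simp add: algebra_simps)
qed

lemma continuous_on_ext_D2: "continuous_on {w. snd w > 0} (\<lambda>w. ext_D2 s u w v v' \<omega>)"
proof -
  have w: "continuous_on {0<..} (\<lambda>z. weight s z t)" "continuous_on {0<..} (\<lambda>z. weight1 s z t)" for t
    using weight_has_derivative weight1_has_derivative
    by (auto intro!: continuous_at_imp_continuous_on DERIV_isCont)
  have w2: "continuous_on {0<..} (\<lambda>z. weight2 s z t)" for t
    unfolding weight2_def by (cases "t = 0") (auto intro!: continuous_intros w)
  have s: "continuous_on {w :: 'a \<times> real. snd w > 0} (\<lambda>w. f (snd w))" if "continuous_on {0<..} f" for f :: "real \<Rightarrow> real"
    by (rule continuous_on_compose2[OF that]) (auto intro: continuous_intros)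
  have f: "continuous_on {w :: 'a \<times> real. snd w > 0} (\<lambda>w. f (fst w))" if "continuous_on UNIV f" for f :: "'a \<Rightarrow> real"
    by (rule continuous_on_compose2[OF that]) (auto intro: continuous_intros)
  note c = C_k_on_2D(3,4)[OF open_UNIV p_C2 UNIV_I]
  show ?thesis unfolding ext_D2_def
    by (intro continuous_intros s f w w2 c C_k_on_continuous[OF p_C2])
qed

text \<open>On a box around w0 the kernel bounds and the weight bounds multiply to one dominating
  family G, to which \<open>C2_integral_Pratt\<close> applies. The derivative formulas and their
  integrability are exported together because the proof of the equation needs both.\<close>

lemma extension_local:
  fixes u :: "'a \<Rightarrow> real"
  assumes s: "s > 0" and u: "u \<in> borel_measurable borel" "\<And>y. \<bar>u y\<bar> \<le> B" and w0: "snd w0 > 0"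
  shows "\<exists>S. open S \<and> w0 \<in> S \<and> C_k_on 2 (\<lambda>w. \<integral>\<omega>. ext_integrand s u w \<omega> \<partial>lborel) S \<and>
    (\<forall>w\<in>S. integrable lborel (ext_integrand s u w)) \<and>
    (\<forall>w\<in>S. \<forall>b\<in>Basis. integrable lborel (ext_D1 s u w b)) \<and>
    (\<forall>w\<in>S. \<forall>b\<in>Basis. \<forall>c\<in>Basis. integrable lborel (ext_D2 s u w b c)) \<and>
    (\<forall>w\<in>S. \<forall>v. pd (\<lambda>w. \<integral>\<omega>. ext_integrand s u w \<omega> \<partial>lborel) w v = (\<integral>\<omega>. ext_D1 s u w v \<omega> \<partial>lborel)) \<and>
    (\<forall>w\<in>S. \<forall>v. \<forall>b\<in>Basis. pd2 (\<lambda>w. \<integral>\<omega>. ext_integrand s u w \<omega> \<partial>lborel) w v b = (\<integral>\<omega>. ext_D2 s u w b v \<omega> \<partial>lborel))"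
proof -
  define \<zeta> where "\<zeta> = snd w0 / 2"
  define Z where "Z = 2 * snd w0"
  have \<zeta>: "\<zeta> > 0" using w0 by (simp add: \<zeta>_def)
  obtain \<delta> C J where \<delta>: "\<delta> > 0" and C: "C > 0" and P: "\<forall>x\<in>ball (fst w0) \<delta>. \<forall>y t. t > 0 \<longrightarrow>
     p x y t \<le> C * (1 + 1 / t) ^ J * p x y (\<kappa> * t) \<and>
     (\<forall>b\<in>Basis. \<bar>pd (\<lambda>\<xi>. p \<xi> y t) x b\<bar> \<le> C * (1 + 1 / t) ^ J * p x y (\<kappa> * t)) \<and>
     (\<forall>b\<in>Basis. \<forall>c\<in>Basis. \<bar>pd2 (\<lambda>\<xi>. p \<xi> y t) x c b\<bar> \<le> C * (1 + 1 / t) ^ J * p x y (\<kappa> * t))"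
    using p_derivative_bounds[of "fst w0"] by (elim exE conjE)
  obtain K where K: "K > 0" and W: "\<forall>z t. \<zeta> < z \<longrightarrow> z < Z \<longrightarrow> t > 0 \<longrightarrow>
    \<bar>weight s z t\<bar> \<le> K * ((1 + 1 / t)\<^sup>2 * (exp (- \<zeta>\<^sup>2 / (4 * t)) / t powr (1 + s))) \<and>
    \<bar>weight1 s z t\<bar> \<le> K * ((1 + 1 / t)\<^sup>2 * (exp (- \<zeta>\<^sup>2 / (4 * t)) / t powr (1 + s))) \<and>
    \<bar>weight2 s z t\<bar> \<le> K * ((1 + 1 / t)\<^sup>2 * (exp (- \<zeta>\<^sup>2 / (4 * t)) / t powr (1 + s)))"
    using weight_bounds[OF \<zeta> s, of Z] by (elim exE conjE)
  have B: "B \<ge> 0" using u(2)[of undefined] by (meson abs_ge_zero order_trans)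
  define S where "S = ball (fst w0) \<delta> \<times> {\<zeta><..<Z}"
  have S: "open S" by (simp add: S_def open_Times)
  have w0S: "w0 \<in> S" using \<delta> w0 by (cases w0) (auto simp: S_def \<zeta>_def Z_def)
  have Spos: "snd w > 0" if "w \<in> S" for w using that \<zeta> by (auto simp: S_def)
  \<comment> \<open>The power J comes from the kernel derivatives and 2 from the weight
    derivatives.\<close>
  define h where "h t = indicator {0<..} t *\<^sub>R ((1 + 1 / t) ^ (J + 2) * (exp (- \<zeta>\<^sup>2 / (4 * t)) / t powr (1 + s)))" for t
  have h: "integrable lborel h" "h t \<ge> 0" "t \<le> 0 \<Longrightarrow> h t = 0" for t
    using dominating_weight_integrable[OF \<zeta> s, of "J + 2"]
    by (auto simp: h_def[abs_def] set_integrable_def indicator_def)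
  \<comment> \<open>\<open>ext_D2\<close> has four summands, each at most E times B.\<close>
  define G where "G w \<omega> = (4 * K * C * B) * (case \<omega> of (y, t) \<Rightarrow> h t * p (fst w) y (\<kappa> * t))" for w :: "'a \<times> real" and \<omega>
  define E where "E w \<omega> = K * C * (case \<omega> of (y, t) \<Rightarrow> h t * p (fst w) y (\<kappa> * t))" for w :: "'a \<times> real" and \<omega>
  have E0: "E w \<omega> \<ge> 0" for w \<omega>
    using K C h(2) p_nonneg by (auto simp: E_def case_prod_unfold)
  have prod_le: "\<bar>a * b\<bar> \<le> E w (y, t)"
    if t: "t > 0" and a: "\<bar>a\<bar> \<le> K * ((1 + 1 / t)\<^sup>2 * (exp (- \<zeta>\<^sup>2 / (4 * t)) / t powr (1 + s)))"
      and b: "\<bar>b\<bar> \<le> C * (1 + 1 / t) ^ J * p (fst w) y (\<kappa> * t)" for a b w y t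
  proof -
    have "\<bar>a * b\<bar> \<le> (K * ((1 + 1 / t)\<^sup>2 * (exp (- \<zeta>\<^sup>2 / (4 * t)) / t powr (1 + s)))) * (C * (1 + 1 / t) ^ J * p (fst w) y (\<kappa> * t))"
      unfolding abs_mult using a b by (intro mult_mono) (auto intro: order_trans[OF abs_ge_zero])
    also have "\<dots> = E w (y, t)" using t by (simp add: E_def h_def power_add power2_eq_square mult_ac)
    finally show ?thesis .
  qed
  have key: "\<bar>weight s (snd w) t * p (fst w) y t\<bar> \<le> E w (y, t) \<and>
      \<bar>weight1 s (snd w) t * p (fst w) y t\<bar> \<le> E w (y, t) \<and>
      \<bar>weight2 s (snd w) t * p (fst w) y t\<bar> \<le> E w (y, t) \<and>
      \<bar>weight s (snd w) t * pd (\<lambda>\<xi>. p \<xi> y t) (fst w) (fst b)\<bar> \<le> E w (y, t) \<and>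
      \<bar>weight1 s (snd w) t * pd (\<lambda>\<xi>. p \<xi> y t) (fst w) (fst b)\<bar> \<le> E w (y, t) \<and>
      \<bar>weight s (snd w) t * pd2 (\<lambda>\<xi>. p \<xi> y t) (fst w) (fst c) (fst b)\<bar> \<le> E w (y, t)"
    if w: "w \<in> S" and b: "b \<in> Basis" and c: "c \<in> Basis" for w y t and b c :: "'a \<times> real"
  proof (cases "t > 0")
    case True
    have x: "fst w \<in> ball (fst w0) \<delta>" and z: "\<zeta> < snd w" "snd w < Z" using w by (auto simp: S_def)
    define A where "A = C * (1 + 1 / t) ^ J * p (fst w) y (\<kappa> * t)"
    have A0: "A \<ge> 0" using C True p_nonneg by (simp add: A_def)
    note P' = P[rule_format, OF x True, of y]
    have p0: "\<bar>p (fst w) y t\<bar> \<le> A" using P' p_nonneg[of "fst w" y t] by (simp add: A_def)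
    \<comment> \<open>A basis vector of the product is (b, 0) or (0, 1), so its spatial part may be
      0, a direction that the bounds over \<open>Basis\<close> do not cover.\<close>
    have zero1: "pd (\<lambda>\<xi>. p \<xi> y t) (fst w) 0 = 0"
      using linear_0[OF has_derivative_linear[OF C_k_on_2D(1)[OF open_UNIV p_C2[of y t] UNIV_I]]] .
    have zero2: "pd2 (\<lambda>\<xi>. p \<xi> y t) (fst w) 0 v = 0" for v
      using linear_0[OF has_derivative_linear[OF C_k_on_2D(2)[OF open_UNIV p_C2[of y t] UNIV_I]]] .
    have zero2': "pd2 (\<lambda>\<xi>. p \<xi> y t) (fst w) v 0 = 0" for v
    proof -
      have "(\<lambda>x. pd (\<lambda>\<xi>. p \<xi> y t) x 0) = (\<lambda>x. 0)"
        using linear_0[OF has_derivative_linear[OF C_k_on_2D(1)[OF open_UNIV p_C2[of y t] UNIV_I]]] by blast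
      then show ?thesis by simp
    qed
    have fb: "fst b \<in> Basis \<or> fst b = 0" "fst c \<in> Basis \<or> fst c = 0" using b c by (auto simp: Basis_prod_def)
    have p1: "\<bar>pd (\<lambda>\<xi>. p \<xi> y t) (fst w) (fst b)\<bar> \<le> A"
      using fb P' zero1 A0 by (auto simp: A_def)
    have p2: "\<bar>pd2 (\<lambda>\<xi>. p \<xi> y t) (fst w) (fst c) (fst b)\<bar> \<le> A"
      using fb P' zero2 zero2' A0 by (auto simp: A_def)
    note W' = W[rule_format, OF z True]
    show ?thesis
      using prod_le[OF True conjunct1[OF W'], of _ w y] prod_le[OF True conjunct1[OF conjunct2[OF W']], of _ w y]
        prod_le[OF True conjunct2[OF conjunct2[OF W']], of _ w y] p0 p1 p2 unfolding A_def by blast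
  qed (use E0 in \<open>simp add: weight_def weight1_def weight2_def\<close>)
  have sb: "\<bar>snd b\<bar> \<le> 1" if "b \<in> Basis" for b :: "'a \<times> real" using that by (auto simp: Basis_prod_def)
  have mul1: "\<bar>r * x\<bar> \<le> e" if "\<bar>r\<bar> \<le> 1" "\<bar>x\<bar> \<le> e" for r x e :: real
    using that mult_mono[of "\<bar>r\<bar>" 1 "\<bar>x\<bar>" e] by (simp add: abs_mult)
  have uG: "\<bar>x * u y\<bar> \<le> G w (y, t)" if "\<bar>x\<bar> \<le> 4 * E w (y, t)" for x w y t
  proof -
    have "\<bar>x * u y\<bar> \<le> (4 * E w (y, t)) * B"
      unfolding abs_mult using that u(2) E0[of w "(y, t)"] by (intro mult_mono) auto
    also have "\<dots> = G w (y, t)" by (simp add: E_def G_def)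
    finally show ?thesis .
  qed
  have Fle: "\<bar>ext_integrand s u w \<omega>\<bar> \<le> G w \<omega>" if "w \<in> S" for w \<omega>
  proof -
    obtain b :: "'a \<times> real" where b: "b \<in> Basis" using nonempty_Basis by blast
    show ?thesis
      using uG[of "weight s (snd w) (snd \<omega>) * p (fst w) (fst \<omega>) (snd \<omega>)" w "fst \<omega>" "snd \<omega>"]
        key[OF that b b, of "snd \<omega>" "fst \<omega>"] E0[of w \<omega>] unfolding ext_integrand_def by simp
  qed
  have D1le: "\<bar>ext_D1 s u w b \<omega>\<bar> \<le> G w \<omega>" if "w \<in> S" "b \<in> Basis" for w b \<omega>
  proof -
    note k = key[OF that that(2), of "snd \<omega>" "fst \<omega>"]
    have "\<bar>weight s (snd w) (snd \<omega>) * pd (\<lambda>\<xi>. p \<xi> (fst \<omega>) (snd \<omega>)) (fst w) (fst b)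
       + snd b * (weight1 s (snd w) (snd \<omega>) * p (fst w) (fst \<omega>) (snd \<omega>))\<bar> \<le> 4 * E w (fst \<omega>, snd \<omega>)"
      using k mul1[OF sb[OF that(2)], of "weight1 s (snd w) (snd \<omega>) * p (fst w) (fst \<omega>) (snd \<omega>)" "E w (fst \<omega>, snd \<omega>)"]
        E0[of w "(fst \<omega>, snd \<omega>)"] by linarith
    from uG[OF this] show ?thesis unfolding ext_D1_def by (simp add: mult.assoc)
  qed
  have D2le: "\<bar>ext_D2 s u w b c \<omega>\<bar> \<le> G w \<omega>" if w: "w \<in> S" and b: "b \<in> Basis" and c: "c \<in> Basis" for w b c \<omega>
  proof -
    note k = key[OF w b c, of "snd \<omega>" "fst \<omega>"] and k' = key[OF w c b, of "snd \<omega>" "fst \<omega>"]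
    let ?E = "E w (fst \<omega>, snd \<omega>)"
    have 1: "\<bar>snd c * (weight1 s (snd w) (snd \<omega>) * pd (\<lambda>\<xi>. p \<xi> (fst \<omega>) (snd \<omega>)) (fst w) (fst b))\<bar> \<le> ?E"
      using mul1[OF sb[OF c]] k by blast
    have 2: "\<bar>snd b * (weight1 s (snd w) (snd \<omega>) * pd (\<lambda>\<xi>. p \<xi> (fst \<omega>) (snd \<omega>)) (fst w) (fst c))\<bar> \<le> ?E"
      using mul1[OF sb[OF b]] k' by blast
    have 3: "\<bar>snd b * (snd c * (weight2 s (snd w) (snd \<omega>) * p (fst w) (fst \<omega>) (snd \<omega>)))\<bar> \<le> ?E"
      using mul1[OF sb[OF b] mul1[OF sb[OF c]]] k by blast
    have 4: "\<bar>weight s (snd w) (snd \<omega>) * pd2 (\<lambda>\<xi>. p \<xi> (fst \<omega>) (snd \<omega>)) (fst w) (fst c) (fst b)\<bar> \<le> ?E"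
      using k by blast
    have "\<bar>weight s (snd w) (snd \<omega>) * pd2 (\<lambda>\<xi>. p \<xi> (fst \<omega>) (snd \<omega>)) (fst w) (fst c) (fst b)
      + snd c * (weight1 s (snd w) (snd \<omega>) * pd (\<lambda>\<xi>. p \<xi> (fst \<omega>) (snd \<omega>)) (fst w) (fst b))
      + (snd b * (weight1 s (snd w) (snd \<omega>) * pd (\<lambda>\<xi>. p \<xi> (fst \<omega>) (snd \<omega>)) (fst w) (fst c))
      + snd b * (snd c * (weight2 s (snd w) (snd \<omega>) * p (fst w) (fst \<omega>) (snd \<omega>))))\<bar> \<le> 4 * ?E"
      using 1 2 3 4 by linarith
    from uG[OF this] show ?thesis unfolding ext_D2_def by (simp add: mult.assoc distrib_left)
  qed
  have Gi: "integrable lborel (G w)" for w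
    unfolding G_def by (intro integrable_mult_right kernel_weight_integral h \<kappa>_pos)
  \<comment> \<open>Independent of w, hence trivially continuous in w.\<close>
  have Gv: "(\<integral>\<omega>. G w \<omega> \<partial>lborel) = (4 * K * C * B) * (\<integral>t. h t \<partial>lborel)" for w
    unfolding G_def by (simp add: kernel_weight_integral(2)[OF h \<kappa>_pos])
  have Gc: "continuous_on S (\<lambda>w. G w \<omega>)" for \<omega>
  proof -
    have "continuous_on S (\<lambda>w. p (fst w) (fst \<omega>) (\<kappa> * snd \<omega>))"
      by (rule continuous_on_compose2[OF C_k_on_continuous[OF p_C2]]) (auto intro: continuous_intros)
    then show ?thesis unfolding G_def case_prod_unfold by (intro continuous_intros)
  qed
  have Fm: "ext_integrand s u w \<in> borel_measurable lborel" for w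
  proof -
    note [measurable] = p_measurable u(1)
    have "(\<lambda>\<omega>. weight s (snd w) (snd \<omega>) * p (fst w) (fst \<omega>) (snd \<omega>) * u (fst \<omega>)) \<in> borel_measurable (borel \<Otimes>\<^sub>M borel)"
      by measurable
    then show ?thesis by (simp add: ext_integrand_def[abs_def] borel_prod)
  qed
  note T = lborel.C2_integral_Pratt[where F = "ext_integrand s u" and ?D1.0 = "ext_D1 s u" and ?D2.0 = "ext_D2 s u" and G = G,
      OF S ext_integrand_has_derivative[OF Spos] ext_D1_has_derivative[OF Spos]
        continuous_on_subset[OF continuous_on_ext_D2] Gc Fm Fle D1le D2le Gi]
  have sub: "S \<subseteq> {w. snd w > 0}" using Spos by blast
  have gic: "continuous_on S (\<lambda>x. integral\<^sup>L lborel (G x))" unfolding Gv by (rule continuous_on_const)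
  show ?thesis
    by (rule exI[of _ S], intro conjI ballI allI S w0S)
       (rule T; (assumption | rule sub gic))+
qed


definition extension :: "real \<Rightarrow> ('a \<Rightarrow> real) \<Rightarrow> 'a \<times> real \<Rightarrow> real" where
  "extension s u w = (\<integral>\<omega>. ext_integrand s u w \<omega> \<partial>lborel)"

lemma open_upper_half: "open {w :: 'a \<times> real. snd w > 0}"
  by (intro open_Collect_less continuous_intros)

lemma ext_integrand_integrable:
  assumes "s > 0" "u \<in> borel_measurable borel" "\<And>y. \<bar>u y\<bar> \<le> B" "snd w > 0"
  shows "integrable lborel (ext_integrand s u w)"
  using extension_local[OF assms] by blast

lemma C2_extension:
  assumes "s > 0" "u \<in> borel_measurable borel" "\<And>y. \<bar>u y\<bar> \<le> B"
  shows "C_k_on 2 (extension s u) {w. snd w > 0}"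
  unfolding extension_def[abs_def]
proof (rule C_k_on_local[OF open_upper_half])
  fix w :: "'a \<times> real" assume "w \<in> {w. snd w > 0}"
  then have "snd w > 0" by simp
  from extension_local[OF assms this]
  show "\<exists>T. open T \<and> w \<in> T \<and> C_k_on 2 (\<lambda>w. \<integral>\<omega>. ext_integrand s u w \<omega> \<partial>lborel) T"
    by (elim exE conjE, intro exI conjI)
qed

text \<open>The boundary terms of the integral of the time derivative. With \<epsilon> = z^2 / 8
  half of the exponential survives the growth of p near 0 and beats every power of 1/t; at infinity
  the power t^(-1-s) suffices.\<close>

lemma p_weight_limits:
  assumes s: "s > 0" and z: "z > 0"
  shows "((\<lambda>t. weight s z t * p x y t) \<longlongrightarrow> 0) (at_right 0)"
    and "((\<lambda>t. weight s z t * p x y t) \<longlongrightarrow> 0) at_top"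
proof -
  define \<epsilon> where "\<epsilon> = z\<^sup>2 / 8"
  have \<epsilon>: "\<epsilon> > 0" using z by (simp add: \<epsilon>_def)
  obtain C where C: "C > 0" "\<And>y t. t > 0 \<Longrightarrow> p x y t \<le> C * exp (\<epsilon> / t)"
    using p_small_time[OF \<epsilon>, of x] by blast
  define k where "k = 1 / (2 powr (2 * s) * Gamma s) * z powr (2 * s)"
  have k: "k > 0" using s z by (simp add: k_def Gamma_real_pos)
  have le: "\<bar>weight s z t * p x y t\<bar> \<le> (k * C) * (exp (- \<epsilon> / t) / t powr (1 + s))" if t: "t > 0" for t
  proof -
    have "weight s z t * p x y t \<le> k * (exp (- z\<^sup>2 / (4 * t)) / t powr (1 + s)) * (C * exp (\<epsilon> / t))"
    proof -
      have "weight s z t * p x y t \<le> weight s z t * (C * exp (\<epsilon> / t))"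
        by (rule mult_left_mono[OF C(2)[OF t] weight_nonneg[OF s]])
      then show ?thesis using t by (simp add: weight_def k_def)
    qed
    also have "\<dots> = (k * C) * (exp (- z\<^sup>2 / (4 * t)) * exp (\<epsilon> / t) / t powr (1 + s))" by simp
    also have "exp (- z\<^sup>2 / (4 * t)) * exp (\<epsilon> / t) = exp (- \<epsilon> / t)"
      using t by (simp add: \<epsilon>_def flip: exp_add)
    finally show ?thesis using weight_nonneg[OF s, of z t] p_nonneg[of x y t] by simp
  qed
  show "((\<lambda>t. weight s z t * p x y t) \<longlongrightarrow> 0) at_top"
  proof (rule Lim_null_comparison)
    show "\<forall>\<^sub>F t in at_top. norm (weight s z t * p x y t) \<le> (k * C) * t powr (- (1 + s))"
      using eventually_gt_at_top[of 0]
    proof eventually_elim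
      case (elim t)
      have "exp (- \<epsilon> / t) / t powr (1 + s) \<le> t powr (- (1 + s))"
        using elim \<epsilon> divide_right_mono[of "exp (- \<epsilon> / t)" 1 "t powr (1 + s)"]
        unfolding powr_minus_divide by simp
      then show ?case using le[OF elim] mult_left_mono[of _ _ "k * C"] k C(1) by (smt (verit) mult_pos_pos real_norm_def)
    qed
    show "((\<lambda>t. (k * C) * t powr (- (1 + s))) \<longlongrightarrow> 0) at_top"
      using s by (intro tendsto_mult_right_zero tendsto_neg_powr filterlim_ident) auto
  qed
  show "((\<lambda>t. weight s z t * p x y t) \<longlongrightarrow> 0) (at_right 0)"
  proof -
    obtain J :: nat where J: "1 + s \<le> real J" using real_arch_simple by blast
    obtain D where D: "D > 0" "\<And>r. r \<ge> 0 \<Longrightarrow> (1 + r) ^ (Suc J) \<le> D * exp (\<epsilon> * r)"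
      using poly_exp_bound[OF \<epsilon>, of "Suc J"] by blast
    show ?thesis
    proof (rule Lim_null_comparison)
      show "\<forall>\<^sub>F t in at_right 0. norm (weight s z t * p x y t) \<le> (k * C) * (D * t)"
        unfolding eventually_at_right_field
      proof (intro exI[of _ 1] conjI allI impI)
        fix t :: real assume t: "0 < t" "t < 1"
        have "1 / t powr (1 + s) \<le> (1 / t) ^ J"
        proof -
          have "1 / t powr (1 + s) = (1 / t) powr (1 + s)" using t by (simp add: powr_divide)
          also have "\<dots> \<le> (1 / t) powr real J" using t J by (intro powr_mono) auto
          also have "\<dots> = (1 / t) ^ J" using t by (intro powr_realpow) auto
          finally show ?thesis .
        qed
        moreover have "(1 / t) * (1 / t) ^ J \<le> D * exp (\<epsilon> / t)"
        proof -
          have "(1 / t) ^ Suc J \<le> (1 + 1 / t) ^ Suc J" using t by (intro power_mono) auto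
          also have "\<dots> \<le> D * exp (\<epsilon> * (1 / t))" using D(2)[of "1 / t"] t by simp
          finally show ?thesis by simp
        qed
        then have "(1 / t) ^ J \<le> D * exp (\<epsilon> / t) * t" using t by (simp add: field_simps)
        ultimately have "1 / t powr (1 + s) \<le> D * exp (\<epsilon> / t) * t" by linarith
        then have "exp (- \<epsilon> / t) * (1 / t powr (1 + s)) \<le> exp (- \<epsilon> / t) * (D * exp (\<epsilon> / t) * t)"
          by (intro mult_left_mono) auto
        also have "\<dots> = D * t" by (simp add: exp_minus)
        finally have "exp (- \<epsilon> / t) / t powr (1 + s) \<le> D * t" by simp
        then show "norm (weight s z t * p x y t) \<le> (k * C) * (D * t)"
          using le[OF t(1)] mult_left_mono[of _ _ "k * C"] k C(1) by (smt (verit) mult_pos_pos real_norm_def)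
      qed simp
      show "((\<lambda>t. (k * C) * (D * t)) \<longlongrightarrow> 0) (at_right 0)"
        by (auto intro!: tendsto_eq_intros)
    qed
  qed
qed

text \<open>The space part f1 and the Bessel part f2 are integrable over all (y, t), so Fubini may
  integrate their sum in t first, where it is a total derivative times u.\<close>

lemma extension_equation:
  assumes s: "s > 0" and u: "u \<in> borel_measurable borel" "\<And>y. \<bar>u y\<bar> \<le> B" and z: "z > 0"
  shows "sub_laplacian X (\<lambda>\<xi>. extension s u (\<xi>, z)) x +
    bessel_op (1 - 2 * s) (\<lambda>z. extension s u (x, z)) z = 0"
proof -
  let ?\<Phi> = "extension s u" and ?H = "{w :: 'a \<times> real. snd w > 0}"
  define w where "w = (x, z)"
  have w: "snd w > 0" "w \<in> ?H" using z by (auto simp: w_def)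
  note C2 = C2_extension[OF s u]
  from extension_local[OF s u w(1)]
  obtain S where S: "open S" "w \<in> S"
    and I1: "\<forall>w\<in>S. \<forall>b\<in>Basis. integrable lborel (ext_D1 s u w b)"
    and I2: "\<forall>w\<in>S. \<forall>b\<in>Basis. \<forall>c\<in>Basis. integrable lborel (ext_D2 s u w b c)"
    and E1: "\<forall>w\<in>S. \<forall>v. pd (\<lambda>w. \<integral>\<omega>. ext_integrand s u w \<omega> \<partial>lborel) w v = (\<integral>\<omega>. ext_D1 s u w v \<omega> \<partial>lborel)"
    and E2: "\<forall>w\<in>S. \<forall>v. \<forall>b\<in>Basis. pd2 (\<lambda>w. \<integral>\<omega>. ext_integrand s u w \<omega> \<partial>lborel) w v b = (\<integral>\<omega>. ext_D2 s u w b v \<omega> \<partial>lborel)"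
    by (elim exE conjE)
  have i1: "integrable lborel (ext_D1 s u w b)" if "b \<in> Basis" for b
    by (rule bspec[OF bspec[OF I1 S(2)] that])
  have i2: "integrable lborel (ext_D2 s u w b c)" if "b \<in> Basis" "c \<in> Basis" for b c
    by (rule bspec[OF bspec[OF bspec[OF I2 S(2)] that(1)] that(2)])
  have e1: "pd ?\<Phi> w v = (\<integral>\<omega>. ext_D1 s u w v \<omega> \<partial>lborel)" for v
    unfolding extension_def[abs_def] by (rule spec[OF bspec[OF E1 S(2)]])
  have e2: "pd2 ?\<Phi> w v b = (\<integral>\<omega>. ext_D2 s u w b v \<omega> \<partial>lborel)" if "b \<in> Basis" for v b
    unfolding extension_def[abs_def] by (rule bspec[OF spec[OF bspec[OF E2 S(2)]] that])
  have bas: "(b, 0) \<in> (Basis :: ('a \<times> real) set)" if "b \<in> Basis" for b using that by (simp add: Basis_prod_def)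
  have bas1: "(0, 1) \<in> (Basis :: ('a \<times> real) set)" by (simp add: Basis_prod_def)
  have zero1: "pd (\<lambda>\<xi>. p \<xi> y t) x 0 = 0" for y t
    using linear_0[OF has_derivative_linear[OF C_k_on_2D(1)[OF open_UNIV p_C2[of y t] UNIV_I]]] .
  have zero2: "pd2 (\<lambda>\<xi>. p \<xi> y t) x 0 v = 0" for v y t
    using linear_0[OF has_derivative_linear[OF C_k_on_2D(2)[OF open_UNIV p_C2[of y t] UNIV_I]]] .
  define A where "A b c = diffusion X b c x" for b c
  define A' where "A' b c = pd (diffusion X b c) x b" for b c
  define Lp where "Lp \<omega> = sub_laplacian X (\<lambda>\<xi>. p \<xi> (fst \<omega>) (snd \<omega>)) x" for \<omega>
  define f1 where "f1 \<omega> = weight s z (snd \<omega>) * Lp \<omega> * u (fst \<omega>)" for \<omega>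
  \<comment> \<open>Through the dominated derivatives of the integrand, integrability of f1 is
    inherited, and integral and operator can be exchanged.\<close>
  have f1_eq: "f1 = (\<lambda>\<omega>. \<Sum>b\<in>Basis. \<Sum>c\<in>Basis. A b c * ext_D2 s u w (c, 0) (b, 0) \<omega> + A' b c * ext_D1 s u w (c, 0) \<omega>)"
  proof
    fix \<omega>
    have "f1 \<omega> = weight s z (snd \<omega>) * (\<Sum>b\<in>Basis. \<Sum>c\<in>Basis. A b c * pd2 (\<lambda>\<xi>. p \<xi> (fst \<omega>) (snd \<omega>)) x b c
        + A' b c * pd (\<lambda>\<xi>. p \<xi> (fst \<omega>) (snd \<omega>)) x c) * u (fst \<omega>)"
      unfolding f1_def Lp_def A_def A'_def
      using sub_laplacian_eq[where X = X, OF smooth_fields open_UNIV p_C2 UNIV_I] by simp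
    then show "f1 \<omega> = (\<Sum>b\<in>Basis. \<Sum>c\<in>Basis. A b c * ext_D2 s u w (c, 0) (b, 0) \<omega> + A' b c * ext_D1 s u w (c, 0) \<omega>)"
      by (simp add: ext_D1_def ext_D2_def w_def sum_distrib_left sum_distrib_right algebra_simps)
  qed
  have if1: "integrable lborel f1"
    unfolding f1_eq by (intro Bochner_Integration.integrable_sum Bochner_Integration.integrable_add integrable_mult_right i1 i2 bas)
  have L: "sub_laplacian X (\<lambda>\<xi>. ?\<Phi> (\<xi>, z)) x = (\<integral>\<omega>. f1 \<omega> \<partial>lborel)"
  proof -
    have "sub_laplacian X (\<lambda>\<xi>. ?\<Phi> (\<xi>, z)) x = lifted_laplacian X ?\<Phi> w"
      unfolding w_def by (rule sub_laplacian_slice[OF smooth_fields open_upper_half C2]) (use z in simp)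
    also have "\<dots> = (\<Sum>b\<in>Basis. \<Sum>c\<in>Basis. A b c * (\<integral>\<omega>. ext_D2 s u w (c, 0) (b, 0) \<omega> \<partial>lborel)
        + A' b c * (\<integral>\<omega>. ext_D1 s u w (c, 0) \<omega> \<partial>lborel))"
      unfolding lifted_laplacian_def e1 A_def A'_def by (intro sum.cong refl) (simp add: e2[unfolded w_def] bas w_def)
    also have "\<dots> = (\<integral>\<omega>. f1 \<omega> \<partial>lborel)"
      unfolding f1_eq by (simp add: Bochner_Integration.integral_sum Bochner_Integration.integrable_sum i1 i2 bas)
    finally show ?thesis .
  qed
  define f2 where "f2 \<omega> = ext_D2 s u w (0, 1) (0, 1) \<omega> + (1 - 2 * s) / z * ext_D1 s u w (0, 1) \<omega>" for \<omega>
  have if2: "integrable lborel f2"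
    unfolding f2_def by (intro Bochner_Integration.integrable_add integrable_mult_right i1 i2 bas1)
  have B: "bessel_op (1 - 2 * s) (\<lambda>z. ?\<Phi> (x, z)) z = (\<integral>\<omega>. f2 \<omega> \<partial>lborel)"
  proof -
    have d1: "((\<lambda>z. ?\<Phi> (x, z)) has_real_derivative pd ?\<Phi> (x, z') (0, 1)) (at z')" if "z' > 0" for z'
      by (rule has_real_derivative_slice_snd[OF C_k_on_2D(1)[OF open_upper_half C2]]) (use that in simp)
    have d2: "((\<lambda>z. pd ?\<Phi> (x, z) (0, 1)) has_real_derivative pd2 ?\<Phi> (x, z) (0, 1) (0, 1)) (at z)"
      by (rule has_real_derivative_slice_snd[OF C_k_on_2D(2)[OF open_upper_half C2]]) (use z in simp)
    have "(deriv (\<lambda>z. ?\<Phi> (x, z)) has_real_derivative pd2 ?\<Phi> (x, z) (0, 1) (0, 1)) (at z)"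
      by (rule has_field_derivative_transform_within_open[OF d2, of "{0<..}"])
         (use z DERIV_imp_deriv[OF d1] in auto)
    then have "bessel_op (1 - 2 * s) (\<lambda>z. ?\<Phi> (x, z)) z = pd2 ?\<Phi> w (0, 1) (0, 1) + (1 - 2 * s) / z * pd ?\<Phi> w (0, 1)"
      unfolding bessel_op_def w_def using DERIV_imp_deriv DERIV_imp_deriv[OF d1[OF z]] by metis
    also have "\<dots> = (\<integral>\<omega>. f2 \<omega> \<partial>lborel)"
      unfolding f2_def e1 e2[OF bas1] by (simp add: i1 i2 bas1)
    finally show ?thesis .
  qed
  define g where "g y t = weight s z t * Lp (y, t) + weight s z t * (z\<^sup>2 / (4 * t\<^sup>2) - (1 + s) / t) * p x y t" for y t
  have sum: "f1 (y, t) + f2 (y, t) = indicator {0<..} t * g y t * u y" for y t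
  proof (cases "t > 0")
    case True
    have "f2 (y, t) = (weight2 s z t + (1 - 2 * s) / z * weight1 s z t) * p x y t * u y"
      by (simp add: f2_def ext_D1_def ext_D2_def w_def zero1 zero2 algebra_simps)
    then have "f2 (y, t) = weight s z t * (z\<^sup>2 / (4 * t\<^sup>2) - (1 + s) / t) * p x y t * u y"
      by (simp only: weight_bessel[OF z True])
    then show ?thesis using True by (simp add: f1_def g_def algebra_simps)
  next
    case False
    then show ?thesis by (simp add: f1_def f2_def ext_D1_def ext_D2_def weight_def weight1_def weight2_def w_def)
  qed
  \<comment> \<open>Valid for every y without checking convergence in t, thanks to the form of
    \<open>integral_derivative_half_line\<close>.\<close>
  have inner: "(\<integral>t. indicator {0<..} t * g y t \<partial>lborel) = 0" for y
  proof -
    have "(LINT t:{0<..}|lborel. g y t) = 0"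
    proof (rule integral_derivative_half_line[OF _ _ p_weight_limits[OF s z, of x y]])
      fix t :: real assume t: "t > 0"
      show "((\<lambda>t. weight s z t * p x y t) has_real_derivative g y t) (at t)"
        by (rule DERIV_cong[OF DERIV_mult[OF weight_has_derivative_time[OF t] p_has_derivative_time[OF t]]])
           (simp add: g_def Lp_def)
    next
      have w: "continuous_on {0<..} (weight s z)"
        using weight_has_derivative_time by (auto intro!: continuous_at_imp_continuous_on DERIV_isCont)
      have p: "continuous_on {0<..} (p x y)"
        using p_has_derivative_time by (auto intro!: continuous_at_imp_continuous_on DERIV_isCont)
      show "continuous_on {0<..} (g y)"
        unfolding g_def Lp_def fst_conv snd_conv
        by (intro continuous_intros w p continuous_on_p_time_derivative) auto
    qed
    then show ?thesis by (simp add: set_lebesgue_integral_def)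
  qed
  have "sub_laplacian X (\<lambda>\<xi>. ?\<Phi> (\<xi>, z)) x + bessel_op (1 - 2 * s) (\<lambda>z. ?\<Phi> (x, z)) z
      = (\<integral>\<omega>. f1 \<omega> + f2 \<omega> \<partial>lborel)"
    unfolding L B using if1 if2 by simp
  also have "\<dots> = (\<integral>\<omega>. f1 \<omega> + f2 \<omega> \<partial>(lborel \<Otimes>\<^sub>M lborel))" by (simp add: lborel_prod)
  also have "\<dots> = (\<integral>y. (\<integral>t. f1 (y, t) + f2 (y, t) \<partial>lborel) \<partial>lborel)"
    by (rule lborel_pair.integral_fst'[symmetric]) (use if1 if2 in \<open>simp add: lborel_prod\<close>)
  also have "\<dots> = (\<integral>y. (\<integral>t. indicator {0<..} t * g y t \<partial>lborel) * u y \<partial>(lborel :: 'a measure))"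
    unfolding sum by simp
  also have "\<dots> = 0" unfolding inner by simp
  finally show ?thesis .
qed


section \<open>Convergence to the boundary datum\<close>


text \<open>\<open>mass\<close> normalizes the integral over the second argument;
  \<open>p_swap\<close> carries it to the first at the cost of a constant.\<close>

lemma p_mass_first: "\<exists>C>0. \<forall>y t. t > 0 \<longrightarrow> (\<integral>\<^sup>+x. ennreal (p x y t) \<partial>lborel) \<le> ennreal C"
proof -
  obtain C where C: "C > 0" "\<And>x y t. t > 0 \<Longrightarrow> p x y t \<le> C * p y x (2 * \<kappa> * t)"
    using p_swap by blast
  have "(\<integral>\<^sup>+x. ennreal (p x y t) \<partial>lborel) \<le> ennreal C" if t: "t > 0" for y t
  proof -
    have "(\<integral>\<^sup>+x. ennreal (p x y t) \<partial>lborel) \<le> (\<integral>\<^sup>+x. ennreal C * ennreal (p y x (2 * \<kappa> * t)) \<partial>lborel)"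
      using C t by (intro nn_integral_mono) (simp add: p_nonneg flip: ennreal_mult)
    also have "\<dots> = ennreal C * (\<integral>\<^sup>+x. ennreal (p y x (2 * \<kappa> * t)) \<partial>lborel)"
    proof (rule nn_integral_cmult)
      have [measurable]: "(\<lambda>x. p y x (2 * \<kappa> * t)) \<in> borel_measurable lborel"
        by (rule borel_measurable_integrable[OF p_integrable])
      show "(\<lambda>x. ennreal (p y x (2 * \<kappa> * t))) \<in> borel_measurable lborel" by measurable
    qed
    also have "(\<integral>\<^sup>+x. ennreal (p y x (2 * \<kappa> * t)) \<partial>lborel) = 1"
      using nn_integral_eq_integral[OF p_integrable] p_nonneg p_integral[of "2 * \<kappa> * t" y] t \<kappa>_pos
      by (simp add: AE_I2)
    finally show ?thesis by simp
  qed
  then show ?thesis using C(1) by blast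
qed

lemma p_norm_sq: "\<exists>C>0. \<forall>x y t. t > 0 \<longrightarrow> (norm (x - y))\<^sup>2 * p x y t \<le> C * t * p x y (2 * \<kappa> * t)"
proof -
  obtain C where C: "C > 0" "\<And>x y t. t > 0 \<Longrightarrow> (dr x y)\<^sup>2 * p x y t \<le> C * t * p x y (2 * \<kappa> * t)"
    using p_dist_sq by blast
  obtain \<Lambda> where \<Lambda>: "\<And>i x. norm (X i x) \<le> \<Lambda>"
    using fields_bounded[OF smooth_fields off_compact] by blast
  \<comment> \<open>The added 1 keeps K positive if \<Lambda> = 0.\<close>
  define K where "K = C * (\<Lambda>\<^sup>2 + 1)"
  have K: "K > 0" "C * \<Lambda>\<^sup>2 \<le> K" using C by (auto simp: K_def add_nonneg_pos distrib_left)
  have "(norm (x - y))\<^sup>2 * p x y t \<le> K * t * p x y (2 * \<kappa> * t)" if t: "t > 0" for x y t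
  proof -
    have "norm (x - y) \<le> \<Lambda> * dr x y"
      unfolding dr_def by (rule norm_le_cc_dist[OF \<Lambda> d_finite])
    then have "(norm (x - y))\<^sup>2 \<le> (\<Lambda> * dr x y)\<^sup>2" by (rule power_mono) simp
    then have "(norm (x - y))\<^sup>2 * p x y t \<le> (\<Lambda> * dr x y)\<^sup>2 * p x y t" by (rule mult_right_mono[OF _ p_nonneg])
    also have "\<dots> = \<Lambda>\<^sup>2 * ((dr x y)\<^sup>2 * p x y t)" by (simp add: power_mult_distrib)
    also have "\<dots> \<le> \<Lambda>\<^sup>2 * (C * t * p x y (2 * \<kappa> * t))" by (intro mult_left_mono C t) simp
    also have "\<dots> = (C * \<Lambda>\<^sup>2) * (t * p x y (2 * \<kappa> * t))" by simp
    also have "\<dots> \<le> K * (t * p x y (2 * \<kappa> * t))" using t p_nonneg by (intro mult_right_mono K) auto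
    finally show ?thesis by (simp add: mult.assoc)
  qed
  then show ?thesis using K(1) by blast
qed

text \<open>The term h x is integrated against mass one in y, the term h y against the bounded mass
  in x. The constant is uniform in t, so it applies at the rescaled time 2 \<kappa> t as
  well.\<close>

lemma p_double_integral:
  fixes h :: "'a \<Rightarrow> real"
  assumes h: "integrable lborel h" "\<And>x. h x \<ge> 0"
  shows "\<exists>K\<ge>0. \<forall>t>0. (\<integral>\<^sup>+x. \<integral>\<^sup>+y. ennreal (p x y t * (h x + h y)) \<partial>lborel \<partial>lborel) \<le> ennreal K"
proof -
  obtain C where C: "C > 0" "\<And>y t. t > 0 \<Longrightarrow> (\<integral>\<^sup>+x. ennreal (p x y t) \<partial>lborel) \<le> ennreal C"
    using p_mass_first by blast
  define I where "I = (\<integral>x. h x \<partial>lborel)"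
  have I: "I \<ge> 0" unfolding I_def using h(2) by (simp add: integral_nonneg_AE)
  have hI: "(\<integral>\<^sup>+x. ennreal (h x) \<partial>lborel) = ennreal I"
    unfolding I_def by (rule nn_integral_eq_integral[OF h(1)]) (simp add: h(2))
  note [measurable] = borel_measurable_integrable[OF h(1), simplified] p_measurable
  have "(\<integral>\<^sup>+x. \<integral>\<^sup>+y. ennreal (p x y t * (h x + h y)) \<partial>lborel \<partial>lborel) \<le> ennreal (I + C * I)" if t: "t > 0" for t
  proof -
    have p1: "(\<integral>\<^sup>+y. ennreal (p x y t) \<partial>lborel) = 1" for x
      using nn_integral_eq_integral[OF p_integrable] p_nonneg p_integral[OF t, of x] by (simp add: AE_I2)
    have "(\<integral>\<^sup>+x. \<integral>\<^sup>+y. ennreal (p x y t * (h x + h y)) \<partial>lborel \<partial>lborel) =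
        (\<integral>\<^sup>+x. (\<integral>\<^sup>+y. ennreal (h x) * ennreal (p x y t) + ennreal (h y) * ennreal (p x y t) \<partial>lborel) \<partial>lborel)"
      by (intro nn_integral_cong) (simp add: h(2) p_nonneg distrib_left mult.commute flip: ennreal_mult ennreal_plus)
    also have "\<dots> = (\<integral>\<^sup>+x. ennreal (h x) + (\<integral>\<^sup>+y. ennreal (h y) * ennreal (p x y t) \<partial>lborel) \<partial>lborel)"
      by (intro nn_integral_cong) (simp add: nn_integral_add nn_integral_cmult p1)
    also have "\<dots> = ennreal I + (\<integral>\<^sup>+x. (\<integral>\<^sup>+y. ennreal (h y) * ennreal (p x y t) \<partial>lborel) \<partial>lborel)"
      by (subst nn_integral_add) (simp_all add: hI)
    also have "(\<integral>\<^sup>+x. (\<integral>\<^sup>+y. ennreal (h y) * ennreal (p x y t) \<partial>lborel) \<partial>lborel) =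
        (\<integral>\<^sup>+y. (\<integral>\<^sup>+x. ennreal (h y) * ennreal (p x y t) \<partial>lborel) \<partial>lborel)"
      by (rule lborel_pair.Fubini') simp
    also have "\<dots> = (\<integral>\<^sup>+y. ennreal (h y) * (\<integral>\<^sup>+x. ennreal (p x y t) \<partial>lborel) \<partial>lborel)"
      by (intro nn_integral_cong nn_integral_cmult) simp
    also have "\<dots> \<le> (\<integral>\<^sup>+y. ennreal (h y) * ennreal C \<partial>lborel)"
      by (intro nn_integral_mono mult_left_mono C t) simp
    also have "\<dots> = (\<integral>\<^sup>+y. ennreal (h y) \<partial>lborel) * ennreal C"
      by (rule nn_integral_multc) simp
    also have "\<dots> = ennreal (C * I)"
      using C(1) I by (simp add: hI mult.commute flip: ennreal_mult)
    finally show ?thesis using I C(1) by (simp add: add_left_mono flip: ennreal_plus)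
  qed
  moreover have "I + C * I \<ge> 0" using I C(1) by simp
  ultimately show ?thesis by blast
qed

text \<open>For t \<ge> 1 the crude increment bound gives a constant; for t < 1 the squared distance
  yields a factor t by \<open>p_norm_sq\<close>. Both lie below a multiple of t^(s/2) on their range
  because 0 < s/2 < 1, and this is a power that the weight can integrate.\<close>

lemma heat_increment:
  assumes u: "schwartz u" and s: "0 < s" "s < 1"
  shows "\<exists>K\<ge>0. \<forall>t>0. (\<integral>\<^sup>+x. \<integral>\<^sup>+y. ennreal (p x y t * (u y - u x)\<^sup>2) \<partial>lborel \<partial>lborel) \<le> ennreal (K * t powr (s / 2))"
proof -
  obtain h where h: "integrable lborel h" "\<And>x. 0 \<le> h x"
    and h1: "\<And>x y. (u x - u y)\<^sup>2 \<le> h x + h y" and h2: "\<And>x y. (u x - u y)\<^sup>2 \<le> (norm (x - y))\<^sup>2 * (h x + h y)"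
    using schwartz_increment[OF u] by blast
  obtain K where K: "K \<ge> 0" "\<And>t. t > 0 \<Longrightarrow> (\<integral>\<^sup>+x. \<integral>\<^sup>+y. ennreal (p x y t * (h x + h y)) \<partial>lborel \<partial>lborel) \<le> ennreal K"
    using p_double_integral[OF h] by blast
  obtain C where C: "C > 0" "\<And>x y t. t > 0 \<Longrightarrow> (norm (x - y))\<^sup>2 * p x y t \<le> C * t * p x y (2 * \<kappa> * t)"
    using p_norm_sq by blast
  note [measurable] = borel_measurable_integrable[OF h(1), simplified] p_measurable
  have "(\<integral>\<^sup>+x. \<integral>\<^sup>+y. ennreal (p x y t * (u y - u x)\<^sup>2) \<partial>lborel \<partial>lborel) \<le> ennreal ((K + C * K) * t powr (s / 2))"
    if t: "t > 0" for t
  proof (cases "t \<ge> 1")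
    case True
    have "(\<integral>\<^sup>+x. \<integral>\<^sup>+y. ennreal (p x y t * (u y - u x)\<^sup>2) \<partial>lborel \<partial>lborel)
        \<le> (\<integral>\<^sup>+x. \<integral>\<^sup>+y. ennreal (p x y t * (h x + h y)) \<partial>lborel \<partial>lborel)"
      using h1 by (intro nn_integral_mono ennreal_leI mult_left_mono p_nonneg) (simp add: power2_commute)
    also have "\<dots> \<le> ennreal K" by (rule K(2)[OF t])
    also have "\<dots> \<le> ennreal ((K + C * K) * t powr (s / 2))"
    proof (rule ennreal_leI)
      have "1 \<le> t powr (s / 2)" using True s by (simp add: ge_one_powr_ge_zero)
      then have "K * 1 \<le> (K + C * K) * t powr (s / 2)" using K C by (intro mult_mono) auto
      then show "K \<le> (K + C * K) * t powr (s / 2)" by simp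
    qed
    finally show ?thesis .
  next
    case False
    have t': "2 * \<kappa> * t > 0" using t \<kappa>_pos by simp
    have "(\<integral>\<^sup>+x. \<integral>\<^sup>+y. ennreal (p x y t * (u y - u x)\<^sup>2) \<partial>lborel \<partial>lborel)
        \<le> (\<integral>\<^sup>+x. \<integral>\<^sup>+y. ennreal (C * t) * ennreal (p x y (2 * \<kappa> * t) * (h x + h y)) \<partial>lborel \<partial>lborel)"
    proof (intro nn_integral_mono)
      fix x y
      have hh: "h x + h y \<ge> 0" using h(2)[of x] h(2)[of y] by simp
      have "p x y t * (u y - u x)\<^sup>2 \<le> p x y t * ((norm (x - y))\<^sup>2 * (h x + h y))"
        using h2[of x y] by (intro mult_left_mono p_nonneg) (simp add: power2_commute)
      also have "\<dots> = ((norm (x - y))\<^sup>2 * p x y t) * (h x + h y)" by simp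
      also have "\<dots> \<le> (C * t * p x y (2 * \<kappa> * t)) * (h x + h y)" by (intro mult_right_mono C t hh)
      finally have "p x y t * (u y - u x)\<^sup>2 \<le> (C * t) * (p x y (2 * \<kappa> * t) * (h x + h y))" by (simp add: mult.assoc)
      then show "ennreal (p x y t * (u y - u x)\<^sup>2) \<le> ennreal (C * t) * ennreal (p x y (2 * \<kappa> * t) * (h x + h y))"
        using C(1) t hh p_nonneg by (simp add: ennreal_leI flip: ennreal_mult)
    qed
    also have "\<dots> = ennreal (C * t) * (\<integral>\<^sup>+x. \<integral>\<^sup>+y. ennreal (p x y (2 * \<kappa> * t) * (h x + h y)) \<partial>lborel \<partial>lborel)"
      by (simp add: nn_integral_cmult)
    also have "\<dots> \<le> ennreal (C * t) * ennreal K"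
      by (intro mult_left_mono K t') simp
    also have "\<dots> = ennreal (C * K * t)" using C(1) K(1) t by (simp add: mult_ac flip: ennreal_mult)
    also have "\<dots> \<le> ennreal ((K + C * K) * t powr (s / 2))"
    proof (rule ennreal_leI)
      have "t powr 1 \<le> t powr (s / 2)" using False t s by (intro powr_mono') auto
      then show "C * K * t \<le> (K + C * K) * t powr (s / 2)" using K C t by (intro mult_mono) auto
    qed
    finally show ?thesis .
  qed
  moreover have "K + C * K \<ge> 0" using K C by simp
  ultimately show ?thesis by blast
qed

text \<open>\<rho> is a probability density in (y, t) jointly, so Jensen's inequality is used once.
  Working with nonnegative integrals, Tonelli reorders freely and square integrability of the
  difference comes out as a result.\<close>

lemma extension_increment:
  assumes u: "schwartz u" and s: "0 < s" "s < 1"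
    and um: "u \<in> borel_measurable borel" and ub: "\<And>y. \<bar>u y\<bar> \<le> B"
  shows "\<exists>K\<ge>0. \<forall>z>0. (\<integral>\<^sup>+x. ennreal ((extension s u (x, z) - u x)\<^sup>2) \<partial>lborel) \<le> ennreal (K * z powr s)"
proof -
  obtain K where K: "K \<ge> 0" "\<And>t. t > 0 \<Longrightarrow>
      (\<integral>\<^sup>+x. \<integral>\<^sup>+y. ennreal (p x y t * (u y - u x)\<^sup>2) \<partial>lborel \<partial>lborel) \<le> ennreal (K * t powr (s / 2))"
    using heat_increment[OF u s] by blast
  obtain C where C: "C \<ge> 0" "\<And>z. z > 0 \<Longrightarrow> integrable lborel (\<lambda>t. weight s z t * t powr (s / 2))"
    "\<And>z. z > 0 \<Longrightarrow> (\<integral>t. weight s z t * t powr (s / 2) \<partial>lborel) = C * z powr s"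
    using weight_moment[OF s(1)] by blast
  note [measurable] = um p_measurable
  have "(\<integral>\<^sup>+x. ennreal ((extension s u (x, z) - u x)\<^sup>2) \<partial>lborel) \<le> ennreal (K * C * z powr s)" if z: "z > 0" for z
  proof -
    \<comment> \<open>The factor 1 matches \<open>kernel_weight_integral\<close> at c = 1.\<close>
    define \<rho> where "\<rho> x \<omega> = (case \<omega> of (y, t) \<Rightarrow> weight s z t * p x y (1 * t))" for x \<omega>
    have wz: "weight s z t = 0" if "t \<le> 0" for t using that by (simp add: weight_def)
    note kw = kernel_weight_integral[OF weight_integral(1)[OF s(1) z] weight_nonneg[OF s(1)] wz zero_less_one]
    have r: "integrable lborel (\<rho> x)" "\<rho> x \<omega> \<ge> 0" "(\<integral>\<omega>. \<rho> x \<omega> \<partial>lborel) = 1" for x \<omega>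
      unfolding \<rho>_def using kw[of x] weight_integral(2)[OF s(1) z] weight_nonneg[OF s(1)] p_nonneg
      by (auto simp: case_prod_unfold)
    have rm: "\<rho> x \<in> borel_measurable lborel" for x using r(1) by (rule borel_measurable_integrable)
    have um': "(\<lambda>\<omega> :: 'a \<times> real. u (fst \<omega>)) \<in> borel_measurable lborel"
    proof -
      have "(\<lambda>\<omega> :: 'a \<times> real. u (fst \<omega>)) \<in> borel_measurable (borel \<Otimes>\<^sub>M borel)" by measurable
      then show ?thesis by (simp add: borel_prod)
    qed
    have B: "B \<ge> 0" using ub[of undefined] by (meson abs_ge_zero order_trans)
    have fb: "\<bar>u y - u x\<bar> \<le> 2 * B" for x y using ub[of x] ub[of y] by linarith
    have i1: "integrable lborel (\<lambda>\<omega>. \<rho> x \<omega> * (u (fst \<omega>) - u x))" for x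
    proof (rule integrable_dominated[OF integrable_mult_right[OF r(1), of "2 * B"]])
      show "(\<lambda>\<omega>. \<rho> x \<omega> * (u (fst \<omega>) - u x)) \<in> borel_measurable lborel"
        by (intro borel_measurable_times borel_measurable_diff rm um') simp
      show "\<bar>\<rho> x \<omega> * (u (fst \<omega>) - u x)\<bar> \<le> 2 * B * \<rho> x \<omega>" for \<omega>
        using mult_right_mono[OF fb[of "fst \<omega>" x] r(2)[of x \<omega>]] r(2)[of x \<omega>] by (simp add: abs_mult mult.commute)
    qed
    have i2: "integrable lborel (\<lambda>\<omega>. \<rho> x \<omega> * (u (fst \<omega>) - u x)\<^sup>2)" for x
    proof (rule integrable_dominated[OF integrable_mult_right[OF r(1), of "(2 * B)\<^sup>2"]])
      show "(\<lambda>\<omega>. \<rho> x \<omega> * (u (fst \<omega>) - u x)\<^sup>2) \<in> borel_measurable lborel"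
        by (intro borel_measurable_times borel_measurable_power borel_measurable_diff rm um') simp
      show "\<bar>\<rho> x \<omega> * (u (fst \<omega>) - u x)\<^sup>2\<bar> \<le> (2 * B)\<^sup>2 * \<rho> x \<omega>" for \<omega>
      proof -
        have "(u (fst \<omega>) - u x)\<^sup>2 \<le> (2 * B)\<^sup>2" using fb[of "fst \<omega>" x] B by (intro abs_le_square_iff[THEN iffD1]) simp
        from mult_right_mono[OF this r(2)[of x \<omega>]] show ?thesis
          using r(2)[of x \<omega>] by (simp add: abs_mult mult.commute)
      qed
    qed
    have diff: "extension s u (x, z) - u x = (\<integral>\<omega>. \<rho> x \<omega> * (u (fst \<omega>) - u x) \<partial>lborel)" for x
    proof -
      have e: "ext_integrand s u (x, z) = (\<lambda>\<omega>. \<rho> x \<omega> * u (fst \<omega>))"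
        by (auto simp: ext_integrand_def \<rho>_def fun_eq_iff)
      have "integrable lborel (\<lambda>\<omega>. \<rho> x \<omega> * u (fst \<omega>))"
        using ext_integrand_integrable[OF s(1) um ub, of "(x, z)"] z by (simp add: e)
      then show ?thesis unfolding extension_def e by (simp add: right_diff_distrib r)
    qed
    have "(\<integral>\<^sup>+x. ennreal ((extension s u (x, z) - u x)\<^sup>2) \<partial>lborel)
        \<le> (\<integral>\<^sup>+x. (\<integral>\<^sup>+\<omega>. ennreal (\<rho> x \<omega> * (u (fst \<omega>) - u x)\<^sup>2) \<partial>lborel) \<partial>lborel)"
    proof (rule nn_integral_mono)
      fix x
      have "(extension s u (x, z) - u x)\<^sup>2 \<le> (\<integral>\<omega>. \<rho> x \<omega> * (u (fst \<omega>) - u x)\<^sup>2 \<partial>lborel)"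
        unfolding diff by (rule weighted_jensen[OF r i1 i2])
      then show "ennreal ((extension s u (x, z) - u x)\<^sup>2) \<le> (\<integral>\<^sup>+\<omega>. ennreal (\<rho> x \<omega> * (u (fst \<omega>) - u x)\<^sup>2) \<partial>lborel)"
        by (subst nn_integral_eq_integral[OF i2]) (auto simp: r ennreal_leI)
    qed
    also have "\<dots> = (\<integral>\<^sup>+x. (\<integral>\<^sup>+t. (\<integral>\<^sup>+y. ennreal (weight s z t * p x y t * (u y - u x)\<^sup>2) \<partial>lborel) \<partial>lborel) \<partial>lborel)"
    proof (rule nn_integral_cong)
      fix x
      have m: "(\<lambda>\<omega> :: 'a \<times> real. ennreal (weight s z (snd \<omega>) * p x (fst \<omega>) (snd \<omega>) * (u (fst \<omega>) - u x)\<^sup>2))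
          \<in> borel_measurable (lborel \<Otimes>\<^sub>M lborel)" by measurable
      have "(\<integral>\<^sup>+\<omega>. ennreal (\<rho> x \<omega> * (u (fst \<omega>) - u x)\<^sup>2) \<partial>lborel) =
         (\<integral>\<^sup>+\<omega>. ennreal (weight s z (snd \<omega>) * p x (fst \<omega>) (snd \<omega>) * (u (fst \<omega>) - u x)\<^sup>2) \<partial>(lborel \<Otimes>\<^sub>M lborel))"
        by (simp add: lborel_prod \<rho>_def case_prod_unfold)
      also have "\<dots> = (\<integral>\<^sup>+t. (\<integral>\<^sup>+y. ennreal (weight s z t * p x y t * (u y - u x)\<^sup>2) \<partial>lborel) \<partial>lborel)"
        using lborel_pair.nn_integral_snd[OF m] by simp
      finally show "(\<integral>\<^sup>+\<omega>. ennreal (\<rho> x \<omega> * (u (fst \<omega>) - u x)\<^sup>2) \<partial>lborel) =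
        (\<integral>\<^sup>+t. (\<integral>\<^sup>+y. ennreal (weight s z t * p x y t * (u y - u x)\<^sup>2) \<partial>lborel) \<partial>lborel)" .
    qed
    also have "\<dots> = (\<integral>\<^sup>+t. (\<integral>\<^sup>+x. (\<integral>\<^sup>+y. ennreal (weight s z t * p x y t * (u y - u x)\<^sup>2) \<partial>lborel) \<partial>lborel) \<partial>lborel)"
      by (rule lborel_pair.Fubini') measurable
    also have "\<dots> = (\<integral>\<^sup>+t. ennreal (weight s z t) * (\<integral>\<^sup>+x. (\<integral>\<^sup>+y. ennreal (p x y t * (u y - u x)\<^sup>2) \<partial>lborel) \<partial>lborel) \<partial>lborel)"
    proof (rule nn_integral_cong)
      fix t
      have "(\<integral>\<^sup>+x. (\<integral>\<^sup>+y. ennreal (weight s z t * p x y t * (u y - u x)\<^sup>2) \<partial>lborel) \<partial>lborel) =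
         (\<integral>\<^sup>+x. (\<integral>\<^sup>+y. ennreal (weight s z t) * ennreal (p x y t * (u y - u x)\<^sup>2) \<partial>lborel) \<partial>lborel)"
        by (simp add: weight_nonneg[OF s(1)] p_nonneg mult.assoc flip: ennreal_mult)
      also have "\<dots> = ennreal (weight s z t) * (\<integral>\<^sup>+x. (\<integral>\<^sup>+y. ennreal (p x y t * (u y - u x)\<^sup>2) \<partial>lborel) \<partial>lborel)"
        by (simp add: nn_integral_cmult)
      finally show "(\<integral>\<^sup>+x. (\<integral>\<^sup>+y. ennreal (weight s z t * p x y t * (u y - u x)\<^sup>2) \<partial>lborel) \<partial>lborel) =
         ennreal (weight s z t) * (\<integral>\<^sup>+x. (\<integral>\<^sup>+y. ennreal (p x y t * (u y - u x)\<^sup>2) \<partial>lborel) \<partial>lborel)" .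
    qed
    also have "\<dots> \<le> (\<integral>\<^sup>+t. ennreal (K * (weight s z t * t powr (s / 2))) \<partial>lborel)"
    proof (rule nn_integral_mono)
      fix t
      show "ennreal (weight s z t) * (\<integral>\<^sup>+x. (\<integral>\<^sup>+y. ennreal (p x y t * (u y - u x)\<^sup>2) \<partial>lborel) \<partial>lborel)
          \<le> ennreal (K * (weight s z t * t powr (s / 2)))"
      proof (cases "t > 0")
        case True
        have "ennreal (weight s z t) * (\<integral>\<^sup>+x. (\<integral>\<^sup>+y. ennreal (p x y t * (u y - u x)\<^sup>2) \<partial>lborel) \<partial>lborel)
            \<le> ennreal (weight s z t) * ennreal (K * t powr (s / 2))"
          by (intro mult_left_mono K True) simp
        also have "\<dots> = ennreal (K * (weight s z t * t powr (s / 2)))"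
          using weight_nonneg[OF s(1), of z t] K(1) by (simp add: mult_ac flip: ennreal_mult)
        finally show ?thesis .
      qed (simp add: weight_def)
    qed
    also have "\<dots> = ennreal (\<integral>t. K * (weight s z t * t powr (s / 2)) \<partial>lborel)"
      by (intro nn_integral_eq_integral integrable_mult_right C z) (simp add: K weight_nonneg[OF s(1)])
    also have "\<dots> = ennreal (K * C * z powr s)" by (simp add: C(3)[OF z] mult.assoc)
    finally show ?thesis .
  qed
  then show ?thesis using K C(1) by (intro exI[of _ "K * C"]) auto
qed

lemma extension_tendsto_L2:
  assumes u: "schwartz u" and s: "0 < s" "s < 1"
    and um: "u \<in> borel_measurable borel" and ub: "\<And>y. \<bar>u y\<bar> \<le> B"
  shows "tendsto_L2 (\<lambda>z x. extension s u (x, z)) u (at_right 0)"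
proof -
  obtain K where K: "K \<ge> 0" "\<And>z. z > 0 \<Longrightarrow>
     (\<integral>\<^sup>+x. ennreal ((extension s u (x, z) - u x)\<^sup>2) \<partial>lborel) \<le> ennreal (K * z powr s)"
    using extension_increment[OF u s um ub] by blast
  obtain h where h: "integrable lborel h" "\<And>x. (u x)\<^sup>2 \<le> h x"
    using schwartz_increment[OF u] by blast
  have u2: "integrable lborel (\<lambda>x. (u x)\<^sup>2)"
    by (rule integrable_dominated[OF h(1)]) (use um h(2) in auto)
  have em: "(\<lambda>x. extension s u (x, z)) \<in> borel_measurable borel" if z: "z > 0" for z
  proof -
    have "continuous_on UNIV (\<lambda>x. extension s u (x, z))"
      using C_k_on_continuous[OF C_k_on_slice_fst[OF open_upper_half C2_extension[OF s(1) um ub]], of z] z by simp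
    then show ?thesis by (rule borel_measurable_continuous_onI)
  qed
  have d2: "integrable lborel (\<lambda>x. (extension s u (x, z) - u x)\<^sup>2)"
    and dle: "(\<integral>x. (extension s u (x, z) - u x)\<^sup>2 \<partial>lborel) \<le> K * z powr s" if z: "z > 0" for z
  proof -
    have m: "(\<lambda>x. (extension s u (x, z) - u x)\<^sup>2) \<in> borel_measurable lborel" using em[OF z] um by simp
    show i: "integrable lborel (\<lambda>x. (extension s u (x, z) - u x)\<^sup>2)"
      by (rule integrableI_nonneg[OF m]) (auto intro: order_le_less_trans[OF K(2)[OF z]])
    have "ennreal (\<integral>x. (extension s u (x, z) - u x)\<^sup>2 \<partial>lborel) \<le> ennreal (K * z powr s)"
      using K(2)[OF z] nn_integral_eq_integral[OF i] by simp
    then show "(\<integral>x. (extension s u (x, z) - u x)\<^sup>2 \<partial>lborel) \<le> K * z powr s" using K(1) by simp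
  qed
  have sq: "square_integrable (\<lambda>x. extension s u (x, z))" if z: "z > 0" for z
    unfolding square_integrable_def
  proof
    show "(\<lambda>x. extension s u (x, z)) \<in> borel_measurable lborel" using em[OF z] by simp
    show "integrable lborel (\<lambda>x. (extension s u (x, z))\<^sup>2)"
    proof (rule integrable_dominated)
      show "integrable lborel (\<lambda>x. 2 * (extension s u (x, z) - u x)\<^sup>2 + 2 * (u x)\<^sup>2)"
        by (intro Bochner_Integration.integrable_add integrable_mult_right d2[OF z] u2)
      \<comment> \<open>The right side minus the left is the square of
        \<open>extension s u (x, z) - 2 * u x\<close>.\<close>
      show "\<bar>(extension s u (x, z))\<^sup>2\<bar> \<le> 2 * (extension s u (x, z) - u x)\<^sup>2 + 2 * (u x)\<^sup>2" for x
        using zero_le_power2[of "extension s u (x, z) - 2 * u x"] by (simp add: power2_eq_square algebra_simps)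
    qed (use em[OF z] in simp)
  qed
  have lim: "((\<lambda>z. sqrt (\<integral>x. (extension s u (x, z) - u x)\<^sup>2 \<partial>lborel)) \<longlongrightarrow> 0) (at_right 0)"
  proof (rule tendsto_sandwich[where f = "\<lambda>_. 0" and h = "\<lambda>z. sqrt (K * z powr s)"])
    show "\<forall>\<^sub>F z in at_right 0. 0 \<le> sqrt (\<integral>x. (extension s u (x, z) - u x)\<^sup>2 \<partial>lborel)"
      by (intro always_eventually allI real_sqrt_ge_zero integral_nonneg_AE) auto
    show "\<forall>\<^sub>F z in at_right 0. sqrt (\<integral>x. (extension s u (x, z) - u x)\<^sup>2 \<partial>lborel) \<le> sqrt (K * z powr s)"
      using eventually_at_right_less[of 0] by eventually_elim (simp add: dle)
    have "((\<lambda>z. z powr s) \<longlongrightarrow> 0 powr s) (at_right 0)"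
      using s by (intro tendsto_powr' tendsto_intros) (auto intro: eventually_mono[OF eventually_at_right_less])
    then have "((\<lambda>z. sqrt (K * z powr s)) \<longlongrightarrow> sqrt (K * 0)) (at_right 0)"
      using s by (intro tendsto_intros) simp
    then show "((\<lambda>z. sqrt (K * z powr s)) \<longlongrightarrow> 0) (at_right 0)" by simp
  qed simp
  show ?thesis unfolding tendsto_L2_def
  proof (intro conjI lim)
    show "square_integrable u" using um u2 by (simp add: square_integrable_def)
    show "\<forall>\<^sub>F z in at_right 0. square_integrable (\<lambda>x. extension s u (x, z))"
      using eventually_at_right_less[of 0] by eventually_elim (rule sq)
  qed
qed


section \<open>Return to the Poisson kernel\<close>

lemma poisson_integrand_integrable:
  assumes s: "s > 0" and z: "z > 0"
  shows "set_integrable lborel {0<..} (poisson_integrand p (1 - 2 * s) z x y)"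
proof -
  define \<epsilon> where "\<epsilon> = z\<^sup>2 / 8"
  have \<epsilon>: "\<epsilon> > 0" using z by (simp add: \<epsilon>_def)
  obtain C where C: "C > 0" "\<And>y t. t > 0 \<Longrightarrow> p x y t \<le> C * exp (\<epsilon> / t)"
    using p_small_time[OF \<epsilon>, of x] by blast
  note G = inverse_gamma_integral(1)[OF \<epsilon> s, unfolded set_integrable_def]
  note [measurable] = p_measurable
  show ?thesis unfolding set_integrable_def
  proof (rule integrable_dominated[OF integrable_mult_right[OF G, of C]])
    show "(\<lambda>t. indicator {0<..} t *\<^sub>R poisson_integrand p (1 - 2 * s) z x y t) \<in> borel_measurable lborel"
      unfolding poisson_integrand_def by measurable
    fix t :: real
    show "\<bar>indicator {0<..} t *\<^sub>R poisson_integrand p (1 - 2 * s) z x y t\<bar>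
       \<le> C * (indicator {0<..} t *\<^sub>R (exp (- \<epsilon> / t) / t powr (1 + s)))"
    proof (cases "t > 0")
      case True
      have ex: "(3 - (1 - 2 * s)) / 2 = 1 + s" by simp
      have "exp (- z\<^sup>2 / (4 * t)) / t powr (1 + s) * p x y t \<le> exp (- z\<^sup>2 / (4 * t)) / t powr (1 + s) * (C * exp (\<epsilon> / t))"
        by (intro mult_left_mono C True) simp
      also have "\<dots> = C * (exp (- z\<^sup>2 / (4 * t)) * exp (\<epsilon> / t) / t powr (1 + s))" by simp
      also have "exp (- z\<^sup>2 / (4 * t)) * exp (\<epsilon> / t) = exp (- \<epsilon> / t)"
        using True by (simp add: \<epsilon>_def flip: exp_add)
      finally show ?thesis using True p_nonneg by (simp only: poisson_integrand_def ex) simp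
    qed simp
  qed
qed

text \<open>With a = 1 - 2 s the exponents 1 - a and (3 - a) / 2 are 2 s and 1 + s, which are those
  of the weight.\<close>

lemma poisson_kernel_eq:
  assumes z: "z > 0"
  shows "poisson_kernel p (1 - 2 * s) z x y * u y = (\<integral>t. ext_integrand s u (x, z) (y, t) \<partial>lborel)"
proof -
  define k where "k = 1 / (2 powr (2 * s) * Gamma s) * z powr (2 * s)"
  have e: "1 - (1 - 2 * s) = 2 * s" "2 * s / 2 = s" "(3 - (1 - 2 * s)) / 2 = 1 + s" by simp_all
  have "ext_integrand s u (x, z) (y, t) = k * (indicator {0<..} t *\<^sub>R poisson_integrand p (1 - 2 * s) z x y t) * u y" for t
    unfolding poisson_integrand_def e by (simp add: ext_integrand_def weight_def k_def indicator_def)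
  then show ?thesis
    unfolding poisson_kernel_def e by (simp add: set_lebesgue_integral_def k_def)
qed

text \<open>Fubini: the iterated integral, first in t and then in y, is the integral over the
  product that defines \<open>extension\<close>.\<close>

lemma poisson_kernel_integral:
  assumes s: "s > 0" and um: "u \<in> borel_measurable borel" and ub: "\<And>y. \<bar>u y\<bar> \<le> B" and z: "z > 0"
  shows "integrable lborel (\<lambda>y. poisson_kernel p (1 - 2 * s) z x y * u y)"
    and "(\<integral>y. poisson_kernel p (1 - 2 * s) z x y * u y \<partial>lborel) = extension s u (x, z)"
proof -
  have "integrable lborel (ext_integrand s u (x, z))"
    using ext_integrand_integrable[OF s um ub, of "(x, z)"] z by simp
  then have i: "integrable (lborel \<Otimes>\<^sub>M lborel) (ext_integrand s u (x, z))" by (simp add: lborel_prod)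
  show "integrable lborel (\<lambda>y. poisson_kernel p (1 - 2 * s) z x y * u y)"
    unfolding poisson_kernel_eq[OF z] by (rule lborel_pair.integrable_fst'[OF i])
  show "(\<integral>y. poisson_kernel p (1 - 2 * s) z x y * u y \<partial>lborel) = extension s u (x, z)"
    unfolding poisson_kernel_eq[OF z] extension_def using lborel_pair.integral_fst'[OF i] by (simp add: lborel_prod)
qed

end

text \<open>Integrals and derivatives are total functions with default values, so convergence of
  both integrals and C^2 regularity of U in (x, z) are part of the conclusion; they give the
  equation its intended meaning.\<close>

theorem proposition10p6:
  fixes X :: "'m::finite \<Rightarrow> real ^ 'n \<Rightarrow> real ^ 'n"
    and p :: "real ^ 'n \<Rightarrow> real ^ 'n \<Rightarrow> real \<Rightarrow> real"
    and u :: "real ^ 'n \<Rightarrow> real"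
    and U :: "real ^ 'n \<Rightarrow> real \<Rightarrow> real"
    and M s a :: real
  assumes "CARD('n) \<ge> 3"
    and "\<And>i. smooth_on (X i) UNIV"
    and "hormander X"
    and "laplacian_off_compact X"
    and "heat_kernel X p"
    and "M > 0"
    and "gaussian_upper X M p"
    and "gaussian_lower X M p"
    and "\<And>x t. t > 0 \<Longrightarrow> has_bochner_integral lborel (\<lambda>y. p x y t) 1"
    and "0 < s" and "s < 1" and "a = 1 - 2 * s"
    and "schwartz u"
    and "\<And>x z. z > 0 \<Longrightarrow> U x z = (LINT y|lborel. poisson_kernel p a z x y * u y)"
  shows "(\<forall>x z. z > 0 \<longrightarrow>
            (\<forall>y. set_integrable lborel {0<..} (poisson_integrand p a z x y)) \<and>
            integrable lborel (\<lambda>y. poisson_kernel p a z x y * u y))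
       \<and> C_k_on 2 (\<lambda>(x, z). U x z) {(x, z). z > 0}
       \<and> (\<forall>x z. z > 0 \<longrightarrow> extension_op X a U x z = 0)
       \<and> tendsto_L2 (\<lambda>z x. U x z) u (at_right 0)"
proof -
  interpret gaussian_heat_kernel X p M
    by unfold_locales (use assms in auto)
  have um: "u \<in> borel_measurable borel"
    using assms(13) C_k_on_continuous[OF smooth_on_C_k[of u UNIV 0]]
    by (auto simp: schwartz_def intro!: borel_measurable_continuous_onI)
  obtain B where ub: "\<And>y. \<bar>u y\<bar> \<le> B"
    using schwartz_decay[OF assms(13), of "[]" 0] by (auto simp: pderivs_def)
  note s = assms(10,11) and a = assms(12)
  have U: "U x z = extension s u (x, z)" if "z > 0" for x z
    using assms(14)[OF that, of x] poisson_kernel_integral(2)[OF s(1) um ub that, of x] by (simp add: a)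
  have "C_k_on 2 (\<lambda>(x, z). U x z) {(x, z). z > 0}"
  proof -
    have "{(x, z). z > 0} = {w :: (real ^ 'n) \<times> real. snd w > 0}" by auto
    then show ?thesis
      using C_k_on_cong_imp[OF open_upper_half _ C2_extension[OF s(1) um ub], of "\<lambda>(x, z). U x z"] U by auto
  qed
  moreover have "extension_op X a U x z = 0" if z: "z > 0" for x z
  proof -
    \<comment> \<open>U is unconstrained for z \<le> 0, so derivatives are compared only through
      agreement near a positive z'.\<close>
    have d: "deriv (U x) z' = deriv (\<lambda>z. extension s u (x, z)) z'" if "z' > 0" for z'
      by (rule deriv_cong_ev[OF _ refl]) (use U that eventually_nhds_in_open[of "{0<..}" z'] in \<open>auto elim!: eventually_mono\<close>)
    have "deriv (deriv (U x)) z = deriv (deriv (\<lambda>z. extension s u (x, z))) z"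
      by (rule deriv_cong_ev[OF _ refl]) (use d z eventually_nhds_in_open[of "{0<..}" z] in \<open>auto elim!: eventually_mono\<close>)
    then have "bessel_op a (U x) z = bessel_op a (\<lambda>z. extension s u (x, z)) z"
      unfolding bessel_op_def d[OF z] by simp
    moreover have "(\<lambda>\<xi>. U \<xi> z) = (\<lambda>\<xi>. extension s u (\<xi>, z))" using U[OF z] by (rule ext)
    ultimately show ?thesis
      unfolding extension_op_def using extension_equation[OF s(1) um ub z, of x] by (simp add: a)
  qed
  moreover have "tendsto_L2 (\<lambda>z x. U x z) u (at_right 0)"
  proof -
    have T: "tendsto_L2 (\<lambda>z x. extension s u (x, z)) u (at_right 0)"
      by (rule extension_tendsto_L2[OF assms(13) s um ub])
    have ev: "\<forall>\<^sub>F z in at_right 0. (\<lambda>x. U x z) = (\<lambda>x. extension s u (x, z))"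
      using eventually_at_right_less[of 0] by eventually_elim (simp add: U)
    have "\<forall>\<^sub>F z in at_right 0. square_integrable (\<lambda>x. U x z)"
      using T ev unfolding tendsto_L2_def by (auto elim: eventually_elim2)
    moreover have "((\<lambda>z. sqrt (LINT x|lborel. (U x z - u x)\<^sup>2)) \<longlongrightarrow> 0) (at_right 0)"
    proof (rule Lim_transform_eventually)
      show "((\<lambda>z. sqrt (LINT x|lborel. (extension s u (x, z) - u x)\<^sup>2)) \<longlongrightarrow> 0) (at_right 0)"
        using T by (simp add: tendsto_L2_def)
      show "\<forall>\<^sub>F z in at_right 0. sqrt (LINT x|lborel. (extension s u (x, z) - u x)\<^sup>2) = sqrt (LINT x|lborel. (U x z - u x)\<^sup>2)"
        using ev by eventually_elim (simp add: fun_eq_iff)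
    qed
    ultimately show ?thesis using T by (simp add: tendsto_L2_def)
  qed
  ultimately show ?thesis
    using poisson_integrand_integrable[OF s(1)] poisson_kernel_integral(1)[OF s(1) um ub] by (auto simp: a)
qed

end
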